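(* Let $p,q\in\mathbb{N}$. For $s_1,\dots,s_p\in\mathbb{C}$ and $l_1,\dots,l_q\in\mathbb{N}_0$ we have \begin{align*} &\zeta_p^{\rm des}(s_1,\dots,s_p)\,\zeta_q^{\rm des}(-l_1,\dots,-l_q)\\ &=\sum_{\substack{i_b+j_b=l_b\\ i_b,j_b\ge0\\ 1\le b\le q}}\prod_{a=1}^q(-1)^{i_a}\binom{l_a}{i_a}\,\zeta_{p+q}^{\rm des}(s_1,\dots,s_{p-1},s_p-i_1-\cdots-i_q,-j_1,\dots,-j_q). \end{align*}
   Context: For $c\in\mathbb{R}$ let $\tilde{\mathfrak{H}}_n(t_1,\dots,t_n;c)=\prod_{j=1}^n\left(\frac{1}{\exp(\sum_{k=j}^n t_k)-1}-\frac{c}{\exp(c\sum_{k=j}^n t_k)-1}\right)$. For non-integral $s_1,\dots,s_n\in\mathbb{C}$ the desingularized multiple zeta-function is \[ \zeta_n^{\rm des}(s_1,\dots,s_n):=\lim_{\substack{c\to1\\ c\in\mathbb{R}\setminus\{1\}}}\frac{1}{(1-c)^n}\prod_{k=1}^n\frac{1}{(e^{2\pi i s_k}-1)\Gamma(s_k)}\int_{\mathcal{C}^n}\tilde{\mathfrak{H}}_n(t_1,\dots,t_n;c)\prod_{k=1}^n t_k^{s_k-1}\,dt_k, \] where $\mathcal{C}$ is the Hankel contour (positive real axis top side, a small circle around $0$, positive real axis bottom side); it is known that this extends to an entire function on $\mathbb{C}^n$, still denoted $\zeta_n^{\rm des}$, and its values at non-positive integer points are the desingularized values. *)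

theory Defs
  imports "HOL-Complex_Analysis.Complex_Analysis"
begin

text \<open>
  A point \<open>(s\<^sub>1, \<dots>, s\<^sub>n)\<close> of \<open>\<complex>\<^sup>n\<close> is represented by a function \<open>s :: nat \<Rightarrow> complex\<close> of which
  only the values at \<open>1, \<dots>, n\<close> matter.
\<close>

text \<open>
  At a point where some \<open>t\<^sub>j + \<dots> + t\<^sub>n\<close> vanishes, the \<open>j\<close>-th factor has a removable singularity,
  which is not filled in here (division by zero yields zero). Such points form a null set
  in the integral below.
\<close>

definition desing_H :: "nat \<Rightarrow> (nat \<Rightarrow> complex) \<Rightarrow> real \<Rightarrow> complex" where
  "desing_H n t c =
     (\<Prod>j=1..n. 1 / (exp (\<Sum>k=j..n. t k) - 1)
       - of_real c / (exp (of_real c * (\<Sum>k=j..n. t k)) - 1))"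

text \<open>
  The Hankel contour with circle radius \<open>\<epsilon>\<close>, parametrised over the real line: for \<open>u < 0\<close> it
  runs from \<open>+\<infinity>\<close> to \<open>\<epsilon>\<close> on the top side of the positive real axis (argument \<open>0\<close>), for
  \<open>0 \<le> u \<le> 2\<pi>\<close> once counterclockwise around the circle, and for \<open>u > 2\<pi>\<close> back from \<open>\<epsilon>\<close> to \<open>+\<infinity>\<close>
  on the bottom side (argument \<open>2\<pi>\<close>). Modulus and argument are kept separately because the branch
  of \<open>t\<^sup>z\<close> is the one continued along the contour.
\<close>

definition hankel_abs :: "real \<Rightarrow> real \<Rightarrow> real" where
  "hankel_abs \<epsilon> u = (if u < 0 then \<epsilon> - u else if u \<le> 2 * pi then \<epsilon> else \<epsilon> + (u - 2 * pi))"

definition hankel_arg :: "real \<Rightarrow> real" where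
  "hankel_arg u = (if u < 0 then 0 else if u \<le> 2 * pi then u else 2 * pi)"

definition hankel :: "real \<Rightarrow> real \<Rightarrow> complex" where
  "hankel \<epsilon> u = of_real (hankel_abs \<epsilon> u) * cis (hankel_arg u)"

definition hankel_powr :: "real \<Rightarrow> real \<Rightarrow> complex \<Rightarrow> complex" where
  "hankel_powr \<epsilon> u z = exp (z * (of_real (ln (hankel_abs \<epsilon> u)) + \<i> * of_real (hankel_arg u)))"

definition hankel_integral :: "nat \<Rightarrow> real \<Rightarrow> (nat \<Rightarrow> complex) \<Rightarrow> real \<Rightarrow> complex" where
  "hankel_integral n \<epsilon> s c =
     (\<integral>u. desing_H n (\<lambda>k. hankel \<epsilon> (u k)) c
            * (\<Prod>k=1..n. hankel_powr \<epsilon> (u k) (s k - 1) * vector_derivative (hankel \<epsilon>) (at (u k)))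
        \<partial>(\<Pi>\<^sub>M k\<in>{1..n}. lborel))"

definition desing_approx :: "nat \<Rightarrow> real \<Rightarrow> (nat \<Rightarrow> complex) \<Rightarrow> real \<Rightarrow> complex" where
  "desing_approx n \<epsilon> s c =
     1 / (1 - of_real c) ^ n
     * (\<Prod>k=1..n. 1 / ((exp (2 * of_real pi * \<i> * s k) - 1) * Gamma (s k)))
     * hankel_integral n \<epsilon> s c"

text \<open>
  Entire functions on \<open>\<complex>\<^sup>n\<close>: jointly continuous and holomorphic in each variable. As \<open>F\<close> depends
  on the coordinates \<open>1, \<dots>, n\<close> only, continuity for the product topology on \<open>nat \<Rightarrow> complex\<close> is
  continuity on \<open>\<complex>\<^sup>n\<close>.
\<close>

definition entire_Cn :: "nat \<Rightarrow> ((nat \<Rightarrow> complex) \<Rightarrow> complex) \<Rightarrow> bool" where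
  "entire_Cn n F \<longleftrightarrow>
     (\<forall>s s'. (\<forall>k\<in>{1..n}. s k = s' k) \<longrightarrow> F s = F s') \<and>
     continuous_on UNIV F \<and>
     (\<forall>s. \<forall>k\<in>{1..n}. (\<lambda>z. F (s(k := z))) holomorphic_on UNIV)"

text \<open>
  The desingularized multiple zeta function is the entire function given at non-integral points by
  the limit \<open>c \<rightarrow> 1\<close> of the contour integrals, for any sufficiently small radius \<open>\<epsilon>\<close> of the circle.
\<close>

definition zeta_des :: "nat \<Rightarrow> (nat \<Rightarrow> complex) \<Rightarrow> complex" where
  "zeta_des n =
     (THE F. entire_Cn n F \<and>
        (\<forall>s. (\<forall>k\<in>{1..n}. s k \<notin> \<int>) \<longrightarrow>
           (\<forall>\<^sub>F \<epsilon> in at_right 0. (desing_approx n \<epsilon> s \<longlongrightarrow> F s) (at 1))))"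

end

theory Submission
  imports Defs "HOL-Real_Asymp.Real_Asymp"
begin

text \<open>
  Put \<open>\<beta>(x) = x / (e\<^sup>x - 1)\<close>. As \<open>c \<rightarrow> 1\<close>, the factors of the integrand, divided by \<open>1 - c\<close>, tend to
  \<open>\<beta>'(t\<^sub>j + \<dots> + t\<^sub>n)\<close>. The normalised one-variable Hankel integral of \<open>f(x + t)\<close> is the Weyl fractional
  integral \<open>W\<^sub>z f(x) = 1/\<Gamma>(z) \<integral>\<^sub>0\<^sup>\<infinity> f(x + t) t\<^bsup>z-1\<^esup> dt\<close>, continued to all \<open>z\<close> by \<open>W\<^sub>z f = W\<^bsub>z+1\<^esub> (D f)\<close>
  with \<open>D = - d/dx\<close>. Integrating over \<open>t\<^sub>1, t\<^sub>2, \<dots>\<close> in turn, the multiple zeta function becomes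
  \<open>W\<^bsub>s\<^sub>n\<^esub> (\<beta>' W\<^bsub>s\<^sub>n\<^sub>-\<^sub>1\<^esub> (\<beta>' \<dots> W\<^bsub>s\<^sub>1\<^esub> \<beta>'))\<close> at \<open>0\<close>, which is entire in \<open>s\<close>.

  Since \<open>W\<^bsub>z-i\<^esub> = D\<^sup>i W\<^sub>z\<close> and \<open>W\<^bsub>-l\<^esub> = D\<^sup>l\<close>, the product formula reduces to the identity
  \<open>\<Sum>\<^sub>i (-1)\<^sup>i (l choose i) D\<^bsup>l-i\<^esup> (g D\<^sup>i f) = f D\<^sup>l g\<close> for the derivation \<open>D\<close>, applied \<open>q\<close> times.
\<close>

section \<open>Integrals depending on a parameter\<close>

text \<open>Everything takes place in one class of functions, \<open>decaying\<close>, preserved by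
  D, by multiplication with \<beta>' and by W_z for every z. Its domain is a half-strip, because the
  contour moves an argument to the right by any amount but in other directions only by \<epsilon>.
  Its bounds are uniform over families, because holomorphy in s, joint continuity and dominated
  convergence all need one constant for many functions. The constants form a chain. \<beta> decays
  like exp(-3x/4), the missing quarter absorbing the factor x. Near 1, c \<ge> 2/3 leaves the rate
  1/2 = (2/3)(3/4), while c \<le> 3/2 stretches \<open>strip 1\<close> to
  \<open>strip (3 / 2)\<close>. A Cauchy disc of radius 1/2 leads to \<open>strip 2\<close>, and
  \<open>strip 3\<close> still avoids the poles at nonzero multiples of 2 pi i. The variables can be
  integrated out in turn because t_1 occurs only in the factor j = 1, and there only through t_1 +
  (t_2 + ... + t_n): what remains is a function of the later sum. As \<open>zeta_des\<close> is a
  definite description, uniqueness has to be shown too; it follows from continuity and the density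
  of the non-integral points.\<close>

text \<open>In a first-countable space, limits along \<open>at a\<close> can be tested on sequences.
  Domination is asked only eventually: a quotient by \<open>h\<close>, or the parameter
  \<open>c\<close>, is controlled only near its limit and away from the limit point itself.\<close>

lemma dominated_convergence_at:
  fixes f :: "'b::first_countable_topology \<Rightarrow> 'a \<Rightarrow> 'c::{banach, second_countable_topology}"
  assumes lim: "\<And>u. u \<in> space M \<Longrightarrow> ((\<lambda>y. f y u) \<longlongrightarrow> l u) (at a)"
    and meas: "\<forall>\<^sub>F y in at a. f y \<in> borel_measurable M"
    and bound: "\<forall>\<^sub>F y in at a. \<forall>u\<in>space M. norm (f y u) \<le> g u"
    and g: "integrable M g"
  shows "((\<lambda>y. \<integral>u. f y u \<partial>M) \<longlongrightarrow> (\<integral>u. l u \<partial>M)) (at a)"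
proof (subst tendsto_at_iff_sequentially, intro allI impI)
  fix X assume X: "\<forall>i. X i \<in> UNIV - {a}" "X \<longlonglongrightarrow> a"
  have Xlim: "filterlim X (at a) sequentially"
    using X by (auto simp: filterlim_at)
  have "\<forall>\<^sub>F i in sequentially. f (X i) \<in> borel_measurable M \<and> (\<forall>u\<in>space M. norm (f (X i) u) \<le> g u)"
    by (rule eventually_compose_filterlim[OF eventually_conj[OF meas bound] Xlim])
  then obtain N where N: "\<And>i. i \<ge> N \<Longrightarrow> f (X i) \<in> borel_measurable M"
      "\<And>i u. i \<ge> N \<Longrightarrow> u \<in> space M \<Longrightarrow> norm (f (X i) u) \<le> g u"
    by (auto simp: eventually_sequentially)
  have L: "(\<lambda>i. f (X (i + N)) u) \<longlonglongrightarrow> l u" if "u \<in> space M" for u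
    using filterlim_compose[OF lim[OF that] Xlim] by (rule LIMSEQ_ignore_initial_segment)
  have ml: "l \<in> borel_measurable M"
    by (rule borel_measurable_LIMSEQ_metric[OF _ L]) (use N in auto)
  have "(\<lambda>i. \<integral>u. f (X (i + N)) u \<partial>M) \<longlonglongrightarrow> (\<integral>u. l u \<partial>M)"
    by (rule integral_dominated_convergence[where w = g]) (use ml g L N in auto)
  then show "((\<lambda>y. \<integral>u. f y u \<partial>M) \<circ> X) \<longlonglongrightarrow> (\<integral>u. l u \<partial>M)"
    by (auto simp: o_def intro: LIMSEQ_offset)
qed

lemma deriv_bound_cball:
  assumes "f holomorphic_on S" "cball z r \<subseteq> S" "r > 0" "\<And>w. w \<in> cball z r \<Longrightarrow> norm (f w) \<le> B"
  shows "norm (deriv f z) \<le> B / r"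
proof -
  have "norm ((deriv ^^ 1) f z) \<le> fact 1 * B / r ^ 1"
  proof (rule Cauchy_inequality)
    show "f holomorphic_on ball z r" "continuous_on (cball z r) f"
      using assms holomorphic_on_subset holomorphic_on_imp_continuous_on
      by (meson ball_subset_cball order.trans)+
  qed (use assms in \<open>auto simp: dist_norm\<close>)
  then show ?thesis by simp
qed

text \<open>The radius is spent in two halves: \<open>r\<close> for the way from z to z + h, and
  another \<open>r\<close> for a Cauchy disc about each point of \<open>cball z r\<close>.\<close>

lemma quotient_bound_cball:
  assumes hol: "f holomorphic_on S" and sub: "cball z (2 * r) \<subseteq> S" and r: "r > 0"
    and B: "\<And>w. w \<in> cball z (2 * r) \<Longrightarrow> norm (f w) \<le> B" and h: "norm h \<le> r"
  shows "norm (f (z + h) - f z) \<le> B / r * norm h"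
proof -
  have hol': "f holomorphic_on ball z (2 * r)"
    using hol by (rule holomorphic_on_subset) (use sub in \<open>auto\<close>)
  have "norm (f (z + h) - f z) \<le> B / r * norm (z + h - z)"
  proof (rule field_differentiable_bound[where S = "cball z r"])
    fix w assume w: "w \<in> cball z r"
    then have wb: "w \<in> ball z (2 * r)" using r by auto
    show "(f has_field_derivative deriv f w) (at w within cball z r)"
      using holomorphic_derivI[OF hol' open_ball wb] by (rule has_field_derivative_at_within)
    have wsub: "cball w r \<subseteq> cball z (2 * r)"
      using w by (auto simp: dist_norm) (smt (verit) dist_commute dist_norm dist_triangle)
    show "norm (deriv f w) \<le> B / r"
      by (rule deriv_bound_cball[OF hol _ r]) (use wsub sub B in auto)
  qed (use h r in \<open>auto simp: dist_norm\<close>)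
  then show ?thesis by simp
qed

text \<open>By Cauchy's estimate the bound \<open>g\<close> on the function itself also bounds its
  difference quotients, by \<open>g / r\<close>; so dominated convergence applies without any
  assumption on the derivative.\<close>

lemma holomorphic_parametric_integral:
  fixes f :: "complex \<Rightarrow> 'a \<Rightarrow> complex"
  assumes Z: "open Z"
    and hol: "\<And>u. u \<in> space M \<Longrightarrow> (\<lambda>z. f z u) holomorphic_on Z"
    and meas: "\<And>z. z \<in> Z \<Longrightarrow> f z \<in> borel_measurable M"
    and bound: "\<And>z u. z \<in> Z \<Longrightarrow> u \<in> space M \<Longrightarrow> norm (f z u) \<le> g u"
    and g: "integrable M g" and z: "z \<in> Z"
  shows "((\<lambda>z. \<integral>u. f z u \<partial>M) has_field_derivative (\<integral>u. deriv (\<lambda>z. f z u) z \<partial>M)) (at z)"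
proof -
  obtain R where R: "R > 0" "cball z R \<subseteq> Z"
    using Z z open_contains_cball by blast
  define r where "r = R / 2"
  have r: "r > 0" "cball z (2 * r) \<subseteq> Z" using R by (auto simp: r_def)
  have zh: "z + h \<in> Z" if "norm h \<le> r" for h
    using that r by (intro subsetD[OF r(2)]) (auto simp: dist_norm)
  have int: "integrable M (f w)" if "w \<in> Z" for w
    by (rule Bochner_Integration.integrable_bound[OF g]) (use meas bound that in \<open>auto intro!: AE_I2 order_trans[OF bound abs_ge_self]\<close>)
  have ev: "\<forall>\<^sub>F h in at 0. norm h \<le> r \<and> h \<noteq> (0::complex)"
    using r(1) unfolding eventually_at by (intro exI[of _ r]) (auto simp: dist_norm)
  have "((\<lambda>h. \<integral>u. (f (z + h) u - f z u) / h \<partial>M) \<longlongrightarrow> (\<integral>u. deriv (\<lambda>z. f z u) z \<partial>M)) (at 0)"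
  proof (rule dominated_convergence_at[where g = "\<lambda>u. g u / r"])
    show "((\<lambda>h. (f (z + h) u - f z u) / h) \<longlongrightarrow> deriv (\<lambda>z. f z u) z) (at 0)" if "u \<in> space M" for u
      using holomorphic_derivI[OF hol[OF that] Z z, of UNIV] by (simp add: DERIV_def)
    show "\<forall>\<^sub>F h in at 0. (\<lambda>u. (f (z + h) u - f z u) / h) \<in> borel_measurable M"
      using ev by eventually_elim (intro borel_measurable_divide borel_measurable_diff meas zh z, auto)
    show "\<forall>\<^sub>F h in at 0. \<forall>u\<in>space M. norm ((f (z + h) u - f z u) / h) \<le> g u / r"
      using ev
    proof (eventually_elim, intro ballI)
      fix h u assume h: "norm h \<le> r \<and> h \<noteq> (0::complex)" and u: "u \<in> space M"
      have "norm (f (z + h) u - f z u) \<le> g u / r * norm h"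
        by (rule quotient_bound_cball[OF hol[OF u] r(2,1)]) (use h bound[OF _ u] r in auto)
      then show "norm ((f (z + h) u - f z u) / h) \<le> g u / r"
        using h r(1) by (simp add: norm_divide divide_simps split: if_splits)
    qed
    show "integrable M (\<lambda>u. g u / r)" using g by simp
  qed
  moreover have "\<forall>\<^sub>F h in at 0. (\<integral>u. (f (z + h) u - f z u) / h \<partial>M)
      = ((\<integral>u. f (z + h) u \<partial>M) - (\<integral>u. f z u \<partial>M)) / h"
    using ev by eventually_elim (simp add: int zh z)
  ultimately show ?thesis
    unfolding DERIV_def by (rule Lim_transform_eventually)
qed

section \<open>Families of holomorphic functions decaying on a half-strip\<close>

text \<open>Stable under all shifts to the right, which the half lines of the contour require;
  negative real parts above -r make room for the circle around 0.\<close>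

definition strip :: "real \<Rightarrow> complex set" where
  "strip r = {z. - r < Re z \<and> \<bar>Im z\<bar> < r}"

lemma open_strip [simp]: "open (strip r)"
proof -
  have "strip r = {z. - r < Re z} \<inter> {z. - r < Im z} \<inter> {z. Im z < r}"
    by (auto simp: strip_def)
  then show ?thesis
    by (simp add: open_Int open_halfspace_Re_gt open_halfspace_Im_gt open_halfspace_Im_lt)
qed

lemma convex_strip [simp]: "convex (strip r)"
proof -
  have "strip r = {z. - r < Re z} \<inter> {z. - r < Im z} \<inter> {z. Im z < r}"
    by (auto simp: strip_def)
  then show ?thesis
    by (simp add: convex_Int convex_halfspace_Re_gt convex_halfspace_Im_gt convex_halfspace_Im_lt)
qed

lemma strip_mono: "x \<in> strip r \<Longrightarrow> r \<le> r' \<Longrightarrow> x \<in> strip r'"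
  by (auto simp: strip_def)

lemma strip_shift: "x \<in> strip r \<Longrightarrow> t \<ge> 0 \<Longrightarrow> x + of_real t \<in> strip r"
  by (auto simp: strip_def)

lemma strip_add: "x \<in> strip r \<Longrightarrow> norm w \<le> e \<Longrightarrow> x + w \<in> strip (r + e)"
  using abs_Re_le_cmod[of w] abs_Im_le_cmod[of w] by (auto simp: strip_def)

lemma strip_less:
  assumes "x \<in> strip r" obtains r' where "r' < r" "x \<in> strip r'"
proof -
  define m where "m = max (- Re x) \<bar>Im x\<bar>"
  have "m < r" using assms by (auto simp: strip_def m_def)
  moreover have "- Re x \<le> m" "\<bar>Im x\<bar> \<le> m" by (auto simp: m_def)
  ultimately have "(m + r) / 2 < r" "x \<in> strip ((m + r) / 2)"
    by (auto simp: strip_def field_simps)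
  then show ?thesis by (rule that)
qed

text \<open>A property of sets, so that one constant serves all members when a parameter varies. The
  constant may blow up as r tends to 1, since each derivative costs some width. The rate 1/2 is what
  is left in \<open>desing_factor_bound\<close>.\<close>

definition decaying :: "(complex \<Rightarrow> complex) set \<Rightarrow> bool" where
  "decaying A \<longleftrightarrow> (\<forall>f\<in>A. f holomorphic_on strip 1) \<and>
     (\<forall>r<1. \<exists>C. \<forall>f\<in>A. \<forall>x\<in>strip r. norm (f x) \<le> C * exp (- Re x / 2))"

lemma decayingI:
  assumes "\<And>f. f \<in> A \<Longrightarrow> f holomorphic_on strip 1"
    and "\<And>r. r < 1 \<Longrightarrow> \<exists>C. \<forall>f\<in>A. \<forall>x\<in>strip r. norm (f x) \<le> C * exp (- Re x / 2)"
  shows "decaying A"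
  using assms by (auto simp: decaying_def)

lemma decaying_holo: "decaying A \<Longrightarrow> f \<in> A \<Longrightarrow> f holomorphic_on strip 1"
  by (auto simp: decaying_def)

lemma decaying_bound:
  assumes "decaying A" "r < 1"
  obtains C where "C \<ge> 0" "\<And>f x. f \<in> A \<Longrightarrow> x \<in> strip r \<Longrightarrow> norm (f x) \<le> C * exp (- Re x / 2)"
proof -
  obtain C where C: "\<forall>f\<in>A. \<forall>x\<in>strip r. norm (f x) \<le> C * exp (- Re x / 2)"
    using assms by (auto simp: decaying_def)
  show ?thesis
  proof (rule that[of "max C 0"])
    fix f x assume "f \<in> A" "x \<in> strip r"
    with C have "norm (f x) \<le> C * exp (- Re x / 2)" by blast
    also have "\<dots> \<le> max C 0 * exp (- Re x / 2)" by (intro mult_right_mono) auto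
    finally show "norm (f x) \<le> max C 0 * exp (- Re x / 2)" .
  qed auto
qed

lemma decaying_subset: "decaying A \<Longrightarrow> B \<subseteq> A \<Longrightarrow> decaying B"
  unfolding decaying_def by (meson subsetD)

section \<open>Derivatives of decaying families\<close>

definition nderiv :: "(complex \<Rightarrow> complex) \<Rightarrow> complex \<Rightarrow> complex" where
  "nderiv f x = - deriv f x"

lemma nderiv_Suc: "(nderiv ^^ Suc m) f x = - deriv ((nderiv ^^ m) f) x"
  by (simp add: nderiv_def[of "(nderiv ^^ m) f" x])

lemma nderiv_holo: "f holomorphic_on strip r \<Longrightarrow> nderiv f holomorphic_on strip r"
  unfolding nderiv_def by (intro holomorphic_intros) auto

text \<open>Cauchy's estimate on discs of radius \<open>d\<close>, half the distance from
  \<open>r\<close> to 1; the factor exp (d / 2) is the decay lost by moving left by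
  \<open>d\<close>.\<close>

lemma decaying_nderiv:
  assumes "decaying A" shows "decaying (nderiv ` A)"
proof (rule decayingI)
  fix r :: real assume r: "r < 1"
  define r' where "r' = (r + 1) / 2"
  define d where "d = (1 - r) / 2"
  have rd: "r' < 1" "d > 0" "r + d = r'" using r by (auto simp: r'_def d_def field_simps)
  obtain C where C: "C \<ge> 0" "\<And>f x. f \<in> A \<Longrightarrow> x \<in> strip r' \<Longrightarrow> norm (f x) \<le> C * exp (- Re x / 2)"
    using decaying_bound[OF assms rd(1)] by metis
  have "norm (nderiv f x) \<le> C * exp (d / 2) / d * exp (- Re x / 2)" if f: "f \<in> A" and x: "x \<in> strip r" for f x
  proof -
    have sub: "w \<in> strip r' \<and> norm (w - x) \<le> d" if "w \<in> cball x d" for w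
      using strip_add[OF x, of "w - x" d] that rd by (auto simp: dist_norm norm_minus_commute)
    have "norm (deriv f x) \<le> (C * exp (d / 2) * exp (- Re x / 2)) / d"
    proof (rule deriv_bound_cball)
      show "f holomorphic_on strip 1" using assms f by (rule decaying_holo)
      show "cball x d \<subseteq> strip 1" using sub rd(1) by (meson less_imp_le strip_mono subsetI)
      fix w assume "w \<in> cball x d"
      note w = sub[OF this]
      have "Re x - d \<le> Re w" using w abs_Re_le_cmod[of "w - x"] by auto
      then have "exp (- Re w / 2) \<le> exp (d / 2) * exp (- Re x / 2)"
        by (simp add: exp_add[symmetric] field_simps)
      then have "C * exp (- Re w / 2) \<le> C * (exp (d / 2) * exp (- Re x / 2))"
        using C(1) by (rule mult_left_mono)
      with C(2)[OF f, of w] w show "norm (f w) \<le> C * exp (d / 2) * exp (- Re x / 2)" by simp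
    qed (use rd in auto)
    then show ?thesis by (simp add: nderiv_def)
  qed
  then show "\<exists>C. \<forall>f\<in>nderiv ` A. \<forall>x\<in>strip r. norm (f x) \<le> C * exp (- Re x / 2)" by blast
qed (use assms in \<open>auto intro: nderiv_holo decaying_holo\<close>)

lemma decaying_nderiv_pow: "decaying A \<Longrightarrow> decaying ((nderiv ^^ m) ` A)"
proof (induction m)
  case (Suc m)
  then show ?case using decaying_nderiv[of "(nderiv ^^ m) ` A"] by (simp add: image_image)
qed simp

lemma nderiv_cong:
  assumes "\<And>x. x \<in> strip r \<Longrightarrow> f x = g x" "x \<in> strip r"
  shows "(nderiv ^^ m) f x = (nderiv ^^ m) g x"
  using assms(2)
proof (induction m arbitrary: x)
  case (Suc m)
  have "eventually (\<lambda>y. y \<in> strip r) (nhds x)"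
    using Suc.prems by (intro eventually_nhds_in_open) auto
  then have "\<forall>\<^sub>F y in nhds x. (nderiv ^^ m) f y = (nderiv ^^ m) g y"
    by eventually_elim (rule Suc.IH)
  then show ?case unfolding nderiv_Suc by (simp add: deriv_cong_ev)
qed (use assms in auto)

text \<open>The x-derivative is a limit of difference quotients that are holomorphic in z; their
  steps \<open>h n\<close> are positive reals, so they stay in the strip. The convergence is uniform
  in z, since the Taylor remainder is controlled by the second x-derivative, which is bounded
  uniformly over the family.\<close>

lemma holomorphic_nderiv_param:
  assumes Z: "open Z" and dec: "decaying (f ` Z)"
    and hol: "\<And>y. y \<in> strip 1 \<Longrightarrow> (\<lambda>z. f z y) holomorphic_on Z" and x: "x \<in> strip 1"
  shows "(\<lambda>z. nderiv (f z) x) holomorphic_on Z"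
proof -
  obtain r where r: "r < 1" "x \<in> strip r" using x by (rule strip_less)
  obtain C where C: "C \<ge> 0" "\<And>g y. g \<in> (nderiv ^^ 2) ` f ` Z \<Longrightarrow> y \<in> strip r \<Longrightarrow> norm (g y) \<le> C * exp (- Re y / 2)"
    using decaying_bound[OF decaying_nderiv_pow[OF dec] r(1)] by metis
  define B where "B = C * exp (1 / 2)"
  define h where "h n = 1 / (real n + 1)" for n :: nat
  have h: "h n > 0" for n by (auto simp: h_def)
  have dd: "norm (deriv (deriv (f z)) y) \<le> B" if "z \<in> Z" "y \<in> strip r" for z y
  proof -
    have e: "(nderiv ^^ 2) (f z) y = deriv (deriv (f z)) y"
    proof -
      have "f z holomorphic_on strip 1" using dec that by (auto intro: decaying_holo)
      then have "deriv (f z) field_differentiable at y"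
        using holomorphic_on_imp_differentiable_at[of "deriv (f z)" "strip 1" y] holomorphic_deriv[of "f z" "strip 1"]
          strip_mono[OF that(2), of 1] r by auto
      then have "(nderiv (f z) has_field_derivative - deriv (deriv (f z)) y) (at y)"
        by (auto intro!: DERIV_minus simp: nderiv_def[abs_def] DERIV_deriv_iff_field_differentiable)
      then show ?thesis
        using nderiv_Suc[of 1 "f z" y] by (simp add: numeral_2_eq_2 DERIV_imp_deriv)
    qed
    have "norm ((nderiv ^^ 2) (f z) y) \<le> C * exp (- Re y / 2)"
      using that by (intro C(2)) auto
    also have "\<dots> \<le> B" unfolding B_def
      by (intro mult_left_mono C) (use that r in \<open>auto simp: strip_def\<close>)
    finally show ?thesis by (simp add: e)
  qed
  have T: "norm ((f z (x + of_real (h n)) - f z x) / of_real (h n) - deriv (f z) x) \<le> B * h n" if z: "z \<in> Z" for z n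
  proof -
    have fz: "f z holomorphic_on strip 1" using dec z by (auto intro: decaying_holo)
    then have fz1: "f z holomorphic_on strip r" and fz2: "deriv (f z) holomorphic_on strip r"
      using r strip_mono[of _ r 1] by (auto intro!: holomorphic_deriv elim!: holomorphic_on_subset)
    have "norm (((\<lambda>i. (deriv ^^ i) (f z)) 0) (x + of_real (h n))
        - (\<Sum>i\<le>1. ((\<lambda>i. (deriv ^^ i) (f z)) i) x * (x + of_real (h n) - x) ^ i / fact i)) 
         \<le> B * norm (x + of_real (h n) - x) ^ Suc 1 / fact 1"
    proof (rule complex_Taylor[OF convex_strip[of r]])
      fix i y assume y: "y \<in> strip r" and i: "i \<le> (1::nat)"
      then have "i = 0 \<or> i = 1" by auto
      then show "((deriv ^^ i) (f z) has_field_derivative (deriv ^^ (Suc i)) (f z) y) (at y within strip r)"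
        using holomorphic_derivI[OF fz1 open_strip y] holomorphic_derivI[OF fz2 open_strip y]
        by (auto intro: has_field_derivative_at_within)
    qed (use dd[OF z] r strip_shift[OF r(2)] h[of n] in \<open>auto simp: numeral_2_eq_2\<close>)
    then have *: "norm (f z (x + of_real (h n)) - f z x - deriv (f z) x * h n) \<le> B * (h n)\<^sup>2"
      using h[of n] by (simp add: algebra_simps power2_eq_square)
    have "(f z (x + of_real (h n)) - f z x) / of_real (h n) - deriv (f z) x
        = (f z (x + of_real (h n)) - f z x - deriv (f z) x * h n) / of_real (h n)"
      using h[of n] by (simp add: field_simps)
    also have "norm \<dots> = norm (f z (x + of_real (h n)) - f z x - deriv (f z) x * h n) / h n"
      using h[of n] by (simp add: norm_divide)
    also have "\<dots> \<le> B * (h n)\<^sup>2 / h n"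
      using * h[of n] by (intro divide_right_mono) auto
    finally show ?thesis using h[of n] by (simp add: power2_eq_square)
  qed
  have lim: "(\<lambda>n. B * h n) \<longlonglongrightarrow> 0"
    using tendsto_mult_right_zero[OF lim_1_over_n, of B] LIMSEQ_Suc[OF lim_1_over_n]
    unfolding h_def by (intro tendsto_mult_right_zero) (auto simp: add.commute)
  have "(\<lambda>z. deriv (f z) x) holomorphic_on Z"
  proof (rule holomorphic_uniform_sequence[OF Z])
    show "(\<lambda>z. (f z (x + of_real (h n)) - f z x) / of_real (h n)) holomorphic_on Z" for n
      by (intro holomorphic_intros hol) (use strip_shift[OF x] h[of n] x in auto)
    fix z assume "z \<in> Z"
    then obtain d where d: "d > 0" "cball z d \<subseteq> Z" using Z open_contains_cball by blast
    have "uniform_limit (cball z d) (\<lambda>n z. (f z (x + of_real (h n)) - f z x) / of_real (h n)) (\<lambda>z. deriv (f z) x) sequentially"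
    proof (rule uniform_limitI)
      fix e :: real assume "e > 0"
      then have "\<forall>\<^sub>F n in sequentially. B * h n < e" using lim by (simp add: order_tendstoD)
      then show "\<forall>\<^sub>F n in sequentially. \<forall>z\<in>cball z d. dist ((f z (x + of_real (h n)) - f z x) / of_real (h n)) (deriv (f z) x) < e"
      proof (eventually_elim, intro ballI)
        fix n z' assume "B * h n < e" "z' \<in> cball z d"
        then show "dist ((f z' (x + of_real (h n)) - f z' x) / of_real (h n)) (deriv (f z') x) < e"
          using T[of z' n] d(2) by (auto simp: dist_norm simp del: mem_cball)
      qed
    qed
    with d show "\<exists>d>0. cball z d \<subseteq> Z \<and> uniform_limit (cball z d) (\<lambda>n z. (f z (x + of_real (h n)) - f z x) / of_real (h n)) (\<lambda>z. deriv (f z) x) sequentially"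
      by blast
  qed
  then show ?thesis unfolding nderiv_def by (intro holomorphic_intros)
qed

lemma holomorphic_nderiv_pow_param:
  assumes Z: "open Z" and dec: "decaying (f ` Z)"
    and hol: "\<And>y. y \<in> strip 1 \<Longrightarrow> (\<lambda>z. f z y) holomorphic_on Z" and x: "x \<in> strip 1"
  shows "(\<lambda>z. (nderiv ^^ m) (f z) x) holomorphic_on Z"
  using x
proof (induction m arbitrary: x)
  case (Suc m)
  have "(\<lambda>z. nderiv ((nderiv ^^ m) (f z)) x) holomorphic_on Z"
    by (rule holomorphic_nderiv_param[OF Z]) (use decaying_nderiv_pow[OF dec, of m] Suc in \<open>auto simp: image_image\<close>)
  then show ?case by simp
qed (use hol in auto)

section \<open>Mellin transforms\<close>

text \<open>Two exponents, \<open>a\<close> for t < 1 and \<open>b\<close> for t > 1, so that one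
  integrable function dominates all z with a \<le> Re z \<le> b at once.\<close>

definition mellin_bound :: "real \<Rightarrow> real \<Rightarrow> real \<Rightarrow> real" where
  "mellin_bound a b t = indicator {0<..} t * (exp (- t / 2) * (t powr (a - 1) + t powr (b - 1)))"

lemma integrable_mellin_bound:
  assumes "a > 0" "b > 0"
  shows "integrable lborel (mellin_bound a b)"
proof -
  have "integrable lborel (\<lambda>t. indicator {0<..} t * (exp (- t / 2) * t powr (a - 1)))" if "a > 0" for a :: real
  proof -
    have "integrable lebesgue (\<lambda>t. norm (indicat_real {0<..} t *\<^sub>R 
        (complex_of_real t powr (complex_of_real a - 1) / of_real (exp (1 / 2 * t)))))"
      using absolutely_integrable_Gamma_integral[of "complex_of_real a" "1/2"] that
      unfolding set_integrable_def by (intro integrable_norm) simp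
    also have "(\<lambda>t. norm (indicat_real {0<..} t *\<^sub>R 
        (complex_of_real t powr (complex_of_real a - 1) / of_real (exp (1 / 2 * t)))))
      = (\<lambda>t. indicator {0<..} t * (exp (- t / 2) * t powr (a - 1)))"
      by (auto simp: fun_eq_iff indicator_def norm_divide norm_mult norm_powr_real_powr exp_minus field_simps)
    finally show ?thesis
      by (subst (asm) integrable_completion) auto
  qed
  from Bochner_Integration.integrable_add[OF this[OF assms(1)] this[OF assms(2)]] show ?thesis
    by (simp add: mellin_bound_def[abs_def] algebra_simps)
qed

lemma norm_of_real_powr_le:
  assumes "t > 0" "a \<le> Re z" "Re z \<le> b"
  shows "norm (of_real t powr (z - 1)) \<le> t powr (a - 1) + t powr (b - 1)"
proof (cases "t \<ge> 1")
  case True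
  have "norm (of_real t powr (z - 1)) = t powr (Re z - 1)" using assms by (simp add: norm_powr_real_powr)
  also have "\<dots> \<le> t powr (b - 1)" using True assms by (intro powr_mono) auto
  also have "\<dots> \<le> t powr (a - 1) + t powr (b - 1)" by simp
  finally show ?thesis .
next
  case False
  have "norm (of_real t powr (z - 1)) = t powr (Re z - 1)" using assms by (simp add: norm_powr_real_powr)
  also have "\<dots> \<le> t powr (a - 1)" using False assms by (intro powr_mono') auto
  also have "\<dots> \<le> t powr (a - 1) + t powr (b - 1)" by simp
  finally show ?thesis .
qed

definition mellin_integrand :: "complex \<Rightarrow> (complex \<Rightarrow> complex) \<Rightarrow> complex \<Rightarrow> real \<Rightarrow> complex" where
  "mellin_integrand z f x t = indicator {0<..} t *\<^sub>R (f (x + of_real t) * of_real t powr (z - 1))"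

definition mellin :: "complex \<Rightarrow> (complex \<Rightarrow> complex) \<Rightarrow> complex \<Rightarrow> complex" where
  "mellin z f x = rGamma z * (\<integral>t. mellin_integrand z f x t \<partial>lborel)"

lemma mellin_integrand_bound:
  assumes "\<And>y. y \<in> strip r \<Longrightarrow> norm (f y) \<le> C * exp (- Re y / 2)" "x \<in> strip r" "a \<le> Re z" "Re z \<le> b"
  shows "norm (mellin_integrand z f x t) \<le> C * exp (- Re x / 2) * mellin_bound a b t"
proof (cases "t > 0")
  case True
  have 1: "norm (f (x + of_real t)) \<le> C * exp (- Re x / 2) * exp (- t / 2)"
    using assms(1)[OF strip_shift[OF assms(2), of t]] True
    by (simp add: exp_add[symmetric] field_simps add_divide_distrib)
  have "norm (f (x + of_real t) * of_real t powr (z - 1))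
      \<le> (C * exp (- Re x / 2) * exp (- t / 2)) * (t powr (a - 1) + t powr (b - 1))"
    unfolding norm_mult
    by (intro mult_mono 1 norm_of_real_powr_le order_trans[OF norm_ge_zero 1]) (use True assms in auto)
  then show ?thesis using True by (simp add: mellin_integrand_def mellin_bound_def mult_ac)
qed (auto simp: mellin_integrand_def mellin_bound_def)

lemma measurable_mellin_integrand:
  assumes "f holomorphic_on strip 1" "x \<in> strip 1"
  shows "mellin_integrand z f x \<in> borel_measurable borel"
proof -
  have "continuous_on {0<..} (\<lambda>t. f (x + of_real t) * of_real t powr (z - 1))"
    by (intro continuous_intros continuous_on_compose2[OF holomorphic_on_imp_continuous_on[OF assms(1)]])
      (use assms strip_shift in \<open>auto intro!: continuous_intros simp: complex_nonpos_Reals_iff\<close>)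
  then show ?thesis
    unfolding mellin_integrand_def[abs_def] by (rule borel_measurable_continuous_on_indicator[rotated]) auto
qed

lemma integrable_mellin_integrand:
  assumes dec: "decaying {f}" and x: "x \<in> strip 1" and z: "Re z > 0"
  shows "integrable lborel (mellin_integrand z f x)"
proof -
  obtain r where r: "r < 1" "x \<in> strip r" using x by (rule strip_less)
  obtain C where C: "C \<ge> 0" "\<And>f' y. f' \<in> {f} \<Longrightarrow> y \<in> strip r \<Longrightarrow> norm (f' y) \<le> C * exp (- Re y / 2)"
    using decaying_bound[OF dec r(1)] by metis
  show ?thesis
  proof (rule Bochner_Integration.integrable_bound)
    show "integrable lborel (\<lambda>t. C * exp (- Re x / 2) * mellin_bound (Re z) (Re z) t)"
      using z by (intro integrable_mult_right integrable_mellin_bound)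
    show "AE t in lborel. norm (mellin_integrand z f x t) \<le> norm (C * exp (- Re x / 2) * mellin_bound (Re z) (Re z) t)"
    proof (rule AE_I2)
      fix t
      have "norm (mellin_integrand z f x t) \<le> C * exp (- Re x / 2) * mellin_bound (Re z) (Re z) t"
        by (rule mellin_integrand_bound[OF C(2) r(2)]) auto
      then show "norm (mellin_integrand z f x t) \<le> norm (C * exp (- Re x / 2) * mellin_bound (Re z) (Re z) t)"
        by simp
    qed
    show "mellin_integrand z f x \<in> borel_measurable lborel"
      using measurable_mellin_integrand[OF decaying_holo[OF dec] x] by simp
  qed
qed

lemma mellin_has_field_derivative:
  assumes dec: "decaying {f}" and x: "x \<in> strip 1" and z: "Re z > 0"
  shows "(mellin z f has_field_derivative mellin z (deriv f) x) (at x)"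
proof -
  obtain r where r: "r < 1" "x \<in> strip r" using x by (rule strip_less)
  obtain C where C: "C \<ge> 0" "\<And>f' y. f' \<in> {f} \<Longrightarrow> y \<in> strip r \<Longrightarrow> norm (f' y) \<le> C * exp (- Re y / 2)"
    using decaying_bound[OF dec r(1)] by metis
  have f: "f holomorphic_on strip 1" using dec by (rule decaying_holo) simp
  then have f': "f holomorphic_on strip r" by (rule holomorphic_on_subset) (use r in \<open>auto intro: strip_mono\<close>)
  have D: "((\<lambda>x. mellin_integrand z f x t) has_field_derivative mellin_integrand z (deriv f) y t) (at y)"
    if y: "y \<in> strip r" for y t
  proof (cases "t > 0")
    case True
    have "(f has_field_derivative deriv f (y + of_real t)) (at (y + of_real t))"
      using True by (intro holomorphic_derivI[OF f' open_strip strip_shift[OF y]]) auto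
    then have "((\<lambda>y. f (y + of_real t)) has_field_derivative deriv f (y + of_real t)) (at y)"
      by (simp add: DERIV_shift)
    then show ?thesis
      using True by (auto simp: mellin_integrand_def intro!: DERIV_cmult_right)
  qed (auto simp: mellin_integrand_def)
  have "((\<lambda>x. \<integral>t. mellin_integrand z f x t \<partial>lborel) has_field_derivative
      (\<integral>t. deriv (\<lambda>x. mellin_integrand z f x t) x \<partial>lborel)) (at x)"
  proof (rule holomorphic_parametric_integral[where Z = "strip r"])
    show "(\<lambda>x. mellin_integrand z f x t) holomorphic_on strip r" for t
      using D by (auto simp: holomorphic_on_open)
    show "integrable lborel (\<lambda>t. C * exp (r / 2) * mellin_bound (Re z) (Re z) t)"
      using z by (intro integrable_mult_right integrable_mellin_bound)
    fix y t assume y: "y \<in> strip r"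
    then have y1: "y \<in> strip 1" by (rule strip_mono) (use r in auto)
    show "mellin_integrand z f y \<in> borel_measurable lborel"
      using measurable_mellin_integrand[OF f y1] by simp
    have "norm (mellin_integrand z f y t) \<le> C * exp (- Re y / 2) * mellin_bound (Re z) (Re z) t"
      by (rule mellin_integrand_bound[OF C(2) y]) auto
    also have "\<dots> \<le> C * exp (r / 2) * mellin_bound (Re z) (Re z) t"
      by (intro mult_right_mono mult_left_mono C) (use y in \<open>auto simp: strip_def mellin_bound_def\<close>)
    finally show "norm (mellin_integrand z f y t) \<le> C * exp (r / 2) * mellin_bound (Re z) (Re z) t" .
  qed (use r in auto)
  moreover have "deriv (\<lambda>x. mellin_integrand z f x t) x = mellin_integrand z (deriv f) x t" for t
    by (rule DERIV_imp_deriv[OF D[OF r(2)]])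
  ultimately show ?thesis
    unfolding mellin_def[abs_def] by (auto intro!: DERIV_cmult)
qed

lemma mellin_holo: "decaying {f} \<Longrightarrow> Re z > 0 \<Longrightarrow> mellin z f holomorphic_on strip 1"
  using mellin_has_field_derivative by (auto simp: holomorphic_on_open)

lemma nderiv_mellin:
  assumes "decaying {f}" "x \<in> strip 1" "Re z > 0"
  shows "nderiv (mellin z f) x = mellin z (nderiv f) x"
proof -
  have "mellin_integrand z (nderiv f) x t = - mellin_integrand z (deriv f) x t" for t
    by (simp add: mellin_integrand_def nderiv_def)
  then show ?thesis
    using DERIV_imp_deriv[OF mellin_has_field_derivative[OF assms]]
    by (simp add: nderiv_def mellin_def)
qed

lemma decaying_mellin:
  assumes dec: "decaying A" and a: "a > 0" and b: "b \<ge> a"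
    and Z: "\<And>z. z \<in> Z \<Longrightarrow> a \<le> Re z \<and> Re z \<le> b \<and> norm (rGamma z) \<le> B"
  shows "decaying {mellin z f |z f. z \<in> Z \<and> f \<in> A}"
proof (rule decayingI)
  fix g assume "g \<in> {mellin z f |z f. z \<in> Z \<and> f \<in> A}"
  then show "g holomorphic_on strip 1"
    using a by (force intro!: mellin_holo decaying_subset[OF dec] dest: Z)
next
  fix r :: real assume r: "r < 1"
  obtain C where C: "C \<ge> 0" "\<And>f y. f \<in> A \<Longrightarrow> y \<in> strip r \<Longrightarrow> norm (f y) \<le> C * exp (- Re y / 2)"
    using decaying_bound[OF dec r] by metis
  define I where "I = (\<integral>t. mellin_bound a b t \<partial>lborel)"
  have "norm (mellin z f x) \<le> B * (C * I) * exp (- Re x / 2)" if "z \<in> Z" "f \<in> A" "x \<in> strip r" for z f x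
  proof -
    have "norm (\<integral>t. mellin_integrand z f x t \<partial>lborel) \<le> (\<integral>t. C * exp (- Re x / 2) * mellin_bound a b t \<partial>lborel)"
    proof (rule order_trans[OF integral_norm_bound], rule integral_mono)
      show "norm (mellin_integrand z f x t) \<le> C * exp (- Re x / 2) * mellin_bound a b t" for t
        by (rule mellin_integrand_bound[OF C(2)]) (use that Z in auto)
      show "integrable lborel (\<lambda>t. norm (mellin_integrand z f x t))"
        using that Z[of z] a r by (intro integrable_norm integrable_mellin_integrand decaying_subset[OF dec]) (auto intro: strip_mono)
    qed (use a b in \<open>auto intro!: integrable_mellin_bound\<close>)
    also have "\<dots> = C * exp (- Re x / 2) * I" by (simp add: I_def)
    finally have *: "norm (\<integral>t. mellin_integrand z f x t \<partial>lborel) \<le> C * exp (- Re x / 2) * I" .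
    have "norm (mellin z f x) \<le> B * (C * exp (- Re x / 2) * I)"
      unfolding mellin_def norm_mult
      by (intro mult_mono * order_trans[OF norm_ge_zero]) (use Z[OF that(1)] norm_ge_zero[of "rGamma z"] in \<open>auto intro: order_trans\<close>)
    then show ?thesis by (simp add: mult_ac)
  qed
  then show "\<exists>C. \<forall>f\<in>{mellin z f |z f. z \<in> Z \<and> f \<in> A}. \<forall>x\<in>strip r. norm (f x) \<le> C * exp (- Re x / 2)"
    by blast
qed

lemma holomorphic_mellin:
  assumes dec: "decaying {f}" and x: "x \<in> strip 1"
  shows "(\<lambda>z. mellin z f x) holomorphic_on {z. Re z > 0}"
proof -
  obtain r where r: "r < 1" "x \<in> strip r" using x by (rule strip_less)
  obtain C where C: "C \<ge> 0" "\<And>f' y. f' \<in> {f} \<Longrightarrow> y \<in> strip r \<Longrightarrow> norm (f' y) \<le> C * exp (- Re y / 2)"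
    using decaying_bound[OF dec r(1)] by metis
  have "(\<lambda>z. \<integral>t. mellin_integrand z f x t \<partial>lborel) field_differentiable at z" if z: "Re z > 0" for z
  proof -
    \<comment> \<open>The band keeps Re w away from 0 and bounded above, so that a single
      \<open>mellin_bound\<close> dominates on all of it.\<close>
    define Z where "Z = {w. Re z / 2 < Re w} \<inter> {w. Re w < Re z + 1}"
    have "((\<lambda>z. \<integral>t. mellin_integrand z f x t \<partial>lborel) has_field_derivative
      (\<integral>t. deriv (\<lambda>z. mellin_integrand z f x t) z \<partial>lborel)) (at z)"
    proof (rule holomorphic_parametric_integral[where Z = Z])
      show "open Z" unfolding Z_def by (intro open_Int open_halfspace_Re_gt open_halfspace_Re_lt)
      show "(\<lambda>z. mellin_integrand z f x t) holomorphic_on Z" for t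
        unfolding mellin_integrand_def by (intro holomorphic_intros)
      show "integrable lborel (\<lambda>t. C * exp (- Re x / 2) * mellin_bound (Re z / 2) (Re z + 1) t)"
        using z by (intro integrable_mult_right integrable_mellin_bound) auto
      fix w t assume w: "w \<in> Z"
      show "mellin_integrand w f x \<in> borel_measurable lborel"
        using measurable_mellin_integrand[OF decaying_holo[OF dec] x] by simp
      show "norm (mellin_integrand w f x t) \<le> C * exp (- Re x / 2) * mellin_bound (Re z / 2) (Re z + 1) t"
        by (rule mellin_integrand_bound[OF C(2) r(2)]) (use w in \<open>auto simp: Z_def\<close>)
    qed (use z in \<open>auto simp: Z_def\<close>)
    then show ?thesis by (auto simp: field_differentiable_def)
  qed
  then have "(\<lambda>z. \<integral>t. mellin_integrand z f x t \<partial>lborel) holomorphic_on {z. Re z > 0}"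
    by (auto simp: holomorphic_on_def intro: field_differentiable_at_within)
  then show ?thesis unfolding mellin_def by (intro holomorphic_intros)
qed

lemma holomorphic_mellin_param:
  assumes Z: "open Z" and dec: "decaying (f ` Z)"
    and hol: "\<And>y. y \<in> strip 1 \<Longrightarrow> (\<lambda>z. f z y) holomorphic_on Z" and x: "x \<in> strip 1" and w: "Re w > 0"
  shows "(\<lambda>z. mellin w (f z) x) holomorphic_on Z"
proof -
  obtain r where r: "r < 1" "x \<in> strip r" using x by (rule strip_less)
  obtain C where C: "C \<ge> 0" "\<And>f' y. f' \<in> f ` Z \<Longrightarrow> y \<in> strip r \<Longrightarrow> norm (f' y) \<le> C * exp (- Re y / 2)"
    using decaying_bound[OF dec r(1)] by metis
  have "((\<lambda>z. \<integral>t. mellin_integrand w (f z) x t \<partial>lborel) has_field_derivative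
    (\<integral>t. deriv (\<lambda>z. mellin_integrand w (f z) x t) z \<partial>lborel)) (at z)" if "z \<in> Z" for z
  proof (rule holomorphic_parametric_integral[OF Z])
    show "(\<lambda>z. mellin_integrand w (f z) x t) holomorphic_on Z" for t
    proof (cases "t > 0")
      case True
      then show ?thesis unfolding mellin_integrand_def using hol[OF strip_shift[OF x]]
        by (simp add: holomorphic_on_mult)
    qed (simp add: mellin_integrand_def)
    show "integrable lborel (\<lambda>t. C * exp (- Re x / 2) * mellin_bound (Re w) (Re w) t)"
      using w by (intro integrable_mult_right integrable_mellin_bound) auto
    fix z t assume z: "z \<in> Z"
    show "mellin_integrand w (f z) x \<in> borel_measurable lborel"
      using measurable_mellin_integrand[OF decaying_holo[OF dec] x] z by simp
    show "norm (mellin_integrand w (f z) x t) \<le> C * exp (- Re x / 2) * mellin_bound (Re w) (Re w) t"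
      by (rule mellin_integrand_bound[OF C(2) r(2)]) (use z in auto)
  qed (rule that)
  then have "(\<lambda>z. \<integral>t. mellin_integrand w (f z) x t \<partial>lborel) holomorphic_on Z"
    using Z by (auto simp: holomorphic_on_open)
  then show ?thesis unfolding mellin_def by (intro holomorphic_intros)
qed

section \<open>Weyl fractional integrals\<close>

text \<open>The cut-off \<open>a\<close> is 0 for the Weyl integral and \<epsilon> for the straight
  parts of the Hankel contour; one integration by parts then serves both.\<close>

definition half_line :: "real \<Rightarrow> complex \<Rightarrow> (complex \<Rightarrow> complex) \<Rightarrow> complex \<Rightarrow> complex" where
  "half_line a z f x = (LINT t:{a<..}|lborel. f (x + of_real t) * of_real t powr (z - 1))"

lemma mellin_half_line: "mellin z f x = rGamma z * half_line 0 z f x"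
  by (simp add: mellin_def half_line_def set_lebesgue_integral_def mellin_integrand_def)

lemma set_integrable_half_line:
  assumes dec: "decaying {f}" and x: "x \<in> strip 1" and a: "a > 0 \<or> a = 0 \<and> Re z > 0"
  shows "set_integrable lborel {a<..} (\<lambda>t. f (x + of_real t) * of_real t powr (z - 1))"
proof (cases "a > 0")
  case True
  \<comment> \<open>Split t powr (z - 1) into t powr w and t powr (c - 1): as c > 0 the second
    factor is harmless at 0, and as Re w \<le> 0 the modulus of the first is at most a powr Re
    w.\<close>
  define c where "c = max 1 (Re z)"
  have c: "c > 0" by (auto simp: c_def)
  define w where "w = z - of_real c"
  have "set_integrable lborel {0<..} (\<lambda>t. f (x + of_real t) * of_real t powr (of_real c - 1))"
    using integrable_mellin_integrand[OF dec x, of "of_real c"] c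
    by (simp add: mellin_integrand_def[abs_def] set_integrable_def)
  then have "set_integrable lborel {a<..} (\<lambda>t. f (x + of_real t) * of_real t powr (of_real c - 1))"
    by (rule set_integrable_subset) (use True in auto)
  then have I: "integrable lborel (\<lambda>t. indicat_real {a<..} t *\<^sub>R (f (x + of_real t) * of_real t powr (of_real c - 1)))"
    unfolding set_integrable_def .
  have "set_integrable lborel {a<..} (\<lambda>t. of_real t powr w * (f (x + of_real t) * of_real t powr (of_real c - 1)))"
    unfolding set_integrable_def
  proof (rule Bochner_Integration.integrable_bound)
    show "integrable lborel (\<lambda>t. complex_of_real (a powr Re w) * (indicat_real {a<..} t *\<^sub>R (f (x + of_real t) * of_real t powr (of_real c - 1))))"
      using I by (rule integrable_mult_right)
    have "continuous_on {a<..} (\<lambda>t. of_real t powr w * (f (x + of_real t) * of_real t powr (of_real c - 1)))"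
    proof (intro continuous_on_mult)
      have f: "f holomorphic_on strip 1" using dec by (rule decaying_holo) simp
      show "continuous_on {a<..} (\<lambda>t. f (x + of_real t))"
        by (intro continuous_on_compose2[OF holomorphic_on_imp_continuous_on[OF f]] continuous_intros)
          (use x strip_shift True in auto)
    qed (use True in \<open>auto intro!: continuous_intros simp: complex_nonpos_Reals_iff\<close>)
    then show "(\<lambda>t. indicat_real {a<..} t *\<^sub>R (of_real t powr w * (f (x + of_real t) * of_real t powr (of_real c - 1)))) \<in> borel_measurable lborel"
      using borel_measurable_continuous_on_indicator[of "{a<..}"] by simp
    have "norm (indicat_real {a<..} t *\<^sub>R (of_real t powr w * (f (x + of_real t) * of_real t powr (of_real c - 1))))
        \<le> norm (of_real (a powr Re w) * (indicat_real {a<..} t *\<^sub>R (f (x + of_real t) * of_real t powr (of_real c - 1))))" for t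
    proof (cases "t > a")
      case t: True
      have "t powr Re w \<le> a powr Re w"
        using t True by (intro powr_mono2') (auto simp: w_def c_def)
      then show ?thesis
        using t True by (simp add: norm_mult norm_powr_real_powr mult_right_mono)
    qed simp
    then show "AE t in lborel. norm (indicat_real {a<..} t *\<^sub>R (of_real t powr w * (f (x + of_real t) * of_real t powr (of_real c - 1))))
        \<le> norm (of_real (a powr Re w) * (indicat_real {a<..} t *\<^sub>R (f (x + of_real t) * of_real t powr (of_real c - 1))))"
      by (rule AE_I2)
  qed
  moreover have "of_real t powr w * (f (x + of_real t) * of_real t powr (of_real c - 1))
      = f (x + of_real t) * of_real t powr (z - 1)" if "t > a" for t
  proof -
    have "of_real t powr (z - 1) = of_real t powr w * complex_of_real t powr (of_real c - 1)"
      unfolding powr_add[symmetric] by (simp add: w_def)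
    then show ?thesis by (simp only: mult_ac)
  qed
  ultimately show ?thesis
    by (subst (asm) set_integrable_cong[OF refl refl, of "{a<..}" _ "\<lambda>t. f (x + of_real t) * of_real t powr (z - 1)"]) auto
next
  case False
  then show ?thesis using a integrable_mellin_integrand[OF dec x, of z]
    by (simp add: mellin_integrand_def[abs_def] set_integrable_def)
qed

lemma decaying_deriv: "decaying {f} \<Longrightarrow> decaying {deriv f}"
  using decaying_nderiv[of "{f}"] by (auto simp: decaying_def nderiv_def intro!: holomorphic_deriv)

text \<open>Integration by parts for f(x + t) t^z, which vanishes at infinity. The lower end value
  \<open>A\<close> is a one-sided limit, because \<open>0 powr z\<close> is 0 by convention even for
  z = 0. For z = 0 the integral on the right may diverge, but it is multiplied by 0.\<close>

lemma half_line_nderiv: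
  assumes dec: "decaying {f}" and x: "x \<in> strip 1" and a: "a \<ge> 0"
    and i1: "z = 0 \<or> a > 0 \<or> a = 0 \<and> Re z > 0"
    and A: "((\<lambda>t. f (x + of_real t) * of_real t powr z) \<longlongrightarrow> A) (at_right a)"
  shows "half_line a (z + 1) (nderiv f) x = z * half_line a z f x + A"
proof -
  have f: "f holomorphic_on strip 1" using dec by (rule decaying_holo) simp
  define F where "F = (\<lambda>t. f (x + of_real t) * of_real t powr z)"
  define G where "G = (\<lambda>t. deriv f (x + of_real t) * of_real t powr z + z * (f (x + of_real t) * of_real t powr (z - 1)))"
  have I1: "set_integrable lborel {a<..} (\<lambda>t. deriv f (x + of_real t) * of_real t powr z)"
  proof -
    have "a > 0 \<or> a = 0 \<and> Re (z + 1) > 0" using i1 a by (cases "a = 0") auto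
    from set_integrable_half_line[OF decaying_deriv[OF dec] x this] show ?thesis by simp
  qed
  have I2: "set_integrable lborel {a<..} (\<lambda>t. z * (f (x + of_real t) * of_real t powr (z - 1)))"
  proof (cases "z = 0")
    case False
    then show ?thesis using i1 by (intro set_integrable_mult_right set_integrable_half_line[OF dec x]) auto
  qed (simp add: set_integrable_def)
  obtain r where r: "r < 1" "x \<in> strip r" using x by (rule strip_less)
  obtain C where C: "C \<ge> 0" "\<And>f' y. f' \<in> {f} \<Longrightarrow> y \<in> strip r \<Longrightarrow> norm (f' y) \<le> C * exp (- Re y / 2)"
    using decaying_bound[OF dec r(1)] by metis
  have "(LBINT t=ereal a..\<infinity>. G t) = 0 - A"
  proof (rule interval_integral_FTC_integrable)
    fix t assume "ereal a < ereal t" "ereal t < \<infinity>"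
    then have t: "t > a" "t > 0" "x + of_real t \<in> strip 1" using a strip_shift[OF x] by auto
    have nz: "of_real t \<notin> \<real>\<^sub>\<le>\<^sub>0" using t by (simp add: complex_nonpos_Reals_iff)
    have d1: "((\<lambda>w. f (x + w)) has_field_derivative deriv f (x + of_real t)) (at (of_real t))"
      using holomorphic_derivI[OF f open_strip t(3), of UNIV] by (simp add: DERIV_shift add.commute[of x])
    have "((\<lambda>w. f (x + w) * w powr z) has_field_derivative
       deriv f (x + of_real t) * of_real t powr z + (z * of_real t powr (z - 1)) * f (x + of_real t)) (at (of_real t))"
      by (rule DERIV_mult[OF d1 has_field_derivative_powr[OF nz]])
    then show "(F has_vector_derivative G t) (at t)"
      unfolding F_def G_def by (intro has_vector_derivative_real_field) (simp add: mult_ac)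
    have "continuous_on {0<..} G"
      unfolding G_def
    proof (intro continuous_on_mult continuous_on_add)
      show "continuous_on {0<..} (\<lambda>t. f (x + of_real t))"
        by (intro continuous_on_compose2[OF holomorphic_on_imp_continuous_on[OF f]] continuous_intros)
          (use x strip_shift in auto)
      show "continuous_on {0<..} (\<lambda>t. deriv f (x + of_real t))"
        by (intro continuous_on_compose2[OF holomorphic_on_imp_continuous_on[OF holomorphic_deriv[OF f open_strip]]] continuous_intros)
          (use x strip_shift in auto)
    qed (auto intro!: continuous_intros simp: complex_nonpos_Reals_iff)
    then show "isCont G t" using t by (auto simp: continuous_on_eq_continuous_at)
  next
    show "set_integrable lborel (einterval (ereal a) \<infinity>) G"
      using set_integral_add(1)[OF I1 I2] by (simp add: G_def)
    show "((F \<circ> real_of_ereal) \<longlongrightarrow> A) (at_right (ereal a))"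
      using A by (simp add: ereal_tendsto_simps1 F_def)
    have "((\<lambda>t. exp (- t / 2) * t powr Re z) \<longlongrightarrow> 0) at_top"
      by real_asymp
    then have lim: "((\<lambda>t. C * exp (- Re x / 2) * (exp (- t / 2) * t powr Re z)) \<longlongrightarrow> 0) at_top"
      by (rule tendsto_mult_right_zero)
    have "\<forall>\<^sub>F t in at_top. norm (F t) \<le> C * exp (- Re x / 2) * (exp (- t / 2) * t powr Re z)"
      using eventually_gt_at_top[of 0]
    proof eventually_elim
      case (elim t)
      have "norm (f (x + of_real t)) \<le> C * exp (- Re x / 2) * exp (- t / 2)"
      proof -
        have "exp (- Re (x + of_real t) / 2) = exp (- Re x / 2) * exp (- t / 2)"
          unfolding exp_add[symmetric] by (simp add: diff_divide_distrib)
        moreover have "norm (f (x + of_real t)) \<le> C * exp (- Re (x + of_real t) / 2)"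
          by (rule C(2)[OF _ strip_shift[OF r(2)]]) (use elim in auto)
        ultimately show ?thesis by (simp only: mult.assoc)
      qed
      from mult_right_mono[OF this, of "t powr Re z"] show ?case
        using elim by (simp only: F_def norm_mult norm_powr_real_powr norm_of_real mult.assoc powr_ge_zero simp_thms)
           (simp add: norm_powr_real_powr)
    qed
    from Lim_null_comparison[OF this lim] have "(F \<longlongrightarrow> 0) at_top" .
    then show "((F \<circ> real_of_ereal) \<longlongrightarrow> 0) (at_left \<infinity>)"
      by (simp add: ereal_tendsto_simps1)
  qed simp
  moreover have "(LBINT t=ereal a..\<infinity>. G t) = (LINT t:{a<..}|lborel. deriv f (x + of_real t) * of_real t powr z) + z * half_line a z f x"
    using set_integral_add(2)[OF I1 I2]
    by (simp add: interval_lebesgue_integral_def G_def half_line_def)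
  ultimately have "(LINT t:{a<..}|lborel. deriv f (x + of_real t) * of_real t powr z) = - A - z * half_line a z f x"
    by (simp add: eq_diff_eq)
  moreover have "half_line a (z + 1) (nderiv f) x = - (LINT t:{a<..}|lborel. deriv f (x + of_real t) * of_real t powr z)"
    by (simp add: half_line_def nderiv_def set_lebesgue_integral_def)
  ultimately show ?thesis by simp
qed

lemma tendsto_shift_strip:
  assumes "decaying {f}" "x \<in> strip 1" "a \<ge> 0"
  shows "((\<lambda>t. f (x + of_real t)) \<longlongrightarrow> f (x + of_real a)) (at_right a)"
proof -
  have "isCont f (x + of_real a)"
    using holomorphic_on_imp_continuous_on[OF decaying_holo[OF assms(1)]] strip_shift[OF assms(2,3)]
    by (auto simp: continuous_on_eq_continuous_at)
  then show ?thesis by (rule isCont_tendsto_compose) (intro tendsto_intros)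
qed

section \<open>Continuation of the Weyl integral to all orders\<close>

lemma mellin_nderiv:
  assumes "decaying {f}" "x \<in> strip 1" "Re z > 0"
  shows "mellin (z + 1) (nderiv f) x = mellin z f x"
proof -
  have "((\<lambda>t. of_real t powr z) \<longlongrightarrow> (0::complex)) (at_right 0)"
  proof (rule Lim_null_comparison)
    show "\<forall>\<^sub>F t in at_right 0. norm (of_real t powr z :: complex) \<le> t powr Re z"
      by (rule eventually_mono[OF eventually_at_right_less]) (simp add: norm_powr_real_powr)
    show "((\<lambda>t. t powr Re z) \<longlongrightarrow> 0) (at_right 0)" using assms(3) by real_asymp
  qed
  from tendsto_mult[OF tendsto_shift_strip[OF assms(1,2) order_refl] this]
  have "half_line 0 (z + 1) (nderiv f) x = z * half_line 0 z f x + 0"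
    using assms by (intro half_line_nderiv) auto
  then show ?thesis by (simp add: mellin_half_line rGamma_plus1[of z, symmetric])
qed

text \<open>The fundamental theorem of calculus: for order 1 the kernel is constant, and only the
  boundary value at t = 0 survives. This is what makes W_0 the identity.\<close>

lemma mellin_1_nderiv:
  assumes "decaying {f}" "x \<in> strip 1"
  shows "mellin 1 (nderiv f) x = f x"
proof -
  have "\<forall>\<^sub>F t in at_right 0. f (x + of_real t) = f (x + of_real t) * complex_of_real t powr 0"
    by (rule eventually_mono[OF eventually_at_right_less]) auto
  then have "((\<lambda>t. f (x + of_real t) * complex_of_real t powr 0) \<longlongrightarrow> f x) (at_right 0)"
    using tendsto_shift_strip[OF assms order_refl] by (auto elim: Lim_transform_eventually)
  then have "half_line 0 (0 + 1) (nderiv f) x = 0 * half_line 0 0 f x + f x"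
    using assms by (intro half_line_nderiv) auto
  then show ?thesis by (simp add: mellin_half_line rGamma_inverse_Gamma)
qed

text \<open>This \<open>m\<close> is the least natural number that brings the real part of the order
  to 1 or more; by \<open>weyl_eq_mellin\<close>, on the strip every \<open>m\<close> that makes it
  positive gives the same value.\<close>

definition weyl :: "complex \<Rightarrow> (complex \<Rightarrow> complex) \<Rightarrow> complex \<Rightarrow> complex" where
  "weyl z f = (let m = nat \<lceil>1 - Re z\<rceil> in mellin (z + of_nat m) ((nderiv ^^ m) f))"

lemma decaying_nderiv_pow1: "decaying {f} \<Longrightarrow> decaying {(nderiv ^^ m) f}"
  using decaying_nderiv_pow[of "{f}"] by simp

text \<open>Two admissible orders m and n are both compared with m + n, by repeated use of W_z f =
  W_(z+1) (D f).\<close>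

lemma weyl_eq_mellin:
  assumes dec: "decaying {f}" and x: "x \<in> strip 1" and m: "Re z + real m > 0"
  shows "weyl z f x = mellin (z + of_nat m) ((nderiv ^^ m) f) x"
proof -
  have step: "mellin (z + of_nat (m + k)) ((nderiv ^^ (m + k)) f) x = mellin (z + of_nat m) ((nderiv ^^ m) f) x"
    if "Re z + real m > 0" for m k
  proof (induction k)
    case (Suc k)
    have "mellin (z + of_nat (m + k) + 1) (nderiv ((nderiv ^^ (m + k)) f)) x = mellin (z + of_nat (m + k)) ((nderiv ^^ (m + k)) f) x"
      by (rule mellin_nderiv[OF decaying_nderiv_pow1[OF dec] x]) (use that in auto)
    then show ?case using Suc by (simp add: add_ac)
  qed simp
  define n where "n = nat \<lceil>1 - Re z\<rceil>"
  have n: "Re z + real n > 0" unfolding n_def by linarith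
  show ?thesis
    using step[OF m, of n] step[OF n, of m] by (simp add: weyl_def n_def[symmetric] add.commute)
qed

lemma ex_weyl_order: "\<exists>m. Re z + real m > 0"
proof -
  obtain n where "- Re z < real n" using reals_Archimedean2 by blast
  then show ?thesis by (intro exI[of _ n]) linarith
qed

lemma weyl_diff_nat:
  assumes "decaying {f}" "x \<in> strip 1"
  shows "weyl (z - of_nat i) f x = weyl z ((nderiv ^^ i) f) x"
proof -
  obtain m where m: "Re z + real m > 0" using ex_weyl_order by blast
  show ?thesis
    using weyl_eq_mellin[OF assms, of "z - of_nat i" "m + i"] weyl_eq_mellin[OF decaying_nderiv_pow1[OF assms(1), of i] assms(2) m] m
    by (simp add: funpow_add)
qed

lemma weyl_0:
  assumes "decaying {f}" "x \<in> strip 1"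
  shows "weyl 0 f x = f x"
  using weyl_eq_mellin[OF assms, of 0 1] mellin_1_nderiv[OF assms] by simp

lemma weyl_minus_nat:
  assumes "decaying {f}" "x \<in> strip 1"
  shows "weyl (- of_nat l) f x = (nderiv ^^ l) f x"
  using weyl_diff_nat[OF assms, of 0 l] weyl_0[OF decaying_nderiv_pow1[OF assms(1)] assms(2)] by simp

text \<open>\<open>weyl\<close> is known to agree with a Mellin transform only on
  \<open>strip 1\<close>, not as a function, so \<open>decaying_subset\<close> cannot carry the
  bounds over.\<close>

lemma decaying_transfer:
  assumes B: "decaying B" and A: "\<And>h. h \<in> A \<Longrightarrow> \<exists>g\<in>B. \<forall>x\<in>strip 1. h x = g x"
  shows "decaying A"
proof (rule decayingI)
  fix h assume "h \<in> A"
  from A[OF this] obtain g where g: "g \<in> B" "\<forall>x\<in>strip 1. h x = g x" by blast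
  then show "h holomorphic_on strip 1"
    using decaying_holo[OF B g(1)] by (simp cong: holomorphic_cong)
next
  fix r :: real assume r: "r < 1"
  obtain C where C: "\<And>f x. f \<in> B \<Longrightarrow> x \<in> strip r \<Longrightarrow> norm (f x) \<le> C * exp (- Re x / 2)"
    using decaying_bound[OF B r] by metis
  show "\<exists>C. \<forall>f\<in>A. \<forall>x\<in>strip r. norm (f x) \<le> C * exp (- Re x / 2)"
  proof (intro exI ballI)
    fix h x assume hx: "h \<in> A" "x \<in> strip r"
    from A[OF this(1)] obtain g where g: "g \<in> B" "\<forall>x\<in>strip 1. h x = g x" by blast
    have "x \<in> strip 1" using hx(2) r by (auto intro: strip_mono)
    then show "norm (h x) \<le> C * exp (- Re x / 2)" using g C[OF g(1) hx(2)] by simp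
  qed
qed

text \<open>One \<open>m\<close> \<ge> M + 1 serves all z of norm at most M: the shifted orders lie
  in a compact disc about m with real parts at least 1, and there \<open>rGamma\<close> is
  bounded.\<close>

lemma decaying_weyl:
  assumes dec: "decaying A"
  shows "decaying {weyl z f |z f. norm z \<le> M \<and> f \<in> A}"
proof -
  define m where "m = nat \<lceil>M + 1\<rceil>"
  define Z where "Z = cball (of_nat m :: complex) M"
  obtain B where B: "\<forall>z\<in>Z. norm (rGamma z) \<le> B"
    using compact_imp_bounded[OF compact_continuous_image[OF holomorphic_on_imp_continuous_on[OF holomorphic_rGamma], of Z]]
    by (auto simp: bounded_iff Z_def)
  have m: "real m \<ge> M + 1" by (simp add: m_def) linarith
  have D: "decaying {mellin z f |z f. z \<in> Z \<and> f \<in> (nderiv ^^ m) ` A}"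
  proof (rule decaying_mellin[OF decaying_nderiv_pow[OF dec], of 1 "max 1 (real m + M)"])
    fix z assume z: "z \<in> Z"
    then have "norm (z - of_nat m) \<le> M" by (auto simp: Z_def dist_norm norm_minus_commute)
    then have "\<bar>Re z - real m\<bar> \<le> M" using abs_Re_le_cmod[of "z - of_nat m"] by simp
    then show "1 \<le> Re z \<and> Re z \<le> max 1 (real m + M) \<and> norm (rGamma z) \<le> B"
      using m B z by auto
  qed auto
  then show ?thesis
  proof (rule decaying_transfer)
    fix h assume "h \<in> {weyl z f |z f. norm z \<le> M \<and> f \<in> A}"
    then obtain z f where h: "h = weyl z f" "norm z \<le> M" "f \<in> A" by blast
    have "Re z + real m > 0" using h(2) m abs_Re_le_cmod[of z] by linarith
    then have "\<forall>x\<in>strip 1. h x = mellin (z + of_nat m) ((nderiv ^^ m) f) x"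
      unfolding h(1) by (intro ballI weyl_eq_mellin decaying_subset[OF dec]) (use h in auto)
    moreover have "z + of_nat m \<in> Z" using h by (auto simp: Z_def dist_norm)
    then have "mellin (z + of_nat m) ((nderiv ^^ m) f) \<in> {mellin z f |z f. z \<in> Z \<and> f \<in> (nderiv ^^ m) ` A}"
      using h(3) by blast
    ultimately show "\<exists>g\<in>{mellin z f |z f. z \<in> Z \<and> f \<in> (nderiv ^^ m) ` A}. \<forall>x\<in>strip 1. h x = g x"
      by (rule bexI)
  qed
qed

lemma decaying_weyl1: "decaying {f} \<Longrightarrow> decaying {weyl z f}"
  by (rule decaying_subset[OF decaying_weyl[of "{f}" "norm z"]]) auto

lemma nderiv_pow_weyl:
  assumes dec: "decaying {f}" and x: "x \<in> strip 1"
  shows "(nderiv ^^ i) (weyl z f) x = weyl z ((nderiv ^^ i) f) x"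
  using x
proof (induction i arbitrary: x)
  case (Suc i)
  obtain m where m: "Re z + real m > 0" using ex_weyl_order by blast
  let ?g = "(nderiv ^^ i) f"
  have g: "decaying {?g}" by (rule decaying_nderiv_pow1[OF dec])
  have "(nderiv ^^ Suc i) (weyl z f) x = (nderiv ^^ 1) ((nderiv ^^ i) (weyl z f)) x" by simp
  also have "\<dots> = (nderiv ^^ 1) (mellin (z + of_nat m) ((nderiv ^^ m) ?g)) x"
    by (rule nderiv_cong[OF _ Suc.prems]) (use Suc.IH weyl_eq_mellin[OF g _ m] in auto)
  also have "\<dots> = mellin (z + of_nat m) (nderiv ((nderiv ^^ m) ?g)) x"
    using m by (simp add: nderiv_mellin decaying_nderiv_pow1[OF g] Suc.prems)
  also have "\<dots> = weyl z ((nderiv ^^ Suc i) f) x"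
    using weyl_eq_mellin[OF decaying_nderiv_pow1[OF dec, of "Suc i"] Suc.prems m] by (simp add: funpow_swap1)
  finally show ?case .
qed simp

lemma weyl_shift_nat:
  assumes "decaying {f}" "x \<in> strip 1"
  shows "weyl (z - of_nat i) f x = (nderiv ^^ i) (weyl z f) x"
  using nderiv_pow_weyl[OF assms] weyl_diff_nat[OF assms] by simp

text \<open>On the half-plane Re z > -m a single Mellin transform represents \<open>weyl\<close>,
  and these half-planes exhaust the plane.\<close>

lemma holomorphic_weyl:
  assumes dec: "decaying {f}" and x: "x \<in> strip 1"
  shows "(\<lambda>z. weyl z f x) holomorphic_on UNIV"
proof -
  have "(\<lambda>z. weyl z f x) holomorphic_on {z. - real m < Re z}" for m
  proof -
    have "(\<lambda>z. mellin (z + of_nat m) ((nderiv ^^ m) f) x) holomorphic_on {z. - real m < Re z}"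
      by (rule holomorphic_on_compose_gen[OF _ holomorphic_mellin[OF decaying_nderiv_pow1[OF dec] x], unfolded o_def])
        (auto intro!: holomorphic_intros)
    then show ?thesis
      by (rule holomorphic_transform) (auto intro!: weyl_eq_mellin[OF dec x, symmetric])
  qed
  then have "(\<lambda>z. weyl z f x) holomorphic_on (\<Union>m. {z. - real m < Re z})"
    by (intro holomorphic_on_UN_open) (auto simp: open_halfspace_Re_gt)
  moreover have "(\<Union>m. {z. - real m < Re z}) = UNIV"
  proof -
    have "\<exists>m. - real m < Re z" for z
    proof -
      obtain m where "Re z + real m > 0" using ex_weyl_order by blast
      then show ?thesis by (intro exI[of _ m]) linarith
    qed
    then show ?thesis by blast
  qed
  ultimately show ?thesis by simp
qed

lemma holomorphic_weyl_param:
  assumes Z: "open Z" and dec: "decaying (f ` Z)"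
    and hol: "\<And>y. y \<in> strip 1 \<Longrightarrow> (\<lambda>z. f z y) holomorphic_on Z" and x: "x \<in> strip 1"
  shows "(\<lambda>z. weyl w (f z) x) holomorphic_on Z"
proof -
  obtain m where m: "Re w + real m > 0" using ex_weyl_order by blast
  have "(\<lambda>z. mellin (w + of_nat m) ((nderiv ^^ m) (f z)) x) holomorphic_on Z"
    using decaying_nderiv_pow[OF dec, of m] m
    by (intro holomorphic_mellin_param[OF Z _ holomorphic_nderiv_pow_param[OF Z dec hol] x]) (auto simp: image_image)
  then show ?thesis
    by (rule holomorphic_transform)
      (auto intro!: weyl_eq_mellin[symmetric] decaying_subset[OF dec] x m)
qed

section \<open>The Hankel contour\<close>

text \<open>On t = \<epsilon> exp(iu) one has dt = i t du, so t^(z-1) dt = i t^z du; this explains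
  the exponent z. The logarithm is continued along the circle, its argument running from 0 to 2
  pi.\<close>

definition circle :: "real \<Rightarrow> complex \<Rightarrow> (complex \<Rightarrow> complex) \<Rightarrow> complex \<Rightarrow> complex" where
  "circle \<epsilon> z f x = (LINT u:{0..2*pi}|lborel.
     f (x + of_real \<epsilon> * cis u) * (\<i> * exp (z * (of_real (ln \<epsilon>) + \<i> * of_real u))))"

lemma circle_in_cball: "\<epsilon> > 0 \<Longrightarrow> x + of_real \<epsilon> * cis u \<in> cball x \<epsilon>"
  by (simp add: dist_norm norm_mult)

lemma continuous_on_circle:
  assumes f: "continuous_on S f" and sub: "cball x \<epsilon> \<subseteq> S" and e: "\<epsilon> > 0"
  shows "continuous_on A (\<lambda>u. f (x + of_real \<epsilon> * cis u) * (\<i> * exp (z * (of_real (ln \<epsilon>) + \<i> * of_real u))))"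
proof (intro continuous_on_mult)
  show "continuous_on A (\<lambda>u. f (x + of_real \<epsilon> * cis u))"
    by (rule continuous_on_compose2[OF f]) (use circle_in_cball[OF e, of x] sub in \<open>auto intro!: continuous_intros\<close>)
qed (intro continuous_intros)+

lemma set_integrable_circle:
  assumes "continuous_on S f" "cball x \<epsilon> \<subseteq> S" "\<epsilon> > 0"
  shows "set_integrable lborel {0..2*pi} (\<lambda>u. f (x + of_real \<epsilon> * cis u) * (\<i> * exp (z * (of_real (ln \<epsilon>) + \<i> * of_real u))))"
  by (intro borel_integrable_atLeastAtMost' continuous_on_circle[OF assms])

lemma exp_of_real_ln_powr: "\<epsilon> > 0 \<Longrightarrow> exp (z * of_real (ln \<epsilon>)) = complex_of_real \<epsilon> powr z"
  by (simp add: powr_def Ln_of_real)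

text \<open>Integration by parts once around the circle. The end points coincide, but t^z returns
  multiplied by exp(2 pi i z), which leaves a boundary term.\<close>

lemma circle_nderiv:
  assumes f: "f holomorphic_on S" and S: "open S" and sub: "cball x \<epsilon> \<subseteq> S" and e: "\<epsilon> > 0"
  shows "z * circle \<epsilon> z f x = circle \<epsilon> (z + 1) (nderiv f) x
    + f (x + of_real \<epsilon>) * of_real \<epsilon> powr z * (exp (2 * of_real pi * \<i> * z) - 1)"
proof -
  have cf: "continuous_on S f" and cf': "continuous_on S (nderiv f)"
    using f S by (auto simp: nderiv_def[abs_def] intro!: holomorphic_on_imp_continuous_on holomorphic_intros)
  define g1 where "g1 = (\<lambda>u. f (x + of_real \<epsilon> * cis u) * (\<i> * exp (z * (of_real (ln \<epsilon>) + \<i> * of_real u))))"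
  define g2 where "g2 = (\<lambda>u. nderiv f (x + of_real \<epsilon> * cis u) * (\<i> * exp ((z + 1) * (of_real (ln \<epsilon>) + \<i> * of_real u))))"
  define F where "F = (\<lambda>u. f (x + of_real \<epsilon> * cis u) * exp (z * (of_real (ln \<epsilon>) + \<i> * of_real u)))"
  have i1: "set_integrable lborel {0..2*pi} (\<lambda>u. z * g1 u)"
    using set_integrable_circle[OF cf sub e] by (intro set_integrable_mult_right) (simp add: g1_def)
  have i2: "set_integrable lborel {0..2*pi} g2"
    using set_integrable_circle[OF cf' sub e] by (simp add: g2_def)
  have "(LINT u:{0..2*pi}|lborel. z * g1 u - g2 u) = F (2 * pi) - F 0"
    unfolding set_lebesgue_integral_def
  proof (rule integral_FTC_atLeastAtMost)
    fix u :: real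
    have L: "exp ((z + 1) * (of_real (ln \<epsilon>) + \<i> * of_real u))
       = exp (z * (of_real (ln \<epsilon>) + \<i> * of_real u)) * (of_real \<epsilon> * exp (\<i> * of_real u))"
    proof -
      have "complex_of_real \<epsilon> = exp (of_real (ln \<epsilon>))" using e by (simp add: exp_of_real)
      then show ?thesis by (simp only: exp_add[symmetric]) (simp add: ring_distribs add_ac)
    qed
    have "x + of_real \<epsilon> * exp (\<i> * of_real u) \<in> S"
      using circle_in_cball[OF e, of x u] sub by (auto simp: cis_conv_exp)
    from holomorphic_derivI[OF f S this, of UNIV]
    have D: "(f has_field_derivative deriv f (x + of_real \<epsilon> * exp (\<i> * of_real u))) (at (x + of_real \<epsilon> * exp (\<i> * of_real u)))" .
    have D2: "((\<lambda>w. x + of_real \<epsilon> * exp (\<i> * w)) has_field_derivative of_real \<epsilon> * (exp (\<i> * of_real u) * \<i>)) (at (of_real u))"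
      by (auto intro!: derivative_eq_intros)
    have D3: "((\<lambda>w. exp (z * (of_real (ln \<epsilon>) + \<i> * w))) has_field_derivative exp (z * (of_real (ln \<epsilon>) + \<i> * of_real u)) * (z * \<i>)) (at (of_real u))"
      by (auto intro!: derivative_eq_intros)
    have "((\<lambda>w. f (x + of_real \<epsilon> * exp (\<i> * w)) * exp (z * (of_real (ln \<epsilon>) + \<i> * w))) has_field_derivative
       deriv f (x + of_real \<epsilon> * exp (\<i> * of_real u)) * (of_real \<epsilon> * (exp (\<i> * of_real u) * \<i>)) * exp (z * (of_real (ln \<epsilon>) + \<i> * of_real u))
       + exp (z * (of_real (ln \<epsilon>) + \<i> * of_real u)) * (z * \<i>) * f (x + of_real \<epsilon> * exp (\<i> * of_real u))) (at (of_real u))"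
      by (rule DERIV_mult[OF DERIV_chain2[OF D D2] D3])
    also have "deriv f (x + of_real \<epsilon> * exp (\<i> * of_real u)) * (of_real \<epsilon> * (exp (\<i> * of_real u) * \<i>)) * exp (z * (of_real (ln \<epsilon>) + \<i> * of_real u))
       + exp (z * (of_real (ln \<epsilon>) + \<i> * of_real u)) * (z * \<i>) * f (x + of_real \<epsilon> * exp (\<i> * of_real u)) = z * g1 u - g2 u"
      unfolding g1_def g2_def nderiv_def cis_conv_exp L by algebra
    finally show "(F has_vector_derivative z * g1 u - g2 u) (at u within {0..2*pi})"
      unfolding F_def cis_conv_exp
      by (rule has_vector_derivative_at_within[OF has_vector_derivative_real_field])
  next
    show "continuous_on {0..2*pi} (\<lambda>u. z * g1 u - g2 u)"
      unfolding g1_def g2_def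
      by (intro continuous_on_diff continuous_on_mult_left continuous_on_circle[OF cf sub e] continuous_on_circle[OF cf' sub e])
  qed simp
  moreover have "(LINT u:{0..2*pi}|lborel. z * g1 u - g2 u) = z * circle \<epsilon> z f x - circle \<epsilon> (z + 1) (nderiv f) x"
    using set_integral_diff(2)[OF i1 i2] by (simp add: circle_def g1_def g2_def)
  moreover have "F (2 * pi) - F 0 = f (x + of_real \<epsilon>) * of_real \<epsilon> powr z * (exp (2 * of_real pi * \<i> * z) - 1)"
    using e by (simp add: F_def ring_distribs exp_add exp_of_real_ln_powr) (simp add: mult_ac)
  ultimately show ?thesis by (simp add: diff_eq_eq add.commute)
qed

text \<open>The factor that t^z gains around the origin, minus 1 because the two half lines of the
  contour run in opposite directions. It is also the factor beside \<Gamma> in the denominators of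
  \<open>desing_approx\<close>.\<close>

definition monodromy :: "complex \<Rightarrow> complex" where
  "monodromy z = exp (2 * of_real pi * \<i> * z) - 1"

lemma monodromy_add_nat: "monodromy (z + of_nat m) = monodromy z"
proof -
  have "exp (2 * of_real pi * \<i> * of_nat m) = 1"
    using exp_integer_2pi[of "of_nat m"] by (simp add: mult_ac)
  then show ?thesis by (simp add: monodromy_def ring_distribs exp_add)
qed

lemma monodromy_add_1: "monodromy (z + 1) = monodromy z"
  using monodromy_add_nat[of z 1] by simp

lemma monodromy_nonzero:
  assumes "z \<notin> \<int>" shows "monodromy z \<noteq> 0"
proof
  assume "monodromy z = 0"
  then have "exp (2 * of_real pi * \<i> * z) = 1" by (simp add: monodromy_def)
  then obtain n :: int where "Im z = 0" "Re z = of_int n"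
    by (auto simp: exp_eq_1)
  then have "z = of_int n" by (simp add: complex_eq_iff)
  with assms show False by simp
qed

definition hankel_value :: "real \<Rightarrow> complex \<Rightarrow> (complex \<Rightarrow> complex) \<Rightarrow> complex \<Rightarrow> complex" where
  "hankel_value \<epsilon> z f x = monodromy z * half_line \<epsilon> z f x + circle \<epsilon> z f x"

lemma half_line_nderiv_pos:
  assumes dec: "decaying {f}" and x: "x \<in> strip 1" and e: "\<epsilon> > 0"
  shows "half_line \<epsilon> (z + 1) (nderiv f) x = z * half_line \<epsilon> z f x + f (x + of_real \<epsilon>) * of_real \<epsilon> powr z"
proof -
  have "((\<lambda>t. f (x + of_real t) * of_real t powr z) \<longlongrightarrow> f (x + of_real \<epsilon>) * of_real \<epsilon> powr z) (at_right \<epsilon>)"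
    using e by (intro tendsto_mult tendsto_shift_strip[OF dec x] tendsto_powr_complex tendsto_intros) (auto simp: complex_nonpos_Reals_iff)
  then show ?thesis using e by (intro half_line_nderiv[OF dec x]) auto
qed

lemma half_line_0_nderiv:
  assumes "decaying {f}" "x \<in> strip 1" "Re z > 0"
  shows "half_line 0 (z + 1) (nderiv f) x = z * half_line 0 z f x"
proof -
  have "rGamma (z + 1) \<noteq> 0"
    using assms(3) by (auto simp: rGamma_eq_zero_iff elim!: nonpos_Ints_cases dest!: arg_cong[of _ _ Re])
  then show ?thesis
    using mellin_nderiv[OF assms] by (simp add: mellin_half_line rGamma_plus1[of z, symmetric])
qed

text \<open>Within radius 3 \<epsilon> there is room for a Cauchy disc of radius 2 \<epsilon> about
  each point of \<open>cball x \<epsilon>\<close>; the ratio 1/2 of the two radii produces the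
  geometric decay in \<open>defect_zero\<close>. As r < 1, decaying functions are bounded on this
  disc.\<close>

context
  fixes \<epsilon> r :: real and x :: complex
  assumes e: "\<epsilon> > 0" and r: "r < 1" and sub: "cball x (3 * \<epsilon>) \<subseteq> strip r"
begin

lemma centre_in_strip: "x \<in> strip r" "x \<in> strip 1"
proof -
  show "x \<in> strip r" using e sub by auto
  then show "x \<in> strip 1" by (rule strip_mono) (use r in simp)
qed

lemma small_cball_sub: "cball x \<epsilon> \<subseteq> strip 1"
  using e r sub by (auto intro!: strip_mono[of _ r 1])

text \<open>The half line, weighted by the monodromy, and the circle contribute opposite boundary
  terms at x + \<epsilon>. The identity holds for every z because the contour stays away from t =
  0.\<close>

lemma hankel_value_nderiv:
  assumes dec: "decaying {f}"
  shows "z * hankel_value \<epsilon> z f x = hankel_value \<epsilon> (z + 1) (nderiv f) x"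
  using half_line_nderiv_pos[OF dec centre_in_strip(2) e, of z]
    circle_nderiv[OF decaying_holo[OF dec singletonI] open_strip small_cball_sub e, of z]
  by (simp add: hankel_value_def monodromy_add_1) (simp add: monodromy_def algebra_simps)

lemma hankel_value_nderiv_pow:
  assumes dec: "decaying {f}"
  shows "pochhammer z m * hankel_value \<epsilon> z f x = hankel_value \<epsilon> (z + of_nat m) ((nderiv ^^ m) f) x"
proof (induction m)
  case (Suc m)
  have "pochhammer z (Suc m) * hankel_value \<epsilon> z f x = (z + of_nat m) * hankel_value \<epsilon> (z + of_nat m) ((nderiv ^^ m) f) x"
    using Suc by (simp add: pochhammer_rec')
  also have "\<dots> = hankel_value \<epsilon> (z + of_nat m + 1) (nderiv ((nderiv ^^ m) f)) x"
    by (rule hankel_value_nderiv[OF decaying_nderiv_pow1[OF dec]])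
  finally show ?case by (simp add: add_ac)
qed simp

text \<open>The defect vanishes because \<open>z * defect z f = defect (z + 1) (nderiv f)\<close>: after \<open>m\<close> steps Cauchy's
  inequality bounds it by \<open>K / 2\<^sup>m\<close>.\<close>

definition defect :: "complex \<Rightarrow> (complex \<Rightarrow> complex) \<Rightarrow> complex" where
  "defect z f = circle \<epsilon> z f x - monodromy z * (half_line 0 z f x - half_line \<epsilon> z f x)"

lemma defect_nderiv:
  assumes dec: "decaying {f}" and z: "Re z > 0"
  shows "z * defect z f = defect (z + 1) (nderiv f)"
  using half_line_nderiv_pos[OF dec centre_in_strip(2) e, of z] half_line_0_nderiv[OF dec centre_in_strip(2) z]
    circle_nderiv[OF decaying_holo[OF dec singletonI] open_strip small_cball_sub e, of z]
  by (simp add: defect_def monodromy_add_1) (simp add: monodromy_def algebra_simps)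

lemma defect_nderiv_pow:
  assumes dec: "decaying {f}" and z: "Re z > 0"
  shows "pochhammer z m * defect z f = defect (z + of_nat m) ((nderiv ^^ m) f)"
proof (induction m)
  case (Suc m)
  have "pochhammer z (Suc m) * defect z f = (z + of_nat m) * defect (z + of_nat m) ((nderiv ^^ m) f)"
    using Suc by (simp add: pochhammer_rec')
  also have "\<dots> = defect (z + of_nat m + 1) (nderiv ((nderiv ^^ m) f))"
    by (rule defect_nderiv[OF decaying_nderiv_pow1[OF dec]]) (use z in simp)
  finally show ?case by (simp add: add_ac)
qed simp

lemma nderiv_pow_deriv: "(nderiv ^^ m) f y = (- 1) ^ m * (deriv ^^ m) f y"
  if "f holomorphic_on S" "open S" "y \<in> S" for f S y
  using that(3)
proof (induction m arbitrary: y)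
  case (Suc m)
  have "\<forall>\<^sub>F y in nhds y. (nderiv ^^ m) f y = (- 1) ^ m * (deriv ^^ m) f y"
    using eventually_nhds_in_open[OF that(2) Suc.prems] by eventually_elim (rule Suc.IH)
  then have "deriv ((nderiv ^^ m) f) y = deriv (\<lambda>y. (- 1) ^ m * (deriv ^^ m) f y) y"
    by (rule deriv_cong_ev) simp
  also have "\<dots> = (- 1) ^ m * deriv ((deriv ^^ m) f) y"
    using that Suc.prems by (intro deriv_cmult holomorphic_on_imp_differentiable_at[OF holomorphic_higher_deriv[OF that(1,2)] that(2)])
  finally show ?case unfolding nderiv_Suc by simp
qed simp

text \<open>What matters is the dependence on z: replacing z by z + m multiplies the bound by
  \<epsilon>^m for fixed B, since Im z and the monodromy do not change. With Re z \<ge> 1 the power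
  of t is largest at \<epsilon> on the missing piece (0, \<epsilon>].\<close>

lemma norm_defect_le:
  assumes g: "decaying {g}" and B: "\<And>y. y \<in> cball x \<epsilon> \<Longrightarrow> norm (g y) \<le> B" and z: "Re z \<ge> 1"
  shows "norm (defect z g) \<le> B * \<epsilon> powr Re z * (2 * pi * exp (2 * pi * \<bar>Im z\<bar>) + norm (monodromy z))"
proof -
  have B0: "B \<ge> 0" using order_trans[OF norm_ge_zero B[of x]] e by simp
  have "norm (circle \<epsilon> z g x) \<le> (\<integral>u. indicat_real {0..2*pi} u * (B * (\<epsilon> powr Re z * exp (2 * pi * \<bar>Im z\<bar>))) \<partial>lborel)"
    unfolding circle_def set_lebesgue_integral_def
  proof (rule order_trans[OF integral_norm_bound integral_mono])
    show "integrable lborel (\<lambda>u. norm (indicat_real {0..2*pi} u *\<^sub>R (g (x + of_real \<epsilon> * cis u) * (\<i> * exp (z * (of_real (ln \<epsilon>) + \<i> * of_real u))))))"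
      using set_integrable_circle[OF holomorphic_on_imp_continuous_on[OF decaying_holo[OF g singletonI]] small_cball_sub e]
      unfolding set_integrable_def by (rule integrable_norm)
    show "norm (indicat_real {0..2*pi} u *\<^sub>R (g (x + of_real \<epsilon> * cis u) * (\<i> * exp (z * (of_real (ln \<epsilon>) + \<i> * of_real u)))))
      \<le> indicat_real {0..2*pi} u * (B * (\<epsilon> powr Re z * exp (2 * pi * \<bar>Im z\<bar>)))" for u
    proof (cases "u \<in> {0..2*pi}")
      case True
      have "- Im z * u \<le> \<bar>Im z\<bar> * u" using True by (intro mult_right_mono) auto
      also have "\<dots> \<le> \<bar>Im z\<bar> * (2 * pi)" using True by (intro mult_left_mono) auto
      finally have "norm (exp (z * (of_real (ln \<epsilon>) + \<i> * of_real u))) \<le> \<epsilon> powr Re z * exp (2 * pi * \<bar>Im z\<bar>)"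
        using e by (simp add: norm_exp_eq_Re powr_def exp_add[symmetric] mult_ac)
      with B[OF circle_in_cball[OF e], of u] True B0 show ?thesis
        by (simp add: norm_mult mult_mono)
    qed simp
  qed (simp add: integrable_mult_left)
  also have "\<dots> = B * \<epsilon> powr Re z * (2 * pi * exp (2 * pi * \<bar>Im z\<bar>))" by simp
  finally have 1: "norm (circle \<epsilon> z g x) \<le> B * \<epsilon> powr Re z * (2 * pi * exp (2 * pi * \<bar>Im z\<bar>))" .
  have I0: "set_integrable lborel {0<..} (\<lambda>t. g (x + of_real t) * of_real t powr (z - 1))"
    using z by (intro set_integrable_half_line[OF g centre_in_strip(2)]) auto
  have I1: "set_integrable lborel {0<..\<epsilon>} (\<lambda>t. g (x + of_real t) * of_real t powr (z - 1))"
    by (rule set_integrable_subset[OF I0]) auto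
  have I2: "set_integrable lborel {\<epsilon><..} (\<lambda>t. g (x + of_real t) * of_real t powr (z - 1))"
    by (rule set_integrable_subset[OF I0]) (use e in auto)
  have U: "{0<..} = {0<..\<epsilon>} \<union> {\<epsilon><..}" using e by auto
  have "{0<..\<epsilon>} \<inter> {\<epsilon><..} = {}" by auto
  from set_integral_Un[OF this I1 I2] have "half_line 0 z g x = (LINT t:{0<..\<epsilon>}|lborel. g (x + of_real t) * of_real t powr (z - 1)) + half_line \<epsilon> z g x"
    unfolding half_line_def U .
  then have "norm (half_line 0 z g x - half_line \<epsilon> z g x) = norm (LINT t:{0<..\<epsilon>}|lborel. g (x + of_real t) * of_real t powr (z - 1))"
    by simp
  also have "\<dots> \<le> (\<integral>t. indicat_real {0<..\<epsilon>} t * (B * \<epsilon> powr (Re z - 1)) \<partial>lborel)"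
    unfolding set_lebesgue_integral_def
  proof (rule order_trans[OF integral_norm_bound integral_mono])
    show "integrable lborel (\<lambda>t. norm (indicat_real {0<..\<epsilon>} t *\<^sub>R (g (x + of_real t) * of_real t powr (z - 1))))"
      using I1 unfolding set_integrable_def by (rule integrable_norm)
    show "norm (indicat_real {0<..\<epsilon>} t *\<^sub>R (g (x + of_real t) * of_real t powr (z - 1)))
        \<le> indicat_real {0<..\<epsilon>} t * (B * \<epsilon> powr (Re z - 1))" for t
    proof (cases "t \<in> {0<..\<epsilon>}")
      case True
      then have "norm (g (x + of_real t)) \<le> B" by (intro B) (auto simp: dist_norm)
      moreover have "t powr (Re z - 1) \<le> \<epsilon> powr (Re z - 1)" using True z by (intro powr_mono2) auto
      ultimately show ?thesis using True B0 by (simp add: norm_mult norm_powr_real_powr mult_mono)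
    qed simp
  qed (rule integrable_mult_left, intro impI integrable_real_indicator, use e in auto)
  also have "\<dots> = B * \<epsilon> powr Re z"
    using e by (simp add: powr_diff)
  finally have 2: "norm (half_line 0 z g x - half_line \<epsilon> z g x) \<le> B * \<epsilon> powr Re z" .
  have "norm (defect z g) \<le> norm (circle \<epsilon> z g x) + norm (monodromy z) * norm (half_line 0 z g x - half_line \<epsilon> z g x)"
    unfolding defect_def by (metis norm_mult norm_triangle_ineq4)
  also have "\<dots> \<le> B * \<epsilon> powr Re z * (2 * pi * exp (2 * pi * \<bar>Im z\<bar>)) + norm (monodromy z) * (B * \<epsilon> powr Re z)"
    by (intro add_mono 1 mult_left_mono 2) auto
  finally show ?thesis by (simp add: algebra_simps)
qed

text \<open>The k-th factor z + k has real part at least k + 1. The resulting m! cancels the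
  factorial of Cauchy's inequality in \<open>defect_zero\<close>.\<close>

lemma norm_pochhammer_ge:
  assumes "Re z \<ge> 1" shows "fact m \<le> norm (pochhammer z m)"
proof (induction m)
  case (Suc m)
  have "1 + real m \<le> Re (z + of_nat m)" using assms by simp
  also have "\<dots> \<le> norm (z + of_nat m)" by (rule complex_Re_le_cmod)
  finally have "(1 + real m) * fact m \<le> norm (z + of_nat m) * norm (pochhammer z m)"
    using Suc by (intro mult_mono) auto
  then show ?case by (simp add: pochhammer_rec' norm_mult add.commute)
qed simp

lemma defect_zero:
  assumes f: "decaying {f}" and z: "Re z \<ge> 1"
  shows "defect z f = 0"
proof -
  obtain C where C: "C \<ge> 0" "\<And>f' y. f' \<in> {f} \<Longrightarrow> y \<in> strip r \<Longrightarrow> norm (f' y) \<le> C * exp (- Re y / 2)"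
    using decaying_bound[OF f r] by metis
  define B where "B = C * exp (1 / 2)"
  have B: "norm (f y) \<le> B" if "y \<in> strip r" for y
  proof -
    have "norm (f y) \<le> C * exp (- Re y / 2)" using C(2) that by simp
    also have "\<dots> \<le> B" unfolding B_def by (intro mult_left_mono C) (use that r in \<open>auto simp: strip_def\<close>)
    finally show ?thesis .
  qed
  have fh: "f holomorphic_on strip r"
    by (rule holomorphic_on_subset[OF decaying_holo[OF f]]) (use r in \<open>auto intro: strip_mono\<close>)
  define K where "K = B * \<epsilon> powr Re z * (2 * pi * exp (2 * pi * \<bar>Im z\<bar>) + norm (monodromy z))"
  have *: "norm (defect z f) \<le> K * (1 / 2) ^ m" for m
  proof -
    have D: "norm ((nderiv ^^ m) f y) \<le> fact m * B / (2 * \<epsilon>) ^ m" if y: "y \<in> cball x \<epsilon>" for y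
    proof -
      have s: "cball y (2 * \<epsilon>) \<subseteq> strip r"
      proof -
        have "dist x w \<le> 3 * \<epsilon>" if "dist y w \<le> 2 * \<epsilon>" for w
          using that y dist_triangle[of x w y] by simp
        then show ?thesis using sub by auto
      qed
      then have ys: "y \<in> strip r" using e by auto
      have "norm ((deriv ^^ m) f y) \<le> fact m * B / (2 * \<epsilon>) ^ m"
      proof (rule Cauchy_inequality)
        show "f holomorphic_on ball y (2 * \<epsilon>)" "continuous_on (cball y (2 * \<epsilon>)) f"
          using fh s by (meson ball_subset_cball holomorphic_on_imp_continuous_on holomorphic_on_subset order_trans)+
        show "norm (f w) \<le> B" if "norm (y - w) = 2 * \<epsilon>" for w
          using that s by (intro B) (auto simp: dist_norm)
      qed (use e in auto)
      then show ?thesis using nderiv_pow_deriv[OF fh open_strip ys, of m] by (simp add: norm_mult norm_power)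
    qed
    have "norm (monodromy (z + of_nat m)) = norm (monodromy z)" by (simp add: monodromy_add_nat)
    then have "norm (defect (z + of_nat m) ((nderiv ^^ m) f)) \<le> fact m * B / (2 * \<epsilon>) ^ m * \<epsilon> powr (Re z + real m) *
       (2 * pi * exp (2 * pi * \<bar>Im z\<bar>) + norm (monodromy z))"
      using norm_defect_le[OF decaying_nderiv_pow1[OF f] D, of "z + of_nat m"] z by simp
    \<comment> \<open>Here \<epsilon>^m from the shifted order meets (2 \<epsilon>)^m from the
      Cauchy discs.\<close>
    also have "\<dots> = fact m * (K * (1 / 2) ^ m)"
      using e by (simp add: K_def powr_add powr_realpow power_mult_distrib field_simps)
    finally have "norm (pochhammer z m) * norm (defect z f) \<le> fact m * (K * (1 / 2) ^ m)"
      using z by (simp add: norm_mult[symmetric] defect_nderiv_pow[OF f])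
    moreover have "fact m * norm (defect z f) \<le> norm (pochhammer z m) * norm (defect z f)"
      by (intro mult_right_mono norm_pochhammer_ge z) auto
    ultimately have "fact m * norm (defect z f) \<le> fact m * (K * (1 / 2) ^ m)" by linarith
    then show ?thesis by (rule mult_left_le_imp_le) simp
  qed
  have "(\<lambda>m. K * (1 / 2) ^ m) \<longlonglongrightarrow> K * 0"
    by (intro tendsto_mult_left LIMSEQ_power_zero) auto
  then have "norm (defect z f) \<le> 0"
    using * by (intro LIMSEQ_le_const) auto
  then show ?thesis by simp
qed

text \<open>Once the order is raised to real part at least 1, the defect vanishes and the contour
  collapses to the half line from 0. The factor \<open>pochhammer z m\<close> that this costs is the
  one relating \<Gamma>(z) and \<Gamma>(z + m). For non-integral z neither it nor the monodromy is
  zero.\<close>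

lemma hankel_value_weyl:
  assumes f: "decaying {f}" and z: "z \<notin> \<int>"
  shows "1 / (monodromy z * Gamma z) * hankel_value \<epsilon> z f x = weyl z f x"
proof -
  define m where "m = nat \<lceil>1 - Re z\<rceil>"
  have m: "Re (z + of_nat m) \<ge> 1" unfolding m_def by simp linarith
  have nz: "monodromy z \<noteq> 0" using z by (rule monodromy_nonzero)
  have p: "pochhammer z m \<noteq> 0" using z by (auto simp: pochhammer_eq_0_iff)
  let ?g = "(nderiv ^^ m) f"
  have "pochhammer z m * hankel_value \<epsilon> z f x = hankel_value \<epsilon> (z + of_nat m) ?g x"
    by (rule hankel_value_nderiv_pow[OF f])
  also have "\<dots> = monodromy z * half_line 0 (z + of_nat m) ?g x"
    using defect_zero[OF decaying_nderiv_pow1[OF f] m]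
    by (simp add: hankel_value_def defect_def monodromy_add_nat algebra_simps)
  finally have "hankel_value \<epsilon> z f x = monodromy z * half_line 0 (z + of_nat m) ?g x / pochhammer z m"
    using p by (simp add: field_simps)
  moreover have "weyl z f x = rGamma (z + of_nat m) * half_line 0 (z + of_nat m) ?g x"
    using m by (simp add: weyl_eq_mellin[OF f centre_in_strip(2), of z m] mellin_half_line)
  moreover have "1 / Gamma z = pochhammer z m * rGamma (z + of_nat m)"
    using pochhammer_rGamma[of z m] by (simp add: rGamma_inverse_Gamma field_simps)
  moreover have "1 / (monodromy z * Gamma z) * hankel_value \<epsilon> z f x = (1 / Gamma z) * (hankel_value \<epsilon> z f x / monodromy z)"
    by simp
  ultimately show ?thesis using nz p by simp
qed

end

text \<open>This is t^(z-1) dt along the parametrisation. At the corners u = 0 and u = 2 pi the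
  derivative does not exist and its value is unspecified; the two points are discarded as a
  countable set.\<close>

definition hankel_weight :: "real \<Rightarrow> complex \<Rightarrow> real \<Rightarrow> complex" where
  "hankel_weight \<epsilon> z u = hankel_powr \<epsilon> u (z - 1) * vector_derivative (hankel \<epsilon>) (at u)"

section \<open>The three pieces of the parametrised contour\<close>

lemma vector_derivative_hankel_neg:
  assumes "u < 0" shows "vector_derivative (hankel \<epsilon>) (at u) = - 1"
proof (rule vector_derivative_at)
  have "((\<lambda>u. complex_of_real (\<epsilon> - u)) has_vector_derivative - 1) (at u)"
    by (auto intro!: derivative_eq_intros)
  then show "(hankel \<epsilon> has_vector_derivative - 1) (at u)"
    by (rule has_vector_derivative_transform_within_open[of _ _ _ "{..<0}"])
      (use assms in \<open>auto simp: hankel_def hankel_abs_def hankel_arg_def\<close>)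
qed

lemma vector_derivative_hankel_circle:
  assumes "0 < u" "u < 2 * pi"
  shows "vector_derivative (hankel \<epsilon>) (at u) = \<i> * of_real \<epsilon> * cis u"
proof (rule vector_derivative_at)
  have "((\<lambda>w. of_real \<epsilon> * exp (\<i> * w)) has_field_derivative \<i> * of_real \<epsilon> * exp (\<i> * of_real u)) (at (of_real u))"
    by (auto intro!: derivative_eq_intros)
  then have "((\<lambda>u. of_real \<epsilon> * cis u) has_vector_derivative \<i> * of_real \<epsilon> * cis u) (at u)"
    unfolding cis_conv_exp by (rule has_vector_derivative_real_field)
  then show "(hankel \<epsilon> has_vector_derivative \<i> * of_real \<epsilon> * cis u) (at u)"
    by (rule has_vector_derivative_transform_within_open[of _ _ _ "{0<..<2*pi}"])
      (use assms in \<open>auto simp: hankel_def hankel_abs_def hankel_arg_def\<close>)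
qed

lemma vector_derivative_hankel_pos:
  assumes "u > 2 * pi" shows "vector_derivative (hankel \<epsilon>) (at u) = 1"
proof (rule vector_derivative_at)
  have "((\<lambda>u. complex_of_real (\<epsilon> + (u - 2 * pi))) has_vector_derivative 1) (at u)"
    by (auto intro!: derivative_eq_intros)
  then show "(hankel \<epsilon> has_vector_derivative 1) (at u)"
    by (rule has_vector_derivative_transform_within_open[of _ _ _ "{2*pi<..}"])
      (use assms pi_gt_zero in \<open>auto simp: hankel_def hankel_abs_def hankel_arg_def simp del: pi_gt_zero\<close>)
qed

lemma hankel_neg: "u < 0 \<Longrightarrow> hankel \<epsilon> u = of_real (\<epsilon> - u)"
  by (simp add: hankel_def hankel_abs_def hankel_arg_def)

lemma hankel_circle: "0 \<le> u \<Longrightarrow> u \<le> 2 * pi \<Longrightarrow> hankel \<epsilon> u = of_real \<epsilon> * cis u"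
  by (simp add: hankel_def hankel_abs_def hankel_arg_def)

lemma hankel_pos: "u > 2 * pi \<Longrightarrow> hankel \<epsilon> u = of_real (\<epsilon> - 2 * pi + u)"
proof -
  assume u: "u > 2 * pi"
  then have "\<not> u < 0" using pi_gt_zero by linarith
  then show ?thesis using u by (simp add: hankel_def hankel_abs_def hankel_arg_def)
qed

lemma hankel_weight_neg:
  assumes "u < 0" "\<epsilon> > 0"
  shows "hankel_weight \<epsilon> z u = - (of_real (\<epsilon> - u) powr (z - 1))"
proof -
  have "hankel_powr \<epsilon> u (z - 1) = exp ((z - 1) * of_real (ln (\<epsilon> - u)))"
    using assms by (simp add: hankel_powr_def hankel_abs_def hankel_arg_def)
  also have "\<dots> = of_real (\<epsilon> - u) powr (z - 1)"
    using assms by (intro exp_of_real_ln_powr) auto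
  finally show ?thesis using assms by (simp add: hankel_weight_def vector_derivative_hankel_neg)
qed

lemma hankel_weight_circle:
  assumes "0 < u" "u < 2 * pi" "\<epsilon> > 0"
  shows "hankel_weight \<epsilon> z u = \<i> * exp (z * (of_real (ln \<epsilon>) + \<i> * of_real u))"
proof -
  have "of_real \<epsilon> * cis u = exp (of_real (ln \<epsilon>) + \<i> * of_real u)"
    using assms by (simp add: exp_add cis_conv_exp exp_of_real)
  then have "hankel_weight \<epsilon> z u = \<i> * (exp ((z - 1) * (of_real (ln \<epsilon>) + \<i> * of_real u)) * exp (of_real (ln \<epsilon>) + \<i> * of_real u))"
    using assms by (simp add: hankel_weight_def vector_derivative_hankel_circle hankel_powr_def hankel_abs_def hankel_arg_def mult_ac)
  also have "\<dots> = \<i> * exp (z * (of_real (ln \<epsilon>) + \<i> * of_real u))"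
    unfolding exp_add[symmetric] by (simp add: algebra_simps)
  finally show ?thesis .
qed

lemma hankel_weight_pos:
  assumes "u > 2 * pi" "\<epsilon> > 0"
  shows "hankel_weight \<epsilon> z u = (monodromy z + 1) * of_real (\<epsilon> - 2 * pi + u) powr (z - 1)"
proof -
  have u: "\<not> u < 0" using assms pi_gt_zero by linarith
  have "hankel_powr \<epsilon> u (z - 1) = exp ((z - 1) * (of_real (ln (\<epsilon> - 2 * pi + u)) + \<i> * of_real (2 * pi)))"
    using assms u by (simp add: hankel_powr_def hankel_abs_def hankel_arg_def algebra_simps)
  also have "\<dots> = exp ((z - 1) * of_real (ln (\<epsilon> - 2 * pi + u))) * exp (2 * of_real pi * \<i> * z + of_int (- 1) * (2 * of_real pi * \<i>))"
    unfolding exp_add[symmetric] by (simp add: algebra_simps)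
  also have "exp (2 * of_real pi * \<i> * z + of_int (- 1) * (2 * of_real pi * \<i>)) = monodromy z + 1"
    using exp_integer_2pi[of "- 1"] by (simp add: monodromy_def exp_diff)
  also have "exp ((z - 1) * of_real (ln (\<epsilon> - 2 * pi + u))) = of_real (\<epsilon> - 2 * pi + u) powr (z - 1)"
    using assms by (intro exp_of_real_ln_powr) auto
  finally show ?thesis using assms by (simp add: hankel_weight_def vector_derivative_hankel_pos)
qed

lemma has_integral_hankel:
  assumes f: "decaying {f}" and x: "x \<in> strip 1" and sub: "cball x \<epsilon> \<subseteq> strip 1" and e: "\<epsilon> > 0"
  shows "has_bochner_integral lborel (\<lambda>u. f (x + hankel \<epsilon> u) * hankel_weight \<epsilon> z u) (hankel_value \<epsilon> z f x)"
proof -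
  define g where "g = (\<lambda>u. f (x + hankel \<epsilon> u) * hankel_weight \<epsilon> z u)"
  define H where "H = (\<lambda>t. indicat_real {\<epsilon><..} t *\<^sub>R (f (x + of_real t) * of_real t powr (z - 1)))"
  have H: "has_bochner_integral lborel H (half_line \<epsilon> z f x)"
    using set_integrable_half_line[OF f x, of \<epsilon> z] e
    by (simp add: has_bochner_integral_iff half_line_def set_lebesgue_integral_def set_integrable_def H_def)
  \<comment> \<open>The reflection of u to \<epsilon> - u carries the incoming piece to the half
    line; the minus sign is the derivative of the contour there.\<close>
  have "has_bochner_integral lborel (\<lambda>u. - H (\<epsilon> + (- 1) * u)) (- half_line \<epsilon> z f x)"
    using lborel_has_bochner_integral_real_affine_iff[of "- 1" H "half_line \<epsilon> z f x" \<epsilon>] H by (intro has_bochner_integral_minus) simp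
  also have "(\<lambda>u. - H (\<epsilon> + (- 1) * u)) = (\<lambda>u. indicat_real {..<0} u *\<^sub>R g u)"
    using e by (auto simp: fun_eq_iff H_def g_def hankel_neg hankel_weight_neg indicator_def)
  finally have A: "has_bochner_integral lborel (\<lambda>u. indicat_real {..<0} u *\<^sub>R g u) (- half_line \<epsilon> z f x)" .
  have "has_bochner_integral lborel (\<lambda>u. (monodromy z + 1) * H (\<epsilon> - 2 * pi + 1 * u)) ((monodromy z + 1) * half_line \<epsilon> z f x)"
    using lborel_has_bochner_integral_real_affine_iff[of 1 H "half_line \<epsilon> z f x" "\<epsilon> - 2 * pi"] H
    by (intro has_bochner_integral_mult_right) simp
  also have "(\<lambda>u. (monodromy z + 1) * H (\<epsilon> - 2 * pi + 1 * u)) = (\<lambda>u. indicat_real {2*pi<..} u *\<^sub>R g u)"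
    using e by (auto simp: fun_eq_iff H_def g_def hankel_pos hankel_weight_pos indicator_def)
  finally have C: "has_bochner_integral lborel (\<lambda>u. indicat_real {2*pi<..} u *\<^sub>R g u) ((monodromy z + 1) * half_line \<epsilon> z f x)" .
  have "has_bochner_integral lborel (\<lambda>u. indicat_real {0..2*pi} u *\<^sub>R (f (x + of_real \<epsilon> * cis u) * (\<i> * exp (z * (of_real (ln \<epsilon>) + \<i> * of_real u))))) (circle \<epsilon> z f x)"
    using set_integrable_circle[OF holomorphic_on_imp_continuous_on[OF decaying_holo[OF f singletonI]] sub e]
    by (simp add: has_bochner_integral_iff circle_def set_lebesgue_integral_def set_integrable_def)
  then have B: "has_bochner_integral lborel (\<lambda>u. indicat_real {0..2*pi} u *\<^sub>R g u) (circle \<epsilon> z f x)"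
    by (subst has_bochner_integral_discrete_difference[where X = "{0, 2*pi}"])
      (use e in \<open>auto simp: g_def hankel_circle hankel_weight_circle indicator_def\<close>)
  have "has_bochner_integral lborel (\<lambda>u. indicat_real {..<0} u *\<^sub>R g u + indicat_real {2*pi<..} u *\<^sub>R g u + indicat_real {0..2*pi} u *\<^sub>R g u)
     (- half_line \<epsilon> z f x + (monodromy z + 1) * half_line \<epsilon> z f x + circle \<epsilon> z f x)"
    by (intro has_bochner_integral_add A B C)
  also have "(\<lambda>u. indicat_real {..<0} u *\<^sub>R g u + indicat_real {2*pi<..} u *\<^sub>R g u + indicat_real {0..2*pi} u *\<^sub>R g u) = g"
    using pi_gt_zero by (auto simp: fun_eq_iff indicator_def simp del: pi_gt_zero)
  also have "- half_line \<epsilon> z f x + (monodromy z + 1) * half_line \<epsilon> z f x + circle \<epsilon> z f x = hankel_value \<epsilon> z f x"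
    by (simp add: hankel_value_def algebra_simps)
  finally show ?thesis by (simp add: g_def)
qed

section \<open>Measurability and fibres of the contour\<close>

lemma measurable_cis [measurable]: "cis \<in> borel_measurable borel"
  by (intro borel_measurable_continuous_onI continuous_intros)

lemma measurable_hankel [measurable]: "hankel \<epsilon> \<in> borel_measurable borel"
  unfolding hankel_def hankel_abs_def hankel_arg_def by measurable

lemma measurable_hankel_weight [measurable]: "hankel_weight \<epsilon> z \<in> borel_measurable borel"
proof -
  have [measurable]: "(\<lambda>u. if u < 0 then - 1 else if u \<le> 2 * pi then \<i> * of_real \<epsilon> * cis u else 1) \<in> borel_measurable borel"
    by measurable
  then have [measurable]: "(\<lambda>u. vector_derivative (hankel \<epsilon>) (at u)) \<in> borel_measurable borel"
    by (rule measurable_discrete_difference[where X = "{0, 2*pi}"])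
      (auto simp: vector_derivative_hankel_neg vector_derivative_hankel_circle vector_derivative_hankel_pos not_less not_le)
  show ?thesis
    unfolding hankel_weight_def[abs_def] hankel_powr_def hankel_abs_def hankel_arg_def by measurable
qed

text \<open>Makes the parameters with x + \<open>hankel \<epsilon> u\<close> = 0 negligible, where
  \<open>dbern0\<close> takes its conventional value. On the circle a fibre lies in one coset of the
  multiples of 2 pi, and each half line adds at most one point.\<close>

lemma countable_hankel_vimage:
  assumes "\<epsilon> > 0"
  shows "countable {u. hankel \<epsilon> u = w}"
proof -
  have "countable ({u. hankel \<epsilon> u = w} \<inter> {0..2*pi})"
  proof (cases "{u. hankel \<epsilon> u = w} \<inter> {0..2*pi} = {}")
    case False
    then obtain v where v: "hankel \<epsilon> v = w" "v \<in> {0..2*pi}" by blast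
    have "{u. hankel \<epsilon> u = w} \<inter> {0..2*pi} \<subseteq> range (\<lambda>n::int. v + 2 * of_int n * pi)"
    proof
      fix u assume u: "u \<in> {u. hankel \<epsilon> u = w} \<inter> {0..2*pi}"
      then have "of_real \<epsilon> * cis u = of_real \<epsilon> * cis v"
        using v hankel_circle[of u \<epsilon>] hankel_circle[of v \<epsilon>] by auto
      then have "exp (\<i> * of_real u) = exp (\<i> * of_real v)" using assms by (simp add: cis_conv_exp)
      then obtain n :: int where "\<i> * of_real u = \<i> * of_real v + of_int (2 * n) * of_real pi * \<i>"
        by (auto simp: exp_eq)
      then have "\<i> * of_real u = \<i> * complex_of_real (v + 2 * of_int n * pi)" by (simp add: algebra_simps)
      then have "u = v + 2 * of_int n * pi" by (simp only: mult_cancel_left of_real_eq_iff) simp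
      then show "u \<in> range (\<lambda>n::int. v + 2 * of_int n * pi)" by blast
    qed
    then show ?thesis by (rule countable_subset) simp
  qed (simp only: countable_empty)
  moreover have "{u. hankel \<epsilon> u = w} \<subseteq> ({u. hankel \<epsilon> u = w} \<inter> {0..2*pi}) \<union> {\<epsilon> - Re w} \<union> {Re w - \<epsilon> + 2 * pi}"
  proof
    fix u assume u: "u \<in> {u. hankel \<epsilon> u = w}"
    consider "u < 0" | "u \<in> {0..2*pi}" | "u > 2 * pi" by force
    then show "u \<in> ({u. hankel \<epsilon> u = w} \<inter> {0..2*pi}) \<union> {\<epsilon> - Re w} \<union> {Re w - \<epsilon> + 2 * pi}"
      using u by cases (auto simp: hankel_neg hankel_pos)
  qed
  ultimately show ?thesis by (elim countable_subset) simp
qed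

section \<open>The limit integrand\<close>

definition bern :: "complex \<Rightarrow> complex" where
  "bern y = (if y = 0 then 1 else y / (exp y - 1))"

text \<open>The nonzero periods of exp are at distance at least 2 pi > 3 from the real axis.\<close>

lemma exp_ne_1_strip:
  assumes "y \<in> strip 3" "y \<noteq> 0" shows "exp y \<noteq> 1"
proof
  assume "exp y = 1"
  then obtain n :: int where n: "Re y = 0" "Im y = of_int (2 * n) * pi" by (auto simp: exp_eq_1)
  have "n = 0"
  proof (rule ccontr)
    assume "n \<noteq> 0"
    then have "1 \<le> \<bar>real_of_int n\<bar>" by linarith
    then have "2 * pi \<le> \<bar>Im y\<bar>" using n by (simp add: abs_mult mult_le_cancel_right)
    then show False using assms pi_gt3 by (auto simp: strip_def)
  qed
  with n assms show False by (simp add: complex_eq_iff)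
qed

lemma bern_holo: "bern holomorphic_on strip 3"
proof (rule no_isolated_singularity'[where K = "{0}"])
  have "((\<lambda>h. (exp (0 + h) - exp 0) / h) \<longlongrightarrow> exp (0::complex)) (at 0)"
    using DERIV_exp[of "0::complex"] by (simp only: DERIV_def)
  then have "((\<lambda>h. inverse ((exp h - 1) / h)) \<longlongrightarrow> inverse (1::complex)) (at 0)"
    by (intro tendsto_inverse) auto
  then have "((\<lambda>h. h / (exp h - 1)) \<longlongrightarrow> (1::complex)) (at 0)" by (simp add: inverse_eq_divide)
  then have "(bern \<longlongrightarrow> 1) (at 0)"
    by (rule Lim_transform_eventually) (simp add: bern_def eventually_at_filter)
  then have "(bern \<longlongrightarrow> bern 0) (at 0)" by (simp add: bern_def)
  then show "(bern \<longlongrightarrow> bern z) (at z within strip 3)" if "z \<in> {0}" for z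
    using that by (auto intro: tendsto_within_subset)
  have "(\<lambda>y. y / (exp y - 1)) holomorphic_on strip 3 - {0}"
    by (intro holomorphic_intros) (use exp_ne_1_strip in auto)
  then show "bern holomorphic_on strip 3 - {0}"
    by (rule holomorphic_transform) (auto simp: bern_def)
qed auto

text \<open>The rate 3/4 is below 1, to absorb the numerator y, and large enough that two thirds of
  it is 1/2. Up to real part 1 compactness gives the bound; beyond, the exponential
  dominates.\<close>

lemma bern_bound:
  obtains C where "C \<ge> 0" "\<And>y. y \<in> strip 2 \<Longrightarrow> norm (bern y) \<le> C * exp (- (3 / 4) * Re y)"
proof -
  have sub: "cbox (Complex (- 2) (- 2)) (Complex 1 2) \<subseteq> strip 3"
    by (auto simp: strip_def in_cbox_complex_iff)
  obtain B where B: "\<forall>y\<in>cbox (Complex (- 2) (- 2)) (Complex 1 2). norm (bern y) \<le> B"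
    using compact_imp_bounded[OF compact_continuous_image[OF continuous_on_subset[OF holomorphic_on_imp_continuous_on[OF bern_holo] sub] compact_cbox]]
    by (auto simp: bounded_iff)
  have B0: "B \<ge> 0" using B[rule_format, of 0] order_trans[OF norm_ge_zero] by (auto simp: in_cbox_complex_iff)
  show ?thesis
  proof (rule that[of "B * exp (3 / 4) + 24"])
    fix y assume y: "y \<in> strip 2"
    show "norm (bern y) \<le> (B * exp (3 / 4) + 24) * exp (- (3 / 4) * Re y)"
    proof (cases "Re y \<le> 1")
      case True
      have "y \<in> cbox (Complex (- 2) (- 2)) (Complex 1 2)"
        using y True by (auto simp: strip_def in_cbox_complex_iff abs_less_iff)
      then have "norm (bern y) \<le> B * 1" using B by simp
      also have "\<dots> \<le> B * (exp (3 / 4) * exp (- (3 / 4) * Re y))"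
        unfolding exp_add[symmetric] by (intro mult_left_mono B0) (use True in simp)
      also have "\<dots> \<le> (B * exp (3 / 4) + 24) * exp (- (3 / 4) * Re y)" by (simp add: ring_distribs)
      finally show ?thesis .
    next
      case False
      then have ny: "y \<noteq> 0" by auto
      have 1: "norm y \<le> 3 * Re y" using cmod_le[of y] y False by (auto simp: strip_def)
      have "2 \<le> exp (1::real)" using exp_ge_add_one_self[of "1::real"] by simp
      also have "\<dots> \<le> exp (Re y)" using False by simp
      finally have "exp (Re y) / 2 \<le> exp (Re y) - 1" by simp
      also have "\<dots> \<le> norm (exp y - 1)" using norm_triangle_ineq2[of "exp y" 1] by simp
      finally have 2: "exp (Re y) / 2 \<le> norm (exp y - 1)" .
      have "norm y / norm (exp y - 1) \<le> (3 * Re y) / (exp (Re y) / 2)"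
        by (rule frac_le) (use 1 2 False in auto)
      then have "norm (bern y) \<le> (3 * Re y) / (exp (Re y) / 2)"
        using ny by (simp only: bern_def norm_divide if_False)
      \<comment> \<open>A quarter of the decay is spent on the linear factor through Re y / 4 \<le>
        exp(Re y / 4); the constant is 24 = 3 * 2 * 4.\<close>
      also have "\<dots> = 24 * (Re y / 4) * exp (- Re y)" by (simp add: exp_minus field_simps)
      also have "\<dots> \<le> 24 * exp (Re y / 4) * exp (- Re y)"
      proof -
        have "Re y / 4 \<le> exp (Re y / 4)" using exp_ge_add_one_self[of "Re y / 4"] by linarith
        then show ?thesis by (intro mult_right_mono mult_left_mono) auto
      qed
      also have "\<dots> = 24 * exp (- (3 / 4) * Re y)" by (simp add: exp_add[symmetric])
      also have "\<dots> \<le> (B * exp (3 / 4) + 24) * exp (- (3 / 4) * Re y)" using B0 by (simp add: ring_distribs)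
      finally show ?thesis .
    qed
  qed (use B0 in auto)
qed

definition dbern :: "complex \<Rightarrow> complex" where
  "dbern = deriv bern"

lemma dbern_bound:
  obtains C where "C \<ge> 0" "\<And>y. y \<in> strip (3 / 2) \<Longrightarrow> norm (dbern y) \<le> C * exp (- (3 / 4) * Re y)"
proof -
  obtain C where C: "C \<ge> 0" "\<And>y. y \<in> strip 2 \<Longrightarrow> norm (bern y) \<le> C * exp (- (3 / 4) * Re y)"
    using bern_bound by metis
  show ?thesis
  proof (rule that[of "C * exp (3 / 8) / (1 / 2)"])
    fix y assume y: "y \<in> strip (3 / 2)"
    have sub: "w \<in> strip 2 \<and> norm (w - y) \<le> 1 / 2" if "w \<in> cball y (1 / 2)" for w
      using strip_add[OF y, of "w - y" "1/2"] that by (auto simp: dist_norm norm_minus_commute)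
    have "norm (deriv bern y) \<le> (C * exp (3 / 8) * exp (- (3 / 4) * Re y)) / (1 / 2)"
    proof (rule deriv_bound_cball[OF bern_holo])
      show "cball y (1 / 2) \<subseteq> strip 3" using sub by (auto intro: strip_mono[of _ 2] simp del: mem_cball)
      fix w assume "w \<in> cball y (1 / 2)"
      note w = sub[OF this]
      have "Re y - 1 / 2 \<le> Re w" using w abs_Re_le_cmod[of "w - y"] by auto
      then have "exp (- (3 / 4) * Re w) \<le> exp (3 / 8) * exp (- (3 / 4) * Re y)"
        unfolding exp_add[symmetric] by simp
      then have "C * exp (- (3 / 4) * Re w) \<le> C * (exp (3 / 8) * exp (- (3 / 4) * Re y))"
        using C(1) by (rule mult_left_mono)
      with C(2)[of w] w show "norm (bern w) \<le> C * exp (3 / 8) * exp (- (3 / 4) * Re y)" by simp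
    qed simp
    then show "norm (dbern y) \<le> C * exp (3 / 8) / (1 / 2) * exp (- (3 / 4) * Re y)" by (simp add: dbern_def)
  qed (use C in auto)
qed

lemma dbern_holo: "dbern holomorphic_on strip 3"
  unfolding dbern_def by (intro holomorphic_deriv bern_holo) simp

text \<open>The bound is uniform in \<open>c\<close> because the factor of \<open>desing_H\<close>, divided by \<open>1 - c\<close>, is the
  difference quotient of \<open>bern\<close> between \<open>c x\<close> and \<open>x\<close>.\<close>

definition desing_factor :: "real \<Rightarrow> complex \<Rightarrow> complex" where
  "desing_factor c x = (1 / (exp x - 1) - of_real c / (exp (of_real c * x) - 1)) / (1 - of_real c)"

lemma desing_factor_eq:
  assumes "x \<noteq> 0" "c \<noteq> 1" "c \<noteq> 0"
  shows "desing_factor c x = (bern (of_real c * x) - bern x) / (of_real c * x - x)"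
proof -
  have c: "(1 - of_real c :: complex) \<noteq> 0" using assms by simp
  then have P: "desing_factor c x * (1 - of_real c) = 1 / (exp x - 1) - of_real c / (exp (of_real c * x) - 1)"
    unfolding desing_factor_def by (rule nonzero_eq_divide_eq[THEN iffD1]) (rule refl)
  have "x * desing_factor c x * (1 - of_real c) = x * (1 / (exp x - 1) - of_real c / (exp (of_real c * x) - 1))"
    by (simp only: mult.assoc P)
  also have "\<dots> = bern x - bern (of_real c * x)"
    using assms by (simp add: bern_def right_diff_distrib mult_ac)
  finally have "x * desing_factor c x * (1 - of_real c) = bern x - bern (of_real c * x)" .
  moreover note c
  ultimately have "desing_factor c x = (bern x - bern (of_real c * x)) / (x * (1 - of_real c))"
    using assms by (simp add: eq_divide_eq mult_ac)
  also have "\<dots> = (bern (of_real c * x) - bern x) / (of_real c * x - x)"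
    by (subst minus_divide_divide[symmetric]) (simp add: algebra_simps)
  finally show ?thesis .
qed

lemma desing_factor_bound:
  obtains C where "C \<ge> 0"
    "\<And>c x. x \<in> strip 1 \<Longrightarrow> 2 / 3 \<le> c \<Longrightarrow> c \<le> 3 / 2 \<Longrightarrow> c \<noteq> 1 \<Longrightarrow> norm (desing_factor c x) \<le> C * exp (- Re x / 2)"
    "\<And>x. x \<in> strip 1 \<Longrightarrow> norm (dbern x) \<le> C * exp (- Re x / 2)"
proof -
  obtain C where C: "C \<ge> 0" "\<And>y. y \<in> strip (3 / 2) \<Longrightarrow> norm (dbern y) \<le> C * exp (- (3 / 4) * Re y)"
    using dbern_bound by metis
  have K: "norm (dbern (of_real t * x)) \<le> C * exp (9 / 8) * exp (- Re x / 2)"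
    if x: "x \<in> strip 1" and t: "2 / 3 \<le> t" "t \<le> 3 / 2" for x t
  proof -
    have tr: "t * - Re x < 3 / 2"
      using mult_strict_left_mono[of "- Re x" 1 t] x t by (simp add: strip_def)
    have "t * \<bar>Im x\<bar> < t * 1"
      by (rule mult_strict_left_mono) (use x t in \<open>auto simp: strip_def\<close>)
    also have "t * 1 \<le> 3 / 2" using t by simp
    finally have "t * \<bar>Im x\<bar> < 3 / 2" .
    with tr have tx: "of_real t * x \<in> strip (3 / 2)" using t by (auto simp: strip_def abs_mult)
    \<comment> \<open>For Re x \<ge> 0 the bound t \<ge> 2/3 keeps the rate 1/2. For Re x < 0 the
      exponential exceeds 1, but -t Re x < 3/2, whence 9/8 = (3/4)(3/2).\<close>
    have "- (3 / 4) * (t * Re x) \<le> 9 / 8 - Re x / 2"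
    proof (cases "Re x \<ge> 0")
      case True
      then have "2 / 3 * Re x \<le> t * Re x" using t by (intro mult_right_mono) auto
      then show ?thesis by simp
    next
      case False
      then show ?thesis using tr by simp
    qed
    then have "C * exp (- (3 / 4) * Re (of_real t * x)) \<le> C * (exp (9 / 8) * exp (- Re x / 2))"
      unfolding exp_add[symmetric] by (intro mult_left_mono C) simp
    with C(2)[OF tx] show ?thesis by simp
  qed
  show ?thesis
  proof (rule that[of "C * exp (9 / 8)"])
    fix c x assume x: "x \<in> strip 1" and c: "2 / 3 \<le> c" "c \<le> 3 / 2" "c \<noteq> (1::real)"
    show "norm (desing_factor c x) \<le> C * exp (9 / 8) * exp (- Re x / 2)"
    proof (cases "x = 0")
      \<comment> \<open>Both fractions divide by zero, so the factor is 0 here.\<close>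
      case True
      then show ?thesis using C by (simp add: desing_factor_def)
    next
      case False
      \<comment> \<open>The segment from x to c x consists of multiples t x with t again in
        [2/3, 3/2], so \<open>K\<close> bounds the derivative on all of it.\<close>
      have seg: "\<exists>t. 2 / 3 \<le> t \<and> t \<le> 3 / 2 \<and> w = of_real t * x" if w: "w \<in> closed_segment x (of_real c * x)" for w
      proof -
        obtain u where u: "0 \<le> u" "u \<le> 1" "w = (1 - u) *\<^sub>R x + u *\<^sub>R (of_real c * x)"
          using w by (auto simp: closed_segment_def)
        have "(2 / 3) * (1 - u) \<le> 1 - u" "1 - u \<le> (3 / 2) * (1 - u)" using u by auto
        moreover have "(2 / 3) * u \<le> c * u" "c * u \<le> (3 / 2) * u"
          by (rule mult_right_mono, use u c in simp, use u in simp)+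
        ultimately have "2 / 3 \<le> (1 - u) + u * c" "(1 - u) + u * c \<le> 3 / 2" by (auto simp: algebra_simps)
        moreover have "w = of_real ((1 - u) + u * c) * x" using u(3) by (simp add: scaleR_conv_of_real algebra_simps)
        ultimately show ?thesis by blast
      qed
      have "norm (bern (of_real c * x) - bern x) \<le> C * exp (9 / 8) * exp (- Re x / 2) * norm (of_real c * x - x)"
      proof (rule field_differentiable_bound[where S = "closed_segment x (of_real c * x)"])
        fix w assume "w \<in> closed_segment x (of_real c * x)"
        from seg[OF this] obtain t where t: "2 / 3 \<le> t" "t \<le> 3 / 2" "w = of_real t * x" by blast
        show "norm (dbern w) \<le> C * exp (9 / 8) * exp (- Re x / 2)" using K[OF x t(1,2)] t by simp
        have "w \<in> strip 3"
        proof -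
          have "t * - Re x < t * 1"
            by (rule mult_strict_left_mono) (use x t in \<open>auto simp: strip_def\<close>)
          also have "t * 1 < 3" using t by simp
          finally have 1: "t * - Re x < 3" .
          have "t * \<bar>Im x\<bar> < t * 1"
            by (rule mult_strict_left_mono) (use x t in \<open>auto simp: strip_def\<close>)
          also have "t * 1 < 3" using t by simp
          finally show ?thesis using t 1 by (auto simp: strip_def abs_mult)
        qed
        then show "(bern has_field_derivative dbern w) (at w within closed_segment x (of_real c * x))"
          unfolding dbern_def by (rule holomorphic_derivI[OF bern_holo open_strip])
      qed auto
      moreover have "of_real c * x - x \<noteq> 0" using False c by simp
      ultimately show ?thesis using False c
        by (subst desing_factor_eq) (auto simp: norm_divide divide_le_eq)
    qed
  next
    fix x assume x: "x \<in> strip 1"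
    show "norm (dbern x) \<le> C * exp (9 / 8) * exp (- Re x / 2)" using K[OF x, of 1] by simp
  qed (use C in auto)
qed

lemma decaying_dbern: "decaying {dbern}"
proof (rule decayingI)
  have "dbern holomorphic_on strip 1"
    by (rule holomorphic_on_subset[OF dbern_holo]) (auto intro: strip_mono)
  then show "f holomorphic_on strip 1" if "f \<in> {dbern}" for f using that by simp
next
  fix r :: real assume "r < 1"
  obtain C where C: "\<And>x. x \<in> strip 1 \<Longrightarrow> norm (dbern x) \<le> C * exp (- Re x / 2)"
    using desing_factor_bound by metis
  then show "\<exists>C. \<forall>f\<in>{dbern}. \<forall>x\<in>strip r. norm (f x) \<le> C * exp (- Re x / 2)"
    using strip_mono[of _ r 1] \<open>r < 1\<close> by (intro exI[of _ C]) auto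
qed

text \<open>At \<open>0\<close>, where \<open>desing_H\<close> takes a junk value, \<open>dbern0\<close> vanishes rather than being continuous; so
  it is the pointwise limit of \<open>desing_factor\<close> there as well.\<close>

definition dbern0 :: "complex \<Rightarrow> complex" where
  "dbern0 x = (exp x - 1 - x * exp x) / (exp x - 1)\<^sup>2"

lemma dbern0_0 [simp]: "dbern0 0 = 0"
  by (simp add: dbern0_def)

lemma dbern0_eq:
  assumes "x \<in> strip 3" "x \<noteq> 0" shows "dbern0 x = dbern x"
proof -
  have nz: "exp x - 1 \<noteq> 0" using exp_ne_1_strip[OF assms] by simp
  have "((\<lambda>y. y / (exp y - 1)) has_field_derivative dbern0 x) (at x)"
    using nz by (auto intro!: derivative_eq_intros simp: dbern0_def power2_eq_square)
  moreover have "\<forall>\<^sub>F y in nhds x. bern y = y / (exp y - 1)"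
    using eventually_nhds_in_open[of "- {0}" x] assms by (auto simp: bern_def elim!: eventually_mono)
  ultimately have "(bern has_field_derivative dbern0 x) (at x)"
    by (subst DERIV_cong_ev[OF refl _ refl]) auto
  then show ?thesis by (simp add: dbern_def DERIV_imp_deriv)
qed

lemma desing_factor_tendsto:
  assumes x: "x \<in> strip 1"
  shows "((\<lambda>c. desing_factor c x) \<longlongrightarrow> dbern0 x) (at 1)"
proof (cases "x = 0")
  case True
  then show ?thesis by (simp add: desing_factor_def)
next
  case False
  have x3: "x \<in> strip 3" using x by (rule strip_mono) simp
  have "(bern has_field_derivative dbern x) (at x)"
    unfolding dbern_def by (rule holomorphic_derivI[OF bern_holo open_strip x3])
  then have "((\<lambda>y. (bern y - bern x) / (y - x)) \<longlongrightarrow> dbern x) (at x)"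
    by (simp add: has_field_derivative_iff)
  moreover have "filterlim (\<lambda>c. of_real c * x) (at x) (at 1)"
    unfolding filterlim_at
  proof
    show "((\<lambda>c. of_real c * x) \<longlongrightarrow> x) (at 1)" by (auto intro!: tendsto_eq_intros)
    show "\<forall>\<^sub>F c in at 1. of_real c * x \<in> UNIV \<and> of_real c * x \<noteq> x"
      using False by (auto simp: eventually_at intro!: exI[of _ 1])
  qed
  ultimately have "((\<lambda>c. (bern (of_real c * x) - bern x) / (of_real c * x - x)) \<longlongrightarrow> dbern x) (at 1)"
    by (rule filterlim_compose)
  moreover have "\<forall>\<^sub>F c in at (1::real). (bern (of_real c * x) - bern x) / (of_real c * x - x) = desing_factor c x"
    using False by (auto simp: eventually_at desing_factor_eq intro!: exI[of _ 1] simp: dist_real_def)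
  ultimately show ?thesis
    using dbern0_eq[OF x3 False] by (simp add: Lim_transform_eventually)
qed

lemma measurable_dbern0 [measurable]: "dbern0 \<in> borel_measurable borel"
  unfolding dbern0_def by measurable

lemma measurable_desing_factor [measurable]: "desing_factor c \<in> borel_measurable borel"
  unfolding desing_factor_def by measurable

section \<open>Iterated Weyl integrals as entire functions\<close>

text \<open>One of the two exponential factors suffices for the decay; the other is at most exp (1 /
  2), since Re x > -1.\<close>

lemma decaying_mult_dbern:
  assumes "decaying A" shows "decaying ((\<lambda>f x. dbern x * f x) ` A)"
proof (rule decayingI)
  fix g assume "g \<in> (\<lambda>f x. dbern x * f x) ` A"
  then show "g holomorphic_on strip 1"
    using decaying_holo[OF assms] decaying_holo[OF decaying_dbern] by (auto intro!: holomorphic_on_mult)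
next
  fix r :: real assume r: "r < 1"
  obtain C where C: "C \<ge> 0" "\<And>f x. f \<in> A \<Longrightarrow> x \<in> strip r \<Longrightarrow> norm (f x) \<le> C * exp (- Re x / 2)"
    using decaying_bound[OF assms r] by metis
  obtain D where D: "D \<ge> 0" "\<And>f x. f \<in> {dbern} \<Longrightarrow> x \<in> strip r \<Longrightarrow> norm (f x) \<le> D * exp (- Re x / 2)"
    using decaying_bound[OF decaying_dbern r] by metis
  have "norm (dbern x * f x) \<le> D * exp (1 / 2) * C * exp (- Re x / 2)" if "f \<in> A" "x \<in> strip r" for f x
  proof -
    have "norm (dbern x) \<le> D * exp (- Re x / 2)" using D(2) that by simp
    also have "\<dots> \<le> D * exp (1 / 2)"
      by (intro mult_left_mono D) (use that r in \<open>auto simp: strip_def\<close>)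
    finally have "norm (dbern x) * norm (f x) \<le> D * exp (1 / 2) * (C * exp (- Re x / 2))"
      using C(2)[OF that] D(1) by (intro mult_mono) auto
    then show ?thesis by (simp add: norm_mult mult_ac)
  qed
  then show "\<exists>C. \<forall>f\<in>(\<lambda>f x. dbern x * f x) ` A. \<forall>x\<in>strip r. norm (f x) \<le> C * exp (- Re x / 2)"
    by (intro exI[of _ "D * exp (1 / 2) * C"]) auto
qed

text \<open>The argument \<open>x\<close> stands for the sum of the contour variables still to be
  integrated; at x = 0 none is left.\<close>

primrec zdes :: "nat \<Rightarrow> (nat \<Rightarrow> complex) \<Rightarrow> complex \<Rightarrow> complex" where
  "zdes 0 s = (\<lambda>x. 1)"
| "zdes (Suc n) s = weyl (s (Suc n)) (\<lambda>x. dbern x * zdes n s x)"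

lemma zdes_cong: "(\<And>k. k \<in> {1..n} \<Longrightarrow> s k = s' k) \<Longrightarrow> zdes n s = zdes n s'"
proof (induction n)
  case (Suc n)
  have "zdes n s = zdes n s'" by (rule Suc.IH) (use Suc.prems in auto)
  moreover have "s (Suc n) = s' (Suc n)" by (rule Suc.prems) simp
  ultimately show ?case by simp
qed simp

text \<open>The families alternate: Weyl integrals of the first form the second, and
  \<open>dbern\<close> times the second is the first for the next n. The induction runs over the
  first, since \<open>zdes 0\<close> is the constant 1, which does not decay.\<close>

lemma decaying_zdes_family:
  "decaying {\<lambda>x. dbern x * zdes n s x |s. \<forall>k\<in>{1..n}. norm (s k) \<le> M}"
  "decaying {zdes (Suc n) s |s. \<forall>k\<in>{1..Suc n}. norm (s k) \<le> M}"
proof -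
  have step: "decaying {zdes (Suc n) s |s. \<forall>k\<in>{1..Suc n}. norm (s k) \<le> M}"
    if "decaying {\<lambda>x. dbern x * zdes n s x |s. \<forall>k\<in>{1..n}. norm (s k) \<le> M}" for n
    by (rule decaying_subset[OF decaying_weyl[OF that, of M]]) fastforce
  show *: "decaying {\<lambda>x. dbern x * zdes n s x |s. \<forall>k\<in>{1..n}. norm (s k) \<le> M}"
  proof (induction n)
    case 0
    show ?case by (rule decaying_subset[OF decaying_dbern]) auto
  next
    case (Suc n)
    show ?case by (rule decaying_subset[OF decaying_mult_dbern[OF step[OF Suc]]]) auto
  qed
  show "decaying {zdes (Suc n) s |s. \<forall>k\<in>{1..Suc n}. norm (s k) \<le> M}"
    by (rule step[OF *])
qed

lemma decaying_dbern_zdes: "decaying {\<lambda>x. dbern x * zdes n s x}"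
proof -
  define M where "M = (\<Sum>k=1..n. norm (s k))"
  have "\<forall>k\<in>{1..n}. norm (s k) \<le> M"
    unfolding M_def by (auto intro: member_le_sum)
  then have "{\<lambda>x. dbern x * zdes n s x} \<subseteq> {\<lambda>x. dbern x * zdes n s x |s. \<forall>k\<in>{1..n}. norm (s k) \<le> M}"
    by blast
  then show ?thesis by (rule decaying_subset[OF decaying_zdes_family(1)])
qed

lemma holomorphic_zdes:
  assumes "k \<in> {1..n}" "x \<in> strip 1"
  shows "(\<lambda>z. zdes n (s(k := z)) x) holomorphic_on UNIV"
  using assms
proof (induction n arbitrary: x)
  case (Suc n)
  show ?case
  proof (cases "k = Suc n")
    case True
    have "zdes n (s(k := z)) = zdes n s" for z by (rule zdes_cong) (use True in auto)
    then show ?thesis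
      using holomorphic_weyl[OF decaying_dbern_zdes Suc.prems(2), of n s] True
      by (simp del: fun_upd_apply add: fun_upd_same)
  next
    case False
    then have k: "k \<in> {1..n}" using Suc.prems by auto
    \<comment> \<open>Only bounded z give a decaying family, so the claim is shown on discs, which
      then exhaust the plane.\<close>
    have "(\<lambda>z. weyl (s (Suc n)) (\<lambda>x. dbern x * zdes n (s(k := z)) x) x) holomorphic_on ball 0 R" for R
    proof (rule holomorphic_weyl_param[OF open_ball _ _ Suc.prems(2)])
      define M where "M = \<bar>R\<bar> + (\<Sum>k=1..n. norm (s k))"
      have M: "norm (s k) \<le> M" if "k \<in> {1..n}" for k
        using member_le_sum[of k "{1..n}" "\<lambda>k. norm (s k)"] that by (auto simp: M_def)
      have "\<bar>R\<bar> \<le> M" unfolding M_def by (simp add: sum_nonneg)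
      then have "\<forall>j\<in>{1..n}. norm ((s(k := z)) j) \<le> M" if "z \<in> ball 0 R" for z
        using M that by auto
      then have "(\<lambda>x. dbern x * zdes n (s(k := z)) x) \<in> {\<lambda>x. dbern x * zdes n s x |s. \<forall>k\<in>{1..n}. norm (s k) \<le> M}"
        if "z \<in> ball 0 R" for z
        using that by (intro CollectI exI[of _ "s(k := z)"] conjI refl) blast
      then have "(\<lambda>z x. dbern x * zdes n (s(k := z)) x) ` ball 0 R
          \<subseteq> {\<lambda>x. dbern x * zdes n s x |s. \<forall>k\<in>{1..n}. norm (s k) \<le> M}"
        by (intro image_subsetI)
      then show "decaying ((\<lambda>z x. dbern x * zdes n (s(k := z)) x) ` ball 0 R)"
        by (rule decaying_subset[OF decaying_zdes_family(1)])
      show "(\<lambda>z. dbern y * zdes n (s(k := z)) y) holomorphic_on ball 0 R" if "y \<in> strip 1" for y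
        by (intro holomorphic_intros holomorphic_on_subset[OF Suc.IH[OF k that]]) auto
    qed
    then have "(\<lambda>z. weyl (s (Suc n)) (\<lambda>x. dbern x * zdes n (s(k := z)) x) x) holomorphic_on (\<Union>R. ball 0 R)"
      by (intro holomorphic_on_UN_open) auto
    moreover have "z \<in> (\<Union>R. ball 0 R)" for z :: complex
      by (rule UN_I[of "norm z + 1"]) auto
    then have "(\<Union>R. ball 0 R) = (UNIV :: complex set)" by blast
    ultimately show ?thesis using False by (simp del: fun_upd_apply add: fun_upd_other)
  qed
qed auto

lemma zdes_bounded:
  obtains C where "\<And>s. (\<And>k. k \<in> {1..n} \<Longrightarrow> norm (s k) \<le> M) \<Longrightarrow> norm (zdes n s 0) \<le> C"
proof (cases n)
  case 0
  show ?thesis by (rule that[of 1]) (simp add: 0)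
next
  case (Suc m)
  obtain C where C: "\<And>f x. f \<in> {zdes (Suc m) s |s. \<forall>k\<in>{1..Suc m}. norm (s k) \<le> M} \<Longrightarrow> x \<in> strip (1 / 2) \<Longrightarrow> norm (f x) \<le> C * exp (- Re x / 2)"
    by (rule decaying_bound[OF decaying_zdes_family(2)[of m M], of "1 / 2"]) auto
  show ?thesis
  proof (rule that[of C])
    fix s :: "nat \<Rightarrow> complex" assume "\<And>k. k \<in> {1..n} \<Longrightarrow> norm (s k) \<le> M"
    then have "zdes (Suc m) s \<in> {zdes (Suc m) s |s. \<forall>k\<in>{1..Suc m}. norm (s k) \<le> M}"
      using Suc by blast
    from C[OF this, of 0] show "norm (zdes n s 0) \<le> C" using Suc by (simp add: strip_def)
  qed
qed

text \<open>Osgood's lemma: for a locally bounded, separately holomorphic function, Cauchy's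
  estimate in each variable gives a Lipschitz bound, the coordinates being changed one at a
  time.\<close>

lemma continuous_on_separately_holomorphic:
  fixes F :: "(nat \<Rightarrow> complex) \<Rightarrow> complex"
  assumes cong: "\<And>s s'. (\<And>k. k \<in> {1..n} \<Longrightarrow> s k = s' k) \<Longrightarrow> F s = F s'"
    and hol: "\<And>s k. k \<in> {1..n} \<Longrightarrow> (\<lambda>z. F (s(k := z))) holomorphic_on UNIV"
    and bnd: "\<And>M. \<exists>C. \<forall>s. (\<forall>k\<in>{1..n}. norm (s k) \<le> M) \<longrightarrow> norm (F s) \<le> C"
  shows "continuous_on UNIV F"
  unfolding continuous_on_def
proof
  fix s0 :: "nat \<Rightarrow> complex"
  define M where "M = (\<Sum>k=1..n. norm (s0 k)) + 1"
  have M0: "norm (s0 k) \<le> M - 1" if "k \<in> {1..n}" for k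
    using member_le_sum[of k "{1..n}" "\<lambda>k. norm (s0 k)"] that by (auto simp: M_def)
  \<comment> \<open>The extra 1 is for Cauchy discs of radius 1 about points of norm at most M.
    Below, \<open>h s m\<close> is the intermediate point with the first m coordinates already moved
    from s0 to s.\<close>
  obtain C where C: "\<And>s. (\<forall>k\<in>{1..n}. norm (s k) \<le> M + 1) \<Longrightarrow> norm (F s) \<le> C"
    using bnd[of "M + 1"] by blast
  define h where "h s m = (\<lambda>k. if k \<le> m then s k else s0 k)" for s m
  have L: "norm (F (h s m) - F s0) \<le> C * (\<Sum>k=1..m. norm (s k - s0 k))"
    if s: "\<And>k. k \<in> {1..n} \<Longrightarrow> norm (s k) \<le> M" and "m \<le> n" for s m
    using that(2)
  proof (induction m)
    case 0
    have "F (h s 0) = F s0" by (rule cong) (auto simp: h_def)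
    then show ?case by simp
  next
    case (Suc m)
    let ?g = "\<lambda>z. F ((h s m)(Suc m := z))"
    have k: "Suc m \<in> {1..n}" using Suc.prems by auto
    have g: "norm (?g z) \<le> C" if "norm z \<le> M + 1" for z
      by (rule C) (use that s M0 in \<open>force simp: h_def\<close>)
    have "norm (?g (s (Suc m)) - ?g (s0 (Suc m))) \<le> C * norm (s (Suc m) - s0 (Suc m))"
    proof (rule field_differentiable_bound[where S = "cball 0 M"])
      fix z :: complex assume z: "z \<in> cball 0 M"
      show "(?g has_field_derivative deriv ?g z) (at z within cball 0 M)"
        by (rule holomorphic_derivI[OF hol[OF k] open_UNIV UNIV_I])
      have "norm (deriv ?g z) \<le> C / 1"
      proof (rule deriv_bound_cball[OF hol[OF k]])
        fix w assume w: "w \<in> cball z 1"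
        have "norm w \<le> norm z + norm (w - z)" using norm_triangle_ineq[of z "w - z"] by simp
        then show "norm (?g w) \<le> C" using w z by (intro g) (auto simp: dist_norm norm_minus_commute)
      qed auto
      then show "norm (deriv ?g z) \<le> C" by simp
    qed (use s[OF k] M0[OF k] in auto)
    moreover have "?g (s (Suc m)) = F (h s (Suc m))" by (rule cong) (auto simp: h_def)
    moreover have "?g (s0 (Suc m)) = F (h s m)" by (rule cong) (auto simp: h_def)
    moreover have "norm (F (h s m) - F s0) \<le> C * (\<Sum>k=1..m. norm (s k - s0 k))"
      using Suc by simp
    moreover have "norm (F (h s (Suc m)) - F s0) \<le> norm (F (h s (Suc m)) - F (h s m)) + norm (F (h s m) - F s0)"
      using norm_triangle_ineq[of "F (h s (Suc m)) - F (h s m)" "F (h s m) - F s0"] by simp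
    ultimately show ?case by (simp add: ring_distribs)
  qed
  have lim: "((\<lambda>s. norm (s k - s0 k)) \<longlongrightarrow> 0) (at s0)" for k
  proof -
    have "continuous_on UNIV (\<lambda>s::nat \<Rightarrow> complex. s k)" by (rule continuous_on_product_coordinates)
    then have "((\<lambda>s. s k) \<longlongrightarrow> s0 k) (at s0)" by (simp add: continuous_on_def)
    then show ?thesis by (intro tendsto_norm_zero) (simp add: LIM_zero_iff)
  qed
  have "\<forall>\<^sub>F s in at s0. norm (s k - s0 k) < 1" for k
    using order_tendstoD(2)[OF lim] by simp
  then have "\<forall>\<^sub>F s in at s0. \<forall>k\<in>{1..n}. norm (s k - s0 k) < 1"
    by (intro eventually_ball_finite) auto
  then have ev: "\<forall>\<^sub>F s in at s0. norm (F s - F s0) \<le> C * (\<Sum>k=1..n. norm (s k - s0 k))"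
  proof eventually_elim
    case (elim s)
    have "norm (s k) \<le> M" if "k \<in> {1..n}" for k
      using M0[OF that] elim that norm_triangle_ineq[of "s k - s0 k" "s0 k"] by fastforce
    from L[OF this order_refl] have "norm (F (h s n) - F s0) \<le> C * (\<Sum>k=1..n. norm (s k - s0 k))" by simp
    moreover have "F (h s n) = F s" by (rule cong) (auto simp: h_def)
    ultimately show ?case by simp
  qed
  have "((\<lambda>s. C * (\<Sum>k=1..n. norm (s k - s0 k))) \<longlongrightarrow> C * (\<Sum>k=1..n. 0)) (at s0)"
    by (intro tendsto_intros lim)
  then have "((\<lambda>s. C * (\<Sum>k=1..n. norm (s k - s0 k))) \<longlongrightarrow> 0) (at s0)" by simp
  from Lim_null_comparison[OF ev this] show "(F \<longlongrightarrow> F s0) (at s0 within UNIV)"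
    by (simp add: LIM_zero_iff)
qed

lemma zero_in_strip [simp]: "0 < r \<Longrightarrow> 0 \<in> strip r"
  by (simp add: strip_def)

lemma entire_zdes: "entire_Cn n (\<lambda>s. zdes n s 0)"
  unfolding entire_Cn_def
proof (intro conjI allI ballI impI)
  show "zdes n s 0 = zdes n s' 0" if "\<forall>k\<in>{1..n}. s k = s' k" for s s'
    using zdes_cong[of n s s'] that by simp
  show hol: "(\<lambda>z. zdes n (s(k := z)) 0) holomorphic_on UNIV" if "k \<in> {1..n}" for s k
    by (rule holomorphic_zdes[OF that]) simp
  show "continuous_on UNIV (\<lambda>s. zdes n s 0)"
  proof (rule continuous_on_separately_holomorphic[OF _ hol])
    show "zdes n s 0 = zdes n s' 0" if "\<And>k. k \<in> {1..n} \<Longrightarrow> s k = s' k" for s s'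
      using zdes_cong[of n s s'] that by simp
    show "\<exists>C. \<forall>s. (\<forall>k\<in>{1..n}. norm (s k) \<le> M) \<longrightarrow> norm (zdes n s 0) \<le> C" for M
      using zdes_bounded[of n M] by metis
  qed
qed

section \<open>The multiple Hankel integral\<close>

text \<open>For \<phi> = \<open>desing_factor c\<close> and x = 0 this is the integrand of
  \<open>hankel_integral\<close> divided by (1 - c)^n. The offset \<open>x\<close> serves the
  induction on n: fixing the last variable moves it by one contour point.\<close>

definition hankel_product :: "real \<Rightarrow> (nat \<Rightarrow> complex) \<Rightarrow> (complex \<Rightarrow> complex) \<Rightarrow> nat \<Rightarrow> complex \<Rightarrow> (nat \<Rightarrow> real) \<Rightarrow> complex" where
  "hankel_product \<epsilon> s \<phi> n x u = (\<Prod>j=1..n. \<phi> (x + (\<Sum>k=j..n. hankel \<epsilon> (u k)))) * (\<Prod>k=1..n. hankel_weight \<epsilon> (s k) (u k))"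

lemma hankel_product_Suc:
  "hankel_product \<epsilon> s \<phi> (Suc n) x u = \<phi> (x + hankel \<epsilon> (u (Suc n))) * hankel_weight \<epsilon> (s (Suc n)) (u (Suc n))
     * hankel_product \<epsilon> s \<phi> n (x + hankel \<epsilon> (u (Suc n))) u"
proof -
  have "(\<Prod>j=1..Suc n. \<phi> (x + (\<Sum>k=j..Suc n. hankel \<epsilon> (u k))))
      = (\<Prod>j=1..n. \<phi> (x + (\<Sum>k=j..Suc n. hankel \<epsilon> (u k)))) * \<phi> (x + hankel \<epsilon> (u (Suc n)))"
    by simp
  also have "(\<Prod>j=1..n. \<phi> (x + (\<Sum>k=j..Suc n. hankel \<epsilon> (u k))))
      = (\<Prod>j=1..n. \<phi> (x + hankel \<epsilon> (u (Suc n)) + (\<Sum>k=j..n. hankel \<epsilon> (u k))))"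
    by (intro prod.cong refl) (simp add: add_ac)
  finally have A: "(\<Prod>j=1..Suc n. \<phi> (x + (\<Sum>k=j..Suc n. hankel \<epsilon> (u k))))
      = (\<Prod>j=1..n. \<phi> (x + hankel \<epsilon> (u (Suc n)) + (\<Sum>k=j..n. hankel \<epsilon> (u k)))) * \<phi> (x + hankel \<epsilon> (u (Suc n)))" .
  have B: "(\<Prod>k=1..Suc n. hankel_weight \<epsilon> (s k) (u k)) = (\<Prod>k=1..n. hankel_weight \<epsilon> (s k) (u k)) * hankel_weight \<epsilon> (s (Suc n)) (u (Suc n))"
    by simp
  show ?thesis unfolding hankel_product_def A B by (simp only: mult_ac)
qed

lemma hankel_product_cong:
  assumes "\<And>k. k \<in> {1..n} \<Longrightarrow> u k = v k"
  shows "hankel_product \<epsilon> s \<phi> n x u = hankel_product \<epsilon> s \<phi> n x v"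
proof -
  have "(\<Sum>k=j..n. hankel \<epsilon> (u k)) = (\<Sum>k=j..n. hankel \<epsilon> (v k))" if "j \<ge> 1" for j
    by (intro sum.cong) (use assms that in auto)
  then show ?thesis
    unfolding hankel_product_def by (intro arg_cong2[of _ _ _ _ "(*)"] prod.cong refl) (use assms in auto)
qed

lemma strip_add_hankel:
  assumes "x \<in> strip r" "\<epsilon> > 0" shows "x + hankel \<epsilon> u \<in> strip (r + \<epsilon>)"
proof -
  have x: "x \<in> strip (r + \<epsilon>)" by (rule strip_mono[OF assms(1)]) (use assms in simp)
  consider "u < 0" | "0 \<le> u" "u \<le> 2 * pi" | "u > 2 * pi" by linarith
  then show ?thesis
  proof cases
    case 1
    have "x + of_real (\<epsilon> - u) \<in> strip (r + \<epsilon>)"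
      by (rule strip_shift[OF x]) (use 1 assms in auto)
    then show ?thesis using 1 by (simp add: hankel_neg)
  next
    case 2
    then show ?thesis using assms by (auto simp: hankel_circle norm_mult intro!: strip_add)
  next
    case 3
    have "x + of_real (\<epsilon> - 2 * pi + u) \<in> strip (r + \<epsilon>)"
      by (rule strip_shift[OF x]) (use 3 assms in auto)
    then show ?thesis using 3 by (simp add: hankel_pos)
  qed
qed

text \<open>t_k occurs in the k factors j = 1, ..., k, and each of them decays like exp(-Re t_k /
  2); hence the multiple k in the exponent.\<close>

definition hankel_majorant :: "real \<Rightarrow> (nat \<Rightarrow> complex) \<Rightarrow> nat \<Rightarrow> real \<Rightarrow> real" where
  "hankel_majorant \<epsilon> s k u = norm (hankel_weight \<epsilon> (s k) u) * exp (- real k * Re (hankel \<epsilon> u) / 2)"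

text \<open>The exponential bounds turn sums of contour points into products, so the variables
  separate. Each point widens the strip by at most \<epsilon>, and r + n \<epsilon> \<le> 1 keeps
  all partial sums where \<phi> is bounded.\<close>

lemma hankel_product_bound:
  assumes \<phi>: "\<And>y. y \<in> strip 1 \<Longrightarrow> norm (\<phi> y) \<le> C * exp (- Re y / 2)" and C: "C \<ge> 0" and e: "\<epsilon> > 0"
    and x: "x \<in> strip r" "r + real n * \<epsilon> \<le> 1"
  shows "norm (hankel_product \<epsilon> s \<phi> n x u) \<le> (C * exp (- Re x / 2)) ^ n * (\<Prod>k=1..n. hankel_majorant \<epsilon> s k (u k))"
  using x
proof (induction n arbitrary: x r)
  case 0
  then show ?case by (simp add: hankel_product_def)
next
  case (Suc n)
  define v where "v = hankel \<epsilon> (u (Suc n))"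
  have y: "x + v \<in> strip (r + \<epsilon>)" unfolding v_def by (rule strip_add_hankel[OF Suc.prems(1) e])
  have r: "r + \<epsilon> + real n * \<epsilon> \<le> 1" using Suc.prems(2) by (simp add: algebra_simps)
  have "r + \<epsilon> \<le> 1" using r e by (meson add_increasing2 le_add_same_cancel1 mult_nonneg_nonneg of_nat_0_le_iff less_imp_le order_trans)
  then have y1: "x + v \<in> strip 1" using y strip_mono by blast
  have ex: "C * exp (- Re (x + v) / 2) = C * exp (- Re x / 2) * exp (- Re v / 2)"
    by (simp add: exp_add[symmetric] diff_divide_distrib mult.assoc)
  have "norm (hankel_product \<epsilon> s \<phi> (Suc n) x u)
      = norm (\<phi> (x + v)) * norm (hankel_weight \<epsilon> (s (Suc n)) (u (Suc n))) * norm (hankel_product \<epsilon> s \<phi> n (x + v) u)"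
    by (simp add: hankel_product_Suc norm_mult v_def)
  also have "\<dots> \<le> (C * exp (- Re (x + v) / 2)) * norm (hankel_weight \<epsilon> (s (Suc n)) (u (Suc n))) *
       ((C * exp (- Re (x + v) / 2)) ^ n * (\<Prod>k=1..n. hankel_majorant \<epsilon> s k (u k)))"
    by (intro mult_mono \<phi>[OF y1] Suc.IH[OF y r] order_refl mult_nonneg_nonneg norm_ge_zero C) auto
  also have "\<dots> = (C * exp (- Re x / 2)) ^ Suc n * (\<Prod>k=1..n. hankel_majorant \<epsilon> s k (u k)) *
       (norm (hankel_weight \<epsilon> (s (Suc n)) (u (Suc n))) * exp (- Re v / 2) ^ Suc n)"
    unfolding ex by (simp add: power_mult_distrib mult_ac)
  also have "exp (- Re v / 2) ^ Suc n = exp (- real (Suc n) * Re (hankel \<epsilon> (u (Suc n))) / 2)"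
    unfolding exp_of_nat_mult[symmetric] v_def by (simp add: algebra_simps)
  also have "norm (hankel_weight \<epsilon> (s (Suc n)) (u (Suc n))) * exp (- real (Suc n) * Re (hankel \<epsilon> (u (Suc n))) / 2) = hankel_majorant \<epsilon> s (Suc n) (u (Suc n))"
    by (simp only: hankel_majorant_def)
  finally show ?case by (simp add: mult_ac)
qed

lemma integrable_hankel_majorant:
  assumes e: "0 < \<epsilon>" "\<epsilon> < 1" and k: "k \<ge> 1"
  shows "integrable lborel (hankel_majorant \<epsilon> s k)"
proof -
  \<comment> \<open>Chosen so that the norm of its contour integrand is exactly the majorant; k
    \<ge> 1 gives at least the rate 1/2.\<close>
  define f where "f = (\<lambda>x::complex. exp (- of_nat k * x / 2))"
  have "decaying {f}"
  proof (rule decayingI)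
    fix r :: real assume r: "r < 1"
    have "norm (f x) \<le> exp (real k / 2) * exp (- Re x / 2)" if x: "x \<in> strip r" for x
    proof -
      have "(real k - 1) * (- Re x) \<le> (real k - 1) * 1" using x r k by (intro mult_left_mono) (auto simp: strip_def)
      then have "- (real k * Re x / 2) \<le> real k / 2 - Re x / 2" by (simp add: algebra_simps)
      then show ?thesis unfolding exp_add[symmetric] by (simp add: f_def norm_exp_eq_Re)
    qed
    then show "\<exists>C. \<forall>f\<in>{f}. \<forall>x\<in>strip r. norm (f x) \<le> C * exp (- Re x / 2)" by blast
  qed (auto simp: f_def intro!: holomorphic_intros)
  moreover have "cball 0 \<epsilon> \<subseteq> strip 1"
  proof
    fix w assume "w \<in> cball (0::complex) \<epsilon>"
    then have "0 + w \<in> strip (0 + \<epsilon> + (1 - \<epsilon>) / 2 )"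
      using strip_add[of 0 "(1 - \<epsilon>) / 2" w \<epsilon>] e by (simp add: add.commute)
    then show "w \<in> strip 1" using e by (auto elim!: strip_mono[of w] simp: field_simps)
  qed
  ultimately have "integrable lborel (\<lambda>u. f (0 + hankel \<epsilon> u) * hankel_weight \<epsilon> (s k) u)"
    using has_integral_hankel[of f 0 \<epsilon> "s k"] e by (simp add: has_bochner_integral_iff)
  then have "integrable lborel (\<lambda>u. norm (f (0 + hankel \<epsilon> u) * hankel_weight \<epsilon> (s k) u))"
    by (rule integrable_norm)
  also have "(\<lambda>u. norm (f (0 + hankel \<epsilon> u) * hankel_weight \<epsilon> (s k) u)) = hankel_majorant \<epsilon> s k"
    by (auto simp: fun_eq_iff f_def norm_mult norm_exp_eq_Re hankel_majorant_def)
  finally show ?thesis .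
qed

lemma measurable_hankel_product:
  assumes [measurable]: "\<phi> \<in> borel_measurable borel"
  shows "hankel_product \<epsilon> s \<phi> n x \<in> borel_measurable (\<Pi>\<^sub>M k\<in>{1..n}. lborel)"
proof -
  have c: "(\<lambda>u. u k :: real) \<in> measurable (\<Pi>\<^sub>M k\<in>{1..n}. lborel) borel" if "k \<in> {1..n}" for k
    using measurable_component_singleton[OF that, of "\<lambda>_. lborel :: real measure"] by simp
  have 1: "(\<lambda>u. hankel \<epsilon> (u k)) \<in> borel_measurable (\<Pi>\<^sub>M k\<in>{1..n}. lborel)" if "k \<in> {1..n}" for k
    using measurable_compose[OF c[OF that] measurable_hankel] .
  have 2: "(\<lambda>u. hankel_weight \<epsilon> (s k) (u k)) \<in> borel_measurable (\<Pi>\<^sub>M k\<in>{1..n}. lborel)" if "k \<in> {1..n}" for k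
    using measurable_compose[OF c[OF that] measurable_hankel_weight] .
  have "(\<lambda>u. x + (\<Sum>k=j..n. hankel \<epsilon> (u k))) \<in> borel_measurable (\<Pi>\<^sub>M k\<in>{1..n}. lborel)" if "j \<in> {1..n}" for j
    by (intro borel_measurable_add borel_measurable_const borel_measurable_sum 1) (use that in auto)
  from measurable_compose[OF this assms] show ?thesis
    unfolding hankel_product_def[abs_def] by (intro borel_measurable_times borel_measurable_prod 2) auto
qed

interpretation lborel_product: product_sigma_finite "\<lambda>_::nat. lborel :: real measure"
  by standard

lemma integrable_hankel_majorant_prod:
  assumes "0 < \<epsilon>" "\<epsilon> < 1"
  shows "integrable (\<Pi>\<^sub>M k\<in>{1..n}. lborel) (\<lambda>u. \<Prod>k=1..n. hankel_majorant \<epsilon> s k (u k))"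
  by (rule lborel_product.product_integrable_prod) (use integrable_hankel_majorant[OF assms] in auto)

lemma integrable_hankel_product:
  assumes [measurable]: "\<phi> \<in> borel_measurable borel"
    and \<phi>: "\<And>y. y \<in> strip 1 \<Longrightarrow> norm (\<phi> y) \<le> C * exp (- Re y / 2)" and C: "C \<ge> 0" and e: "0 < \<epsilon>" "\<epsilon> < 1"
    and x: "x \<in> strip r" "r + real n * \<epsilon> \<le> 1"
  shows "integrable (\<Pi>\<^sub>M k\<in>{1..n}. lborel) (hankel_product \<epsilon> s \<phi> n x)"
proof (rule Bochner_Integration.integrable_bound)
  show "integrable (\<Pi>\<^sub>M k\<in>{1..n}. lborel) (\<lambda>u. (C * exp (- Re x / 2)) ^ n * (\<Prod>k=1..n. hankel_majorant \<epsilon> s k (u k)))"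
    by (intro integrable_mult_right integrable_hankel_majorant_prod e)
  show "AE u in \<Pi>\<^sub>M k\<in>{1..n}. lborel. norm (hankel_product \<epsilon> s \<phi> n x u) \<le> norm ((C * exp (- Re x / 2)) ^ n * (\<Prod>k=1..n. hankel_majorant \<epsilon> s k (u k)))"
  proof (rule AE_I2)
    fix u
    have "norm (hankel_product \<epsilon> s \<phi> n x u) \<le> (C * exp (- Re x / 2)) ^ n * (\<Prod>k=1..n. hankel_majorant \<epsilon> s k (u k))"
      by (rule hankel_product_bound[OF \<phi> C e(1) x])
    then show "norm (hankel_product \<epsilon> s \<phi> n x u) \<le> norm ((C * exp (- Re x / 2)) ^ n * (\<Prod>k=1..n. hankel_majorant \<epsilon> s k (u k)))"
      by simp
  qed
qed (rule measurable_hankel_product[OF assms(1)])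

lemma dbern0_bound:
  obtains C where "C \<ge> 0" "\<And>x. x \<in> strip 1 \<Longrightarrow> norm (dbern0 x) \<le> C * exp (- Re x / 2)"
proof -
  obtain C where C: "C \<ge> 0" "\<And>x. x \<in> strip 1 \<Longrightarrow> norm (dbern x) \<le> C * exp (- Re x / 2)"
    using desing_factor_bound by metis
  have "norm (dbern0 x) \<le> C * exp (- Re x / 2)" if "x \<in> strip 1" for x
    using C(2)[OF that] C(1) dbern0_eq[of x] strip_mono[OF that, of 3] by (cases "x = 0") auto
  with C(1) show ?thesis by (rule that)
qed

definition prefactor :: "complex \<Rightarrow> complex" where
  "prefactor z = 1 / (monodromy z * Gamma z)"

text \<open>Fubini with the last variable outermost. Measurability of the outer integrand is a
  hypothesis because it is best obtained from the closed form of the inner integral.\<close>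

lemma hankel_product_integral_Suc:
  assumes int: "integrable (\<Pi>\<^sub>M k\<in>{1..Suc n}. lborel) (hankel_product \<epsilon> s \<phi> (Suc n) x)"
    and meas: "(\<lambda>v. \<phi> (x + hankel \<epsilon> v) * hankel_weight \<epsilon> (s (Suc n)) v *
        (\<integral>u. hankel_product \<epsilon> s \<phi> n (x + hankel \<epsilon> v) u \<partial>(\<Pi>\<^sub>M k\<in>{1..n}. lborel))) \<in> borel_measurable borel"
  shows "(\<integral>u. hankel_product \<epsilon> s \<phi> (Suc n) x u \<partial>(\<Pi>\<^sub>M k\<in>{1..Suc n}. lborel))
    = (\<integral>v. \<phi> (x + hankel \<epsilon> v) * hankel_weight \<epsilon> (s (Suc n)) v *
        (\<integral>u. hankel_product \<epsilon> s \<phi> n (x + hankel \<epsilon> v) u \<partial>(\<Pi>\<^sub>M k\<in>{1..n}. lborel)) \<partial>lborel)"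
proof -
  let ?f = "hankel_product \<epsilon> s \<phi> (Suc n) x"
  have S: "{1..Suc n} = {Suc n} \<union> {1..n}" by auto
  have "(\<integral>u. ?f u \<partial>(\<Pi>\<^sub>M k\<in>{1..Suc n}. lborel))
     = (\<integral>a. (\<integral>b. ?f (merge {Suc n} {1..n} (a, b)) \<partial>(\<Pi>\<^sub>M k\<in>{1..n}. lborel)) \<partial>(\<Pi>\<^sub>M k\<in>{Suc n}. lborel))"
    unfolding S by (rule lborel_product.product_integral_fold) (use int S in auto)
  also have "\<dots> = (\<integral>a. \<phi> (x + hankel \<epsilon> (a (Suc n))) * hankel_weight \<epsilon> (s (Suc n)) (a (Suc n)) *
        (\<integral>u. hankel_product \<epsilon> s \<phi> n (x + hankel \<epsilon> (a (Suc n))) u \<partial>(\<Pi>\<^sub>M k\<in>{1..n}. lborel)) \<partial>(\<Pi>\<^sub>M k\<in>{Suc n}. lborel))"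
  proof (rule Bochner_Integration.integral_cong[OF refl])
    fix a :: "nat \<Rightarrow> real"
    have "?f (merge {Suc n} {1..n} (a, b)) = \<phi> (x + hankel \<epsilon> (a (Suc n))) * hankel_weight \<epsilon> (s (Suc n)) (a (Suc n)) *
       hankel_product \<epsilon> s \<phi> n (x + hankel \<epsilon> (a (Suc n))) b" for b
    proof -
      have "hankel_product \<epsilon> s \<phi> n y (merge {Suc n} {1..n} (a, b)) = hankel_product \<epsilon> s \<phi> n y b" for y
        by (rule hankel_product_cong) (auto simp: merge_def)
      moreover have "merge {Suc n} {1..n} (a, b) (Suc n) = a (Suc n)" by (simp add: merge_def)
      ultimately show ?thesis unfolding hankel_product_Suc by simp
    qed
    then show "(\<integral>b. ?f (merge {Suc n} {1..n} (a, b)) \<partial>(\<Pi>\<^sub>M k\<in>{1..n}. lborel))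
      = \<phi> (x + hankel \<epsilon> (a (Suc n))) * hankel_weight \<epsilon> (s (Suc n)) (a (Suc n)) *
        (\<integral>u. hankel_product \<epsilon> s \<phi> n (x + hankel \<epsilon> (a (Suc n))) u \<partial>(\<Pi>\<^sub>M k\<in>{1..n}. lborel))"
      by simp
  qed
  also have "\<dots> = (\<integral>v. \<phi> (x + hankel \<epsilon> v) * hankel_weight \<epsilon> (s (Suc n)) v *
        (\<integral>u. hankel_product \<epsilon> s \<phi> n (x + hankel \<epsilon> v) u \<partial>(\<Pi>\<^sub>M k\<in>{1..n}. lborel)) \<partial>lborel)"
    by (rule lborel_product.product_integral_singleton) (use meas in simp)
  finally show ?thesis .
qed

text \<open>The term (n + 3) \<epsilon> allows \<epsilon> for each contour variable and the 3
  \<epsilon> demanded by \<open>hankel_value_weyl\<close>. In the induction \<open>x\<close> moves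
  by one contour point, so the width grows by \<epsilon> while the number of variables drops by one:
  the total is preserved.\<close>

lemma hankel_product_integral_dbern0:
  assumes s: "\<And>k. k \<in> {1..n} \<Longrightarrow> s k \<notin> \<int>" and e: "0 < \<epsilon>"
    and x: "x \<in> strip r" "r + (real n + 3) * \<epsilon> < 1" 
  shows "(\<Prod>k=1..n. prefactor (s k)) * (\<integral>u. hankel_product \<epsilon> s dbern0 n x u \<partial>(\<Pi>\<^sub>M k\<in>{1..n}. lborel)) = zdes n s x"
  using s x
proof (induction n arbitrary: x r)
  case 0
  then show ?case by (simp add: hankel_product_def PiM_empty lebesgue_integral_count_space_finite)
next
  case (Suc n)
  let ?I = "\<lambda>x. \<integral>u. hankel_product \<epsilon> s dbern0 n x u \<partial>(\<Pi>\<^sub>M k\<in>{1..n}. lborel)"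
  let ?P = "\<Prod>k=1..n. prefactor (s k)"
  define f where "f = (\<lambda>x. dbern x * zdes n s x)"
  have f: "decaying {f}" unfolding f_def by (rule decaying_dbern_zdes)
  have r0: "r > 0" using Suc.prems(2) by (auto simp: strip_def)
  have re: "r + real n * \<epsilon> + 4 * \<epsilon> < 1" using Suc.prems(3) by (simp add: algebra_simps)
  have ne: "real n * \<epsilon> \<ge> 0" using e by simp
  have IH: "?P * ?I (x + hankel \<epsilon> v) = zdes n s (x + hankel \<epsilon> v)" for v
    by (rule Suc.IH[OF _ strip_add_hankel[OF Suc.prems(2) e]]) (use Suc.prems re in \<open>auto simp: algebra_simps\<close>)
  have e1: "\<epsilon> < 1" using re ne e r0 by linarith
  have e2: "r + real (Suc n) * \<epsilon> \<le> 1" using re e by (simp add: ring_distribs)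
  have x1: "x \<in> strip 1" by (rule strip_mono[OF Suc.prems(2)]) (use re ne e in linarith)
  have sub3: "cball x (3 * \<epsilon>) \<subseteq> strip (r + 3 * \<epsilon>)"
  proof
    fix w assume "w \<in> cball x (3 * \<epsilon>)"
    then show "w \<in> strip (r + 3 * \<epsilon>)"
      using strip_add[OF Suc.prems(2), of "w - x" "3 * \<epsilon>"] by (simp add: dist_norm norm_minus_commute)
  qed
  have r3: "r + 3 * \<epsilon> < 1" using re ne e by linarith
  have "cball x \<epsilon> \<subseteq> cball x (3 * \<epsilon>)" using e by auto
  then have sub1: "cball x \<epsilon> \<subseteq> strip 1"
    using sub3 strip_mono[of _ "r + 3 * \<epsilon>" 1] r3 by (meson less_imp_le subset_iff)
  have hb: "has_bochner_integral lborel (\<lambda>v. f (x + hankel \<epsilon> v) * hankel_weight \<epsilon> (s (Suc n)) v) (hankel_value \<epsilon> (s (Suc n)) f x)"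
    by (rule has_integral_hankel[OF f x1 sub1 e])
  define Q where "Q = (\<lambda>v. dbern0 (x + hankel \<epsilon> v) * hankel_weight \<epsilon> (s (Suc n)) v * ?I (x + hankel \<epsilon> v))"
  have eq: "f (x + hankel \<epsilon> v) * hankel_weight \<epsilon> (s (Suc n)) v = ?P * Q v" if "v \<notin> {v. hankel \<epsilon> v = - x}" for v
  proof -
    have "x + hankel \<epsilon> v \<noteq> 0" using that by (auto simp: add_eq_0_iff2 add.commute)
    moreover have "x + hankel \<epsilon> v \<in> strip 3"
      by (rule strip_mono[OF strip_add_hankel[OF Suc.prems(2) e]]) (use re ne e in linarith)
    ultimately have d0: "dbern0 (x + hankel \<epsilon> v) = dbern (x + hankel \<epsilon> v)" by (intro dbern0_eq)
    have "f (x + hankel \<epsilon> v) * hankel_weight \<epsilon> (s (Suc n)) v = dbern0 (x + hankel \<epsilon> v) * hankel_weight \<epsilon> (s (Suc n)) v * (?P * ?I (x + hankel \<epsilon> v))"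
      by (simp only: f_def IH d0) (simp only: mult_ac)
    then show ?thesis by (simp add: Q_def mult_ac)
  qed
  \<comment> \<open>\<open>dbern\<close> and \<open>dbern0\<close> are exchanged off a countable set
    of parameters.\<close>
  have hQ: "has_bochner_integral lborel (\<lambda>v. ?P * Q v) (hankel_value \<epsilon> (s (Suc n)) f x)"
    by (subst has_bochner_integral_discrete_difference[where X = "{v. hankel \<epsilon> v = - x}", symmetric, OF _ _ _ eq])
      (use hb countable_hankel_vimage[OF e] in auto)
  have "prefactor (s k) \<noteq> 0" if "k \<in> {1..n}" for k
  proof -
    have "s k \<notin> \<int>" using Suc.prems(1) that by simp
    then show ?thesis
      using monodromy_nonzero nonpos_Ints_subset_Ints by (auto simp: prefactor_def Gamma_eq_zero_iff)
  qed
  \<comment> \<open>Dividing by this nonzero constant recovers measurability of \<open>Q\<close>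
    from integrability of its multiple.\<close>
  then have P0: "?P \<noteq> 0" by (simp add: prod_zero_iff)
  have "Q \<in> borel_measurable lborel"
  proof -
    have "(\<lambda>v. inverse ?P * (?P * Q v)) \<in> borel_measurable lborel"
      using hQ by (intro borel_measurable_times borel_measurable_const borel_measurable_integrable) (auto simp: has_bochner_integral_iff)
    moreover have "(\<lambda>v. inverse ?P * (?P * Q v)) = Q" using P0 by (simp add: mult.assoc[symmetric])
    ultimately show ?thesis by (simp only:)
  qed
  then have mQ: "Q \<in> borel_measurable borel" by simp
  obtain C where C: "C \<ge> 0" "\<And>x. x \<in> strip 1 \<Longrightarrow> norm (dbern0 x) \<le> C * exp (- Re x / 2)" using dbern0_bound by metis
  have "(\<integral>u. hankel_product \<epsilon> s dbern0 (Suc n) x u \<partial>(\<Pi>\<^sub>M k\<in>{1..Suc n}. lborel)) = (\<integral>v. Q v \<partial>lborel)"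
    unfolding Q_def
  proof (rule hankel_product_integral_Suc)
    show "integrable (\<Pi>\<^sub>M k\<in>{1..Suc n}. lborel) (hankel_product \<epsilon> s dbern0 (Suc n) x)"
      by (rule integrable_hankel_product[OF measurable_dbern0 C(2,1) _ _ Suc.prems(2)])
        (use e e1 e2 in auto)
  qed (use mQ in \<open>simp add: Q_def\<close>)
  then have "(\<Prod>k=1..Suc n. prefactor (s k)) * (\<integral>u. hankel_product \<epsilon> s dbern0 (Suc n) x u \<partial>(\<Pi>\<^sub>M k\<in>{1..Suc n}. lborel))
    = prefactor (s (Suc n)) * (\<integral>v. ?P * Q v \<partial>lborel)"
    by (simp add: mult_ac)
  also have "(\<integral>v. ?P * Q v \<partial>lborel) = hankel_value \<epsilon> (s (Suc n)) f x"
    using hQ by (simp only: has_bochner_integral_iff)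
  also have "prefactor (s (Suc n)) * hankel_value \<epsilon> (s (Suc n)) f x = weyl (s (Suc n)) f x"
    unfolding prefactor_def
    by (rule hankel_value_weyl[OF e r3 sub3 f]) (use Suc.prems(1) in auto)
  finally show ?case by (simp add: f_def)
qed

section \<open>The desingularized zeta function\<close>

lemma hankel_integral_eq:
  assumes "c \<noteq> 1"
  shows "hankel_integral n \<epsilon> s c
    = (1 - of_real c) ^ n * (\<integral>u. hankel_product \<epsilon> s (desing_factor c) n 0 u \<partial>(\<Pi>\<^sub>M k\<in>{1..n}. lborel))"
proof -
  have c: "(1 - of_real c :: complex) \<noteq> 0" using assms by simp
  have "desing_H n (\<lambda>k. hankel \<epsilon> (u k)) c * (\<Prod>k=1..n. hankel_powr \<epsilon> (u k) (s k - 1) * vector_derivative (hankel \<epsilon>) (at (u k)))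
     = (1 - of_real c) ^ n * hankel_product \<epsilon> s (desing_factor c) n 0 u" for u
  proof -
    have "desing_H n (\<lambda>k. hankel \<epsilon> (u k)) c = (\<Prod>j=1..n. (1 - of_real c) * desing_factor c (\<Sum>k=j..n. hankel \<epsilon> (u k)))"
      unfolding desing_H_def desing_factor_def using c by (intro prod.cong refl) simp
    also have "\<dots> = (1 - of_real c) ^ n * (\<Prod>j=1..n. desing_factor c (\<Sum>k=j..n. hankel \<epsilon> (u k)))"
      by (simp add: prod.distrib)
    finally show ?thesis by (simp add: hankel_product_def hankel_weight_def)
  qed
  then show ?thesis unfolding hankel_integral_def by simp
qed

lemma desing_approx_eq:
  assumes "c \<noteq> 1"
  shows "desing_approx n \<epsilon> s c
    = (\<Prod>k=1..n. prefactor (s k)) * (\<integral>u. hankel_product \<epsilon> s (desing_factor c) n 0 u \<partial>(\<Pi>\<^sub>M k\<in>{1..n}. lborel))"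
  using assms by (simp add: desing_approx_def hankel_integral_eq prefactor_def monodromy_def)

text \<open>The starting point 0 lies in \<open>strip (1 / 2)\<close>, and the other half of the
  width is the allowance for \<epsilon>. The limit passes under the integral since the majorant in
  \<open>hankel_product_bound\<close> does not depend on c.\<close>

lemma desing_approx_tendsto:
  assumes s: "\<And>k. k \<in> {1..n} \<Longrightarrow> s k \<notin> \<int>" and e: "0 < \<epsilon>" "(real n + 3) * \<epsilon> < 1 / 2"
  shows "(desing_approx n \<epsilon> s \<longlongrightarrow> zdes n s 0) (at 1)"
proof -
  let ?M = "\<Pi>\<^sub>M k\<in>{1..n}. (lborel :: real measure)"
  obtain C where C: "C \<ge> 0"
    "\<And>c x. x \<in> strip 1 \<Longrightarrow> 2 / 3 \<le> c \<Longrightarrow> c \<le> 3 / 2 \<Longrightarrow> c \<noteq> 1 \<Longrightarrow> norm (desing_factor c x) \<le> C * exp (- Re x / 2)"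
    using desing_factor_bound by metis
  have n0: "real n * \<epsilon> \<ge> 0" using e by simp
  have "real n * \<epsilon> + 3 * \<epsilon> < 1 / 2" using e(2) by (simp add: ring_distribs)
  then have e1: "\<epsilon> < 1" "1 / 2 + real n * \<epsilon> \<le> 1" using e(1) n0 by linarith+
  have ev: "\<forall>\<^sub>F c in at 1. 2 / 3 \<le> c \<and> c \<le> 3 / 2 \<and> c \<noteq> (1::real)"
    unfolding eventually_at by (intro exI[of _ "1/3"]) (auto simp: dist_real_def abs_if split: if_splits)
  have "((\<lambda>c. \<integral>u. hankel_product \<epsilon> s (desing_factor c) n 0 u \<partial>?M) \<longlongrightarrow> (\<integral>u. hankel_product \<epsilon> s dbern0 n 0 u \<partial>?M)) (at 1)"
  proof (rule dominated_convergence_at)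
    fix u
    have "(\<Sum>k=j..n. hankel \<epsilon> (u k)) \<in> strip 1" if "j \<ge> 1" for j
    proof -
      have "(\<Sum>k=j..m. hankel \<epsilon> (u k)) \<in> strip (1 / 2 + real m * \<epsilon>)" for m
      proof (induction m)
        case 0
        then show ?case using that by (simp add: strip_def)
      next
        case (Suc m)
        have "(\<Sum>k=j..m. hankel \<epsilon> (u k)) + hankel \<epsilon> (u (Suc m)) \<in> strip (1 / 2 + real m * \<epsilon> + \<epsilon>)"
          by (rule strip_add_hankel[OF Suc e(1)])
        moreover have "(0::complex) \<in> strip (1 / 2 + real (Suc m) * \<epsilon>)"
          using e by (intro zero_in_strip) (simp add: add_pos_nonneg)
        ultimately show ?case by (cases "j \<le> Suc m") (auto simp: algebra_simps)
      qed
      from strip_mono[OF this e1(2)] show ?thesis .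
    qed
    then show "((\<lambda>c. hankel_product \<epsilon> s (desing_factor c) n 0 u) \<longlongrightarrow> hankel_product \<epsilon> s dbern0 n 0 u) (at 1)"
      unfolding hankel_product_def by (intro tendsto_intros desing_factor_tendsto) auto
  next
    show "\<forall>\<^sub>F c in at 1. hankel_product \<epsilon> s (desing_factor c) n 0 \<in> borel_measurable ?M"
      by (intro always_eventually allI measurable_hankel_product measurable_desing_factor)
    show "\<forall>\<^sub>F c in at 1. \<forall>u\<in>space ?M. norm (hankel_product \<epsilon> s (desing_factor c) n 0 u)
        \<le> (C * exp (- Re 0 / 2)) ^ n * (\<Prod>k=1..n. hankel_majorant \<epsilon> s k (u k))"
      using ev
    proof (eventually_elim, intro ballI)
      fix c u assume c: "2 / 3 \<le> c \<and> c \<le> 3 / 2 \<and> c \<noteq> (1::real)"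
      show "norm (hankel_product \<epsilon> s (desing_factor c) n 0 u)
        \<le> (C * exp (- Re 0 / 2)) ^ n * (\<Prod>k=1..n. hankel_majorant \<epsilon> s k (u k))"
        by (rule hankel_product_bound[OF C(2) C(1) e(1) _ e1(2)]) (use c in auto)
    qed
    show "integrable ?M (\<lambda>u. (C * exp (- Re 0 / 2)) ^ n * (\<Prod>k=1..n. hankel_majorant \<epsilon> s k (u k)))"
      by (intro integrable_mult_right integrable_hankel_majorant_prod e e1)
  qed
  then have "((\<lambda>c. (\<Prod>k=1..n. prefactor (s k)) * (\<integral>u. hankel_product \<epsilon> s (desing_factor c) n 0 u \<partial>?M)) \<longlongrightarrow> 
     (\<Prod>k=1..n. prefactor (s k)) * (\<integral>u. hankel_product \<epsilon> s dbern0 n 0 u \<partial>?M)) (at 1)"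
    by (rule tendsto_mult_left)
  also have "(\<Prod>k=1..n. prefactor (s k)) * (\<integral>u. hankel_product \<epsilon> s dbern0 n 0 u \<partial>?M) = zdes n s 0"
    by (rule hankel_product_integral_dbern0[where r = "1 / 2"]) (use s e in auto)
  finally show ?thesis
  proof (rule Lim_transform_eventually)
    show "\<forall>\<^sub>F c in at 1. (\<Prod>k=1..n. prefactor (s k)) * (\<integral>u. hankel_product \<epsilon> s (desing_factor c) n 0 u \<partial>?M) = desing_approx n \<epsilon> s c"
      using ev by eventually_elim (simp add: desing_approx_eq)
  qed
qed

lemma eventually_desing_approx_tendsto:
  assumes "\<forall>k\<in>{1..n}. s k \<notin> \<int>"
  shows "\<forall>\<^sub>F \<epsilon> in at_right 0. (desing_approx n \<epsilon> s \<longlongrightarrow> zdes n s 0) (at 1)"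
  unfolding eventually_at_right_field
proof (intro exI conjI allI impI)
  show "(0::real) < 1 / (2 * (real n + 3))" by simp
  fix \<epsilon> :: real assume e: "0 < \<epsilon>" "\<epsilon> < 1 / (2 * (real n + 3))"
  have "(real n + 3) * \<epsilon> < (real n + 3) * (1 / (2 * (real n + 3)))" using e by (intro mult_strict_left_mono) auto
  also have "\<dots> = 1 / 2" by (simp add: field_simps)
  finally show "(desing_approx n \<epsilon> s \<longlongrightarrow> zdes n s 0) (at 1)"
    using assms e by (intro desing_approx_tendsto) auto
qed

text \<open>Adding i \<eta> to every coordinate makes all of them non-real, hence non-integral, for
  small \<eta> > 0; so every point is a limit of points where F and F' agree.\<close>

lemma entire_eqI:
  fixes F F' :: "(nat \<Rightarrow> complex) \<Rightarrow> complex"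
  assumes F: "continuous_on UNIV F" and F': "continuous_on UNIV F'"
    and eq: "\<And>s. (\<forall>k\<in>{1..n}. s k \<notin> \<int>) \<Longrightarrow> F s = F' s"
  shows "F s = F' s"
proof -
  define h where "h \<eta> = (\<lambda>k. s k + \<i> * of_real \<eta>)" for \<eta> :: real
  have h: "continuous_on UNIV h" unfolding h_def by (intro continuous_on_coordinatewise_then_product continuous_intros)
  have lim: "((\<lambda>\<eta>. H (h \<eta>)) \<longlongrightarrow> H (h 0)) (at_right 0)" if "continuous_on UNIV H" for H :: "(nat \<Rightarrow> complex) \<Rightarrow> complex"
  proof -
    have "continuous_on UNIV (\<lambda>\<eta>. H (h \<eta>))" by (rule continuous_on_compose2[OF that h]) auto
    then have "isCont (\<lambda>\<eta>. H (h \<eta>)) 0" by (simp add: continuous_on_eq_continuous_at)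
    then show ?thesis by (auto simp: isCont_def intro: tendsto_within_subset)
  qed
  have "\<forall>\<^sub>F \<eta> in at_right 0. h \<eta> k \<notin> \<int>" for k
  proof -
    have "\<forall>\<^sub>F \<eta> in at_right 0. \<eta> \<noteq> - Im (s k) \<and> \<eta> \<noteq> 0"
    proof (cases "- Im (s k) > 0")
      case True
      show ?thesis unfolding eventually_at_right_field using True by (intro exI[of _ "- Im (s k)"]) auto
    next
      case False
      show ?thesis unfolding eventually_at_right_field using False by (intro exI[of _ 1]) auto
    qed
    then show ?thesis by eventually_elim (auto simp: h_def complex_eq_iff elim!: Ints_cases)
  qed
  then have "\<forall>\<^sub>F \<eta> in at_right 0. \<forall>k\<in>{1..n}. h \<eta> k \<notin> \<int>" by (intro eventually_ball_finite) auto
  then have "\<forall>\<^sub>F \<eta> in at_right 0. F (h \<eta>) = F' (h \<eta>)" by eventually_elim (rule eq)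
  from Lim_transform_eventually[OF lim[OF F] this] lim[OF F'] have "F (h 0) = F' (h 0)"
    by (rule tendsto_unique[OF trivial_limit_at_right_real])
  then show ?thesis by (simp add: h_def)
qed

text \<open>For uniqueness, at a non-integral point some radius is small enough for both limits,
  which must then coincide; continuity does the rest.\<close>

theorem zeta_des_eq: "zeta_des n = (\<lambda>s. zdes n s 0)"
  unfolding zeta_des_def
proof (rule the_equality)
  show "entire_Cn n (\<lambda>s. zdes n s 0) \<and> (\<forall>s. (\<forall>k\<in>{1..n}. s k \<notin> \<int>) \<longrightarrow>
      (\<forall>\<^sub>F \<epsilon> in at_right 0. (desing_approx n \<epsilon> s \<longlongrightarrow> zdes n s 0) (at 1)))"
    using entire_zdes eventually_desing_approx_tendsto by blast
next
  fix F assume F: "entire_Cn n F \<and> (\<forall>s. (\<forall>k\<in>{1..n}. s k \<notin> \<int>) \<longrightarrow>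
      (\<forall>\<^sub>F \<epsilon> in at_right 0. (desing_approx n \<epsilon> s \<longlongrightarrow> F s) (at 1)))"
  show "F = (\<lambda>s. zdes n s 0)"
  proof
    fix s
    show "F s = zdes n s 0"
    proof (rule entire_eqI[where n = n and F = F and F' = "\<lambda>s. zdes n s 0"])
      show "continuous_on UNIV F" "continuous_on UNIV (\<lambda>s. zdes n s 0)"
        using F entire_zdes[of n] by (auto simp: entire_Cn_def)
      fix s :: "nat \<Rightarrow> complex" assume s: "\<forall>k\<in>{1..n}. s k \<notin> \<int>"
      have "\<forall>\<^sub>F \<epsilon> in at_right 0. (desing_approx n \<epsilon> s \<longlongrightarrow> F s) (at 1)"
        using F s by blast
      then have "\<forall>\<^sub>F \<epsilon> in at_right (0::real). F s = zdes n s 0"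
        using eventually_desing_approx_tendsto[OF s]
        by eventually_elim (rule tendsto_unique[OF at_neq_bot])
      then show "F s = zdes n s 0" by simp
    qed
  qed
qed

section \<open>The Leibniz rule and the product formula\<close>

lemma nderiv_pow_holo: "f holomorphic_on strip r \<Longrightarrow> (nderiv ^^ m) f holomorphic_on strip r"
  by (induction m) (auto intro: nderiv_holo)

lemma nderiv_pow_sum:
  assumes "finite I" "\<And>i. i \<in> I \<Longrightarrow> f i holomorphic_on strip 1" "x \<in> strip 1"
  shows "(nderiv ^^ m) (\<lambda>x. \<Sum>i\<in>I. c i * f i x) x = (\<Sum>i\<in>I. c i * (nderiv ^^ m) (f i) x)"
  using assms(3)
proof (induction m arbitrary: x)
  case (Suc m)
  have "(nderiv ^^ Suc m) (\<lambda>x. \<Sum>i\<in>I. c i * f i x) x = (nderiv ^^ 1) ((nderiv ^^ m) (\<lambda>x. \<Sum>i\<in>I. c i * f i x)) x"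
    by simp
  also have "\<dots> = (nderiv ^^ 1) (\<lambda>x. \<Sum>i\<in>I. c i * (nderiv ^^ m) (f i) x) x"
    by (rule nderiv_cong[OF Suc.IH Suc.prems])
  also have "\<dots> = - deriv (\<lambda>x. \<Sum>i\<in>I. c i * (nderiv ^^ m) (f i) x) x" by (simp add: nderiv_def)
  also have "((\<lambda>x. \<Sum>i\<in>I. c i * (nderiv ^^ m) (f i) x) has_field_derivative (\<Sum>i\<in>I. c i * deriv ((nderiv ^^ m) (f i)) x)) (at x)"
    by (intro DERIV_sum DERIV_cmult holomorphic_derivI[OF nderiv_pow_holo open_strip Suc.prems] assms)
  then have "deriv (\<lambda>x. \<Sum>i\<in>I. c i * (nderiv ^^ m) (f i) x) x = (\<Sum>i\<in>I. c i * deriv ((nderiv ^^ m) (f i)) x)"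
    by (rule DERIV_imp_deriv)
  finally show ?case by (simp only: nderiv_Suc sum_negf mult_minus_right)
qed simp

lemma nderiv_mult:
  assumes "f holomorphic_on strip 1" "g holomorphic_on strip 1" "x \<in> strip 1"
  shows "nderiv (\<lambda>x. f x * g x) x = nderiv f x * g x + f x * nderiv g x"
proof -
  have "((\<lambda>x. f x * g x) has_field_derivative deriv f x * g x + deriv g x * f x) (at x)"
    by (intro DERIV_mult holomorphic_derivI[OF assms(1) open_strip] holomorphic_derivI[OF assms(2) open_strip] assms(3))
  then show ?thesis by (simp add: nderiv_def DERIV_imp_deriv)
qed

text \<open>As \<open>D = nderiv\<close> is a derivation, \<open>D\<close> acts on \<open>g\<close> alone as \<open>D\<close> on the product minus \<open>D\<close> on \<open>f\<close>.\<close>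

lemma sum_nderiv_binomial:
  assumes f: "f holomorphic_on strip 1" and g: "g holomorphic_on strip 1" and x: "x \<in> strip 1"
  shows "(\<Sum>i\<le>l. ((- 1) ^ i * of_nat (l choose i)) * (nderiv ^^ (l - i)) (\<lambda>x. g x * (nderiv ^^ i) f x) x) = f x * (nderiv ^^ l) g x"
  using f x
proof (induction l arbitrary: f x)
  case (Suc l)
  define T where "T i j = (nderiv ^^ j) (\<lambda>x. g x * (nderiv ^^ i) f x)" for i j
  have hT: "T i j holomorphic_on strip 1" for i j
    unfolding T_def by (intro nderiv_pow_holo holomorphic_on_mult g Suc.prems(1))
  have IH: "(\<Sum>i\<le>l. ((- 1) ^ i * of_nat (l choose i)) * T i (l - i) y) = f y * (nderiv ^^ l) g y" if "y \<in> strip 1" for y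
    unfolding T_def by (rule Suc.IH[OF Suc.prems(1) that])
  have "(\<Sum>i\<le>l. ((- 1) ^ i * of_nat (l choose i)) * T (Suc i) (l - i) x) = nderiv f x * (nderiv ^^ l) g x"
    using Suc.IH[OF nderiv_holo[OF Suc.prems(1)] Suc.prems(2)] by (simp add: T_def funpow_swap1)
  moreover have "(\<Sum>i\<le>l. ((- 1) ^ i * of_nat (l choose i)) * T i (Suc l - i) x) = nderiv f x * (nderiv ^^ l) g x + f x * (nderiv ^^ Suc l) g x"
  proof -
    have "(\<Sum>i\<le>l. ((- 1) ^ i * of_nat (l choose i)) * T i (Suc l - i) x)
       = (\<Sum>i\<le>l. ((- 1) ^ i * of_nat (l choose i)) * (nderiv ^^ 1) (T i (l - i)) x)"
      by (intro sum.cong refl) (simp add: T_def Suc_diff_le)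
    also have "\<dots> = (nderiv ^^ 1) (\<lambda>x. \<Sum>i\<le>l. ((- 1) ^ i * of_nat (l choose i)) * T i (l - i) x) x"
      by (rule nderiv_pow_sum[symmetric]) (use hT Suc.prems in auto)
    also have "\<dots> = (nderiv ^^ 1) (\<lambda>x. f x * (nderiv ^^ l) g x) x"
      by (rule nderiv_cong[OF IH Suc.prems(2)])
    also have "\<dots> = nderiv f x * (nderiv ^^ l) g x + f x * (nderiv ^^ Suc l) g x"
      by (simp add: nderiv_mult[OF Suc.prems(1) nderiv_pow_holo[OF g] Suc.prems(2)])
    finally show ?thesis .
  qed
  \<comment> \<open>Pascal's rule; the term i = Suc l disappears because l choose Suc l is
    0.\<close>
  moreover have "(\<Sum>i\<le>Suc l. ((- 1) ^ i * of_nat (Suc l choose i)) * T i (Suc l - i) x)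
     = (\<Sum>i\<le>l. ((- 1) ^ i * of_nat (l choose i)) * T i (Suc l - i) x) - (\<Sum>i\<le>l. ((- 1) ^ i * of_nat (l choose i)) * T (Suc i) (l - i) x)"
  proof -
    have "(\<Sum>i\<le>Suc l. ((- 1) ^ i * of_nat (Suc l choose i)) * T i (Suc l - i) x)
      = T 0 (Suc l) x + (\<Sum>i\<le>l. ((- 1) ^ Suc i * of_nat (Suc l choose Suc i)) * T (Suc i) (l - i) x)"
      by (subst sum.atMost_Suc_shift) simp
    also have "(\<Sum>i\<le>l. ((- 1) ^ Suc i * of_nat (Suc l choose Suc i)) * T (Suc i) (l - i) x)
      = (\<Sum>i\<le>l. ((- 1) ^ Suc i * of_nat (l choose Suc i)) * T (Suc i) (l - i) x) - (\<Sum>i\<le>l. ((- 1) ^ i * of_nat (l choose i)) * T (Suc i) (l - i) x)"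
      unfolding sum_subtractf[symmetric] by (intro sum.cong refl) (simp add: algebra_simps)
    also have "T 0 (Suc l) x + ((\<Sum>i\<le>l. ((- 1) ^ Suc i * of_nat (l choose Suc i)) * T (Suc i) (l - i) x) - (\<Sum>i\<le>l. ((- 1) ^ i * of_nat (l choose i)) * T (Suc i) (l - i) x))
       = (\<Sum>i\<le>Suc l. ((- 1) ^ i * of_nat (l choose i)) * T i (Suc l - i) x) - (\<Sum>i\<le>l. ((- 1) ^ i * of_nat (l choose i)) * T (Suc i) (l - i) x)"
      by (subst sum.atMost_Suc_shift) simp
    also have "(\<Sum>i\<le>Suc l. ((- 1) ^ i * of_nat (l choose i)) * T i (Suc l - i) x) = (\<Sum>i\<le>l. ((- 1) ^ i * of_nat (l choose i)) * T i (Suc l - i) x)"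
      by simp
    finally show ?thesis .
  qed
  ultimately show ?case by (simp add: T_def)
qed simp

text \<open>The operator D^(j_q) \<beta>' ... D^(j_1) \<beta>' applied to f, which is what the last
  q Weyl integrals become at -j_1, ..., -j_q. With f = 1 it yields the second factor of the product
  formula, with f a derivative of \<open>zdes p s\<close> the terms of the sum.\<close>

primrec nderiv_chain :: "nat \<Rightarrow> (nat \<Rightarrow> nat) \<Rightarrow> (complex \<Rightarrow> complex) \<Rightarrow> complex \<Rightarrow> complex" where
  "nderiv_chain 0 j f = f"
| "nderiv_chain (Suc q) j f = (nderiv ^^ j (Suc q)) (\<lambda>x. dbern x * nderiv_chain q j f x)"

lemma dbern_holo_strip: "dbern holomorphic_on strip 1"
  using decaying_holo[OF decaying_dbern] by simp

lemma nderiv_chain_holo: "f holomorphic_on strip 1 \<Longrightarrow> nderiv_chain q j f holomorphic_on strip 1"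
  by (induction q) (auto intro!: nderiv_pow_holo holomorphic_on_mult dbern_holo_strip)

lemma nderiv_chain_cong:
  assumes "\<And>b. b \<in> {1..q} \<Longrightarrow> j b = j' b"
  shows "nderiv_chain q j f = nderiv_chain q j' f"
  using assms by (induction q) auto

text \<open>Equality with \<open>f\<close> is asked only on the strip, as the Weyl identities hold
  only there; since the strip is open, derivatives do not notice the difference.\<close>

lemma zdes_chain:
  assumes base: "\<And>x. x \<in> strip 1 \<Longrightarrow> zdes p s x = f x"
    and s: "\<And>b. b \<in> {1..q} \<Longrightarrow> s (p + b) = - of_nat (j b)" and x: "x \<in> strip 1"
  shows "zdes (p + q) s x = nderiv_chain q j f x"
  using s x
proof (induction q arbitrary: x)
  case (Suc q)
  have "zdes (p + Suc q) s x = weyl (- of_nat (j (Suc q))) (\<lambda>x. dbern x * zdes (p + q) s x) x"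
    using Suc.prems(1)[of "Suc q"] by simp
  also have "\<dots> = (nderiv ^^ j (Suc q)) (\<lambda>x. dbern x * zdes (p + q) s x) x"
    by (rule weyl_minus_nat[OF decaying_dbern_zdes Suc.prems(2)])
  also have "\<dots> = (nderiv ^^ j (Suc q)) (\<lambda>x. dbern x * nderiv_chain q j f x) x"
    by (rule nderiv_cong[OF _ Suc.prems(2)]) (use Suc in auto)
  finally show ?case by simp
qed (use base in auto)

text \<open>Induction on q for all f. The last index y is split off; for fixed y the hypothesis,
  applied to D^y f, sums over the other indices, and \<open>sum_nderiv_binomial\<close> with g =
  \<beta>' times the shorter chain sums over y. All these derivatives accumulate on the innermost f,
  whence the sum of the i_b.\<close>

lemma sum_nderiv_chain:
  assumes "f holomorphic_on strip 1" "x \<in> strip 1"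
  shows "(\<Sum>i\<in>(\<Pi>\<^sub>E b\<in>{1..q}. {..l b}). (\<Prod>a=1..q. (- 1) ^ i a * of_nat (l a choose i a)) *
      nderiv_chain q (\<lambda>b. l b - i b) ((nderiv ^^ (\<Sum>b=1..q. i b)) f) x) = f x * nderiv_chain q l (\<lambda>_. 1) x"
  using assms
proof (induction q arbitrary: f x)
  case (Suc q)
  let ?P = "\<Pi>\<^sub>E b\<in>{1..q}. {..l b}"
  let ?n = "Suc q"
  define co where "co i = (\<Prod>a=1..q. (- 1) ^ i a * of_nat (l a choose i a) :: complex)" for i
  define cn where "cn y = ((- 1) ^ y * of_nat (l ?n choose y) :: complex)" for y
  define W where "W i y = nderiv_chain q (\<lambda>b. l b - i b) ((nderiv ^^ (\<Sum>b=1..q. i b)) ((nderiv ^^ y) f))" for i y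
  have ins: "{1..?n} = insert ?n {1..q}" by auto
  have fin: "finite ?P" by (intro finite_PiE) auto
  have hW: "W i y holomorphic_on strip 1" for i y
    unfolding W_def by (intro nderiv_chain_holo nderiv_pow_holo Suc.prems(1))
  let ?F = "\<lambda>i. (\<Prod>a=1..?n. (- 1) ^ i a * of_nat (l a choose i a)) *
      nderiv_chain ?n (\<lambda>b. l b - i b) ((nderiv ^^ (\<Sum>b=1..?n. i b)) f) x"
  have F: "?F (i(?n := y)) = co i * cn y * (nderiv ^^ (l ?n - y)) (\<lambda>x. dbern x * W i y x) x" for i y
  proof -
    have "(\<Prod>a=1..?n. (- 1) ^ (i(?n := y)) a * of_nat (l a choose (i(?n := y)) a)) = co i * cn y"
    proof -
      have "(\<Prod>a=1..q. (- 1) ^ (i(?n := y)) a * of_nat (l a choose (i(?n := y)) a)) = co i"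
        unfolding co_def by (intro prod.cong) auto
      then show ?thesis by (simp add: cn_def)
    qed
    moreover have "(\<Sum>b=1..?n. (i(?n := y)) b) = (\<Sum>b=1..q. i b) + y"
    proof -
      have "(\<Sum>b=1..q. (i(?n := y)) b) = (\<Sum>b=1..q. i b)" by (intro sum.cong) auto
      then show ?thesis by simp
    qed
    moreover have "nderiv_chain q (\<lambda>b. l b - (i(?n := y)) b) h = nderiv_chain q (\<lambda>b. l b - i b) h" for h
      by (rule nderiv_chain_cong) auto
    ultimately show ?thesis by (simp only: nderiv_chain.simps) (simp add: W_def funpow_add)
  qed
  have "(\<Sum>i\<in>(\<Pi>\<^sub>E b\<in>{1..?n}. {..l b}). ?F i) = (\<Sum>i\<in>(\<lambda>(y, g). g(?n := y)) ` ({..l ?n} \<times> ?P). ?F i)"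
    unfolding ins PiE_insert_eq ..
  also have "\<dots> = (\<Sum>(y, i)\<in>{..l ?n} \<times> ?P. ?F (i(?n := y)))"
    by (subst sum.reindex[OF inj_combinator]) (auto simp: case_prod_unfold o_def)
  also have "\<dots> = (\<Sum>y\<le>l ?n. \<Sum>i\<in>?P. ?F (i(?n := y)))"
    by (rule sum.cartesian_product[symmetric])
  also have "\<dots> = (\<Sum>y\<le>l ?n. cn y * (nderiv ^^ (l ?n - y)) (\<lambda>x. (dbern x * nderiv_chain q l (\<lambda>_. 1) x) * (nderiv ^^ y) f x) x)"
  proof (rule sum.cong[OF refl])
    fix y
    have "(\<Sum>i\<in>?P. ?F (i(?n := y))) = cn y * (\<Sum>i\<in>?P. co i * (nderiv ^^ (l ?n - y)) (\<lambda>x. dbern x * W i y x) x)"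
      unfolding F by (simp add: sum_distrib_left mult_ac)
    also have "(\<Sum>i\<in>?P. co i * (nderiv ^^ (l ?n - y)) (\<lambda>x. dbern x * W i y x) x)
       = (nderiv ^^ (l ?n - y)) (\<lambda>x. \<Sum>i\<in>?P. co i * (dbern x * W i y x)) x"
      by (rule nderiv_pow_sum[symmetric, OF fin holomorphic_on_mult[OF dbern_holo_strip hW] Suc.prems(2)])
    also have "\<dots> = (nderiv ^^ (l ?n - y)) (\<lambda>x. (dbern x * nderiv_chain q l (\<lambda>_. 1) x) * (nderiv ^^ y) f x) x"
    proof (rule nderiv_cong[OF _ Suc.prems(2)])
      fix x assume x: "x \<in> strip 1"
      have "(\<Sum>i\<in>?P. co i * W i y x) = (nderiv ^^ y) f x * nderiv_chain q l (\<lambda>_. 1) x"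
        unfolding co_def W_def by (rule Suc.IH[OF nderiv_pow_holo[OF Suc.prems(1)] x])
      moreover have "(\<Sum>i\<in>?P. co i * (dbern x * W i y x)) = dbern x * (\<Sum>i\<in>?P. co i * W i y x)"
        by (simp add: sum_distrib_left mult_ac)
      ultimately show "(\<Sum>i\<in>?P. co i * (dbern x * W i y x)) = (dbern x * nderiv_chain q l (\<lambda>_. 1) x) * (nderiv ^^ y) f x"
        by (simp add: mult_ac)
    qed
    finally show "(\<Sum>i\<in>?P. ?F (i(?n := y))) = cn y * (nderiv ^^ (l ?n - y)) (\<lambda>x. (dbern x * nderiv_chain q l (\<lambda>_. 1) x) * (nderiv ^^ y) f x) x" .
  qed
  also have "\<dots> = f x * (nderiv ^^ l ?n) (\<lambda>x. dbern x * nderiv_chain q l (\<lambda>_. 1) x) x"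
    unfolding cn_def
    by (rule sum_nderiv_binomial[OF Suc.prems(1) holomorphic_on_mult[OF dbern_holo_strip nderiv_chain_holo] Suc.prems(2)]) auto
  finally show ?case by simp
qed simp

theorem theorem2p7:
  fixes p q :: nat and s :: "nat \<Rightarrow> complex" and l :: "nat \<Rightarrow> nat"
  assumes "p \<ge> 1" and "q \<ge> 1"
  shows "zeta_des p s * zeta_des q (\<lambda>b. - of_nat (l b)) =
    (\<Sum>(i, j) \<in> {(i, j). i \<in> {1..q} \<rightarrow>\<^sub>E (UNIV :: nat set) \<and> j \<in> {1..q} \<rightarrow>\<^sub>E (UNIV :: nat set)
                        \<and> (\<forall>b\<in>{1..q}. i b + j b = l b)}.
       (\<Prod>a=1..q. (-1) ^ i a * of_nat (l a choose i a)) *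
       zeta_des (p + q)
         (\<lambda>k. if k < p then s k
              else if k = p then s p - of_nat (\<Sum>b=1..q. i b)
              else - of_nat (j (k - p))))"
proof -
  let ?s = "\<lambda>i j k. if k < p then s k else if k = p then s p - of_nat (\<Sum>b=1..q. i b) else - of_nat (j (k - p))"
  let ?P = "\<Pi>\<^sub>E b\<in>{1..q}. {..l b}"
  let ?c = "\<lambda>i. \<Prod>a=1..q. (-1) ^ i a * of_nat (l a choose i a) :: complex"
  \<comment> \<open>i determines j = l - i; restricting gives it the value outside {1..q} that the
    extensional function space prescribes.\<close>
  let ?J = "\<lambda>i. restrict (\<lambda>b. l b - i b) {1..q}"
  obtain p' where p: "p = Suc p'" using assms(1) by (cases p) auto
  have z: "(0::complex) \<in> strip 1" by simp
  \<comment> \<open>s_p belongs to the outermost Weyl integral of \<open>zdes p\<close>, so lowering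
    it by the sum of the i_b differentiates \<open>zdes p s\<close> that many times; the q later
    arguments then act as a chain.\<close>
  have eval: "zdes (p + q) (?s i j) 0 = nderiv_chain q j ((nderiv ^^ (\<Sum>b=1..q. i b)) (zdes p s)) 0" for i j
  proof (rule zdes_chain[OF _ _ z])
    fix x assume x: "x \<in> strip 1"
    have "zdes p' (?s i j) = zdes p' s" by (rule zdes_cong) (auto simp: p)
    then have "zdes p (?s i j) x = weyl (s p - of_nat (\<Sum>b=1..q. i b)) (\<lambda>x. dbern x * zdes p' s x) x"
      by (simp add: p)
    also have "\<dots> = (nderiv ^^ (\<Sum>b=1..q. i b)) (zdes p s) x"
      unfolding weyl_shift_nat[OF decaying_dbern_zdes x] by (simp add: p)
    finally show "zdes p (?s i j) x = (nderiv ^^ (\<Sum>b=1..q. i b)) (zdes p s) x" .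
  qed auto
  have hol: "zdes p s holomorphic_on strip 1"
    using decaying_holo[OF decaying_weyl1[OF decaying_dbern_zdes]] by (simp add: p)
  have "zdes (0 + q) (\<lambda>b. - of_nat (l b)) 0 = nderiv_chain q l (\<lambda>_. 1) 0"
    by (rule zdes_chain[OF _ _ z]) auto
  then have "zeta_des p s * zeta_des q (\<lambda>b. - of_nat (l b)) = zdes p s 0 * nderiv_chain q l (\<lambda>_. 1) 0"
    by (simp add: zeta_des_eq)
  also have "\<dots> = (\<Sum>i\<in>?P. ?c i * nderiv_chain q (\<lambda>b. l b - i b) ((nderiv ^^ (\<Sum>b=1..q. i b)) (zdes p s)) 0)"
    by (rule sum_nderiv_chain[OF hol z, symmetric])
  also have "\<dots> = (\<Sum>i\<in>?P. ?c i * zeta_des (p + q) (?s i (?J i)))"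
  proof (intro sum.cong refl arg_cong2[of _ _ _ _ "(*)"])
    fix i
    have "nderiv_chain q (?J i) h = nderiv_chain q (\<lambda>b. l b - i b) h" for h
      by (rule nderiv_chain_cong) auto
    then show "nderiv_chain q (\<lambda>b. l b - i b) ((nderiv ^^ (\<Sum>b=1..q. i b)) (zdes p s)) 0 = zeta_des (p + q) (?s i (?J i))"
      unfolding zeta_des_eq eval by simp
  qed
  also have "\<dots> = (\<Sum>(i, j)\<in>(\<lambda>i. (i, ?J i)) ` ?P. ?c i * zeta_des (p + q) (?s i j))"
    by (subst sum.reindex) (auto simp: inj_on_def simp del: One_nat_def)
  also have "(\<lambda>i. (i, ?J i)) ` ?P = {(i, j). i \<in> {1..q} \<rightarrow>\<^sub>E (UNIV :: nat set) \<and> j \<in> {1..q} \<rightarrow>\<^sub>E (UNIV :: nat set)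
                        \<and> (\<forall>b\<in>{1..q}. i b + j b = l b)}" (is "?L = ?R")
  proof (intro set_eqI iffI)
    fix ij assume "ij \<in> ?L"
    then obtain i where i: "i \<in> ?P" "ij = (i, ?J i)" by blast
    have "i b \<le> l b" if "b \<in> {1..q}" for b using PiE_mem[OF i(1) that] by simp
    then show "ij \<in> ?R" using i by (auto simp: PiE_iff extensional_def)
  next
    fix ij assume "ij \<in> ?R"
    then obtain i j where ij: "ij = (i, j)" "i \<in> {1..q} \<rightarrow>\<^sub>E UNIV" "j \<in> {1..q} \<rightarrow>\<^sub>E UNIV" "\<And>b. b \<in> {1..q} \<Longrightarrow> i b + j b = l b"
      by blast
    have "i \<in> ?P"
    proof (rule PiE_I)
      fix b assume "b \<in> {1..q}"
      from ij(4)[OF this] show "i b \<in> {..l b}" by simp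
    qed (rule PiE_arb[OF ij(2)])
    moreover have "j = ?J i"
    proof
      fix b show "j b = ?J i b"
      proof (cases "b \<in> {1..q}")
        case True
        from ij(4)[OF this] True show ?thesis by simp
      next
        case False
        then show ?thesis using PiE_arb[OF ij(3)] by (simp only: restrict_def if_False)
      qed
    qed
    ultimately show "ij \<in> ?L" using ij(1) by blast
  qed
  finally show ?thesis .
qed

end
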